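(* Let $G$ be a finitely generated group and $\mathcal{D}$ an irreducible deformation space of $G$-trees. If either (1) $\mathcal{D}$ is non-ascending, or (2) $\mathcal{D}$ is locally finite and $b_1(\mathcal{D})\le 1$, then the deformation retract $W\subset\mathcal{D}$ is finite dimensional.
   Context: A $G$-tree is a simplicial tree $T$ with an action of $G$ by simplicial automorphisms without inversions; it is always assumed minimal (no proper invariant subtree), so $T/G$ is a finite graph. Two $G$-trees are identified if there is a $G$-equivariant simplicial isomorphism between them. For an oriented edge $e$, $o(e)$ and $t(e)$ are its initial and terminal vertices and $\bar e$ is the reversed edge; $G_v,G_e$ denote stabilizers; $E_o(v)$ is the set of oriented edges with initial vertex $v$. $T$ is irreducible if $G$ fixes neither an end nor a pair of ends of $T$. An edge $e$ is collapsible if $o(e)$ and $t(e)$ are not in the same $G$-orbit and $G_e=G_{o(e)}$ or $G_e=G_{t(e)}$; then $T_e$ is the $G$-tree obtained by contracting each edge of $Ge\cup G\bar e$ to a point (a collapse move). $T$ is reduced if it has no collapsible edge. A subgroup of $G$ is elliptic in $T$ if it fixes a point of $T$. A deformation space $\mathcal{D}$ of $G$-trees is the set of all metric $G$-trees having the same elliptic subgroups as a given $G$-tree, modulo $G$-equivariant isometry and rescaling. $\mathcal{D}$ is irreducible if its $G$-trees are irreducible; locally finite if its $G$-trees are locally finite trees; non-ascending if for no $T\in\mathcal{D}$ does the quotient graph of groups $T/G$ contain an ascending loop, i.e. a one-edge loop in which one of the two inclusions of the edge group into the vertex group is an isomorphism and the other is a proper inclusion. (The first two properties hold for all trees of $\mathcal{D}$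 as soon as they hold for one.) The homotopy type of the graph $T/G$ is the same for all $T\in\mathcal{D}$, and $b_1(\mathcal{D})$ denotes the first Betti number of $T/G$ for any $T\in\mathcal{D}$. $\mathcal{C}ol(\mathcal{D})$ is the poset of $G$-trees in $\mathcal{D}$ regarded as simplicial trees (with no subdivision vertices, i.e. no vertex $v$ with $E_o(v)=\{e,f\}$ and $G_e=G_v=G_f$), where $T'\ge T$ if $T$ is obtained from $T'$ by a finite (possibly empty) sequence of collapse moves. For $T\in\mathcal{C}ol(\mathcal{D})$ let $\mathrm{red}(T)=\{T'\le T : T'\text{ is reduced}\}$. An edge $e$ of $T$ is surviving if there is $T'\in\mathrm{red}(T)$ such that $e$ is not collapsed in $T\to T'$, and non-surviving otherwise. $T_{\mathcal{W}}$ is the $G$-tree obtained from $T$ by collapsing all non-surviving edges; equivalently the unique minimal element of $\{T'\le T : \mathrm{red}(T')=\mathrm{red}(T)\}$. $W$ is the geometric realization (order complex) of the subposet $\{T_{\mathcal{W}} : T\in\mathcal{C}ol(\mathcal{D})\}$ of $\mathcal{C}ol(\mathcal{D})$. *)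

theory Defs
  imports
    Complex_Main
    "HOL-Library.Function_Algebras"
    "HOL-Algebra.Group_Action"
    "HOL-Algebra.Generated_Groups"
begin

definition finitely_generated_group :: "('g, 'b) monoid_scheme \<Rightarrow> bool" where
  "finitely_generated_group G \<longleftrightarrow>
     group G \<and> (\<exists>S. finite S \<and> S \<subseteq> carrier G \<and> generate G S = carrier G)"

section \<open>Simplicial G-trees\<close>

text \<open>
  A simplicial tree has neither loops nor multiple edges, so an oriented edge is an ordered pair
  of adjacent vertices: its origin is \<open>fst\<close>, its terminus \<open>snd\<close>, and reversal is \<open>prod.swap\<close>.
\<close>

definition is_tree :: "'v set \<Rightarrow> ('v \<times> 'v) set \<Rightarrow> bool" where
  "is_tree V E \<longleftrightarrow>
     V \<noteq> {} \<and> E \<subseteq> V \<times> V \<and> sym E \<and> irrefl E \<and>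
     (\<forall>u\<in>V. \<forall>v\<in>V. (u, v) \<in> E\<^sup>*) \<and>
     \<not> (\<exists>vs. 3 \<le> length vs \<and> distinct vs \<and>
            successively (\<lambda>u v. (u, v) \<in> E) vs \<and> (last vs, hd vs) \<in> E)"

record ('g, 'v) gtree =
  verts :: "'v set"
  edges :: "('v \<times> 'v) set"
  act   :: "'g \<Rightarrow> 'v \<Rightarrow> 'v"

definition edge_act :: "('g, 'v) gtree \<Rightarrow> 'g \<Rightarrow> 'v \<times> 'v \<Rightarrow> 'v \<times> 'v" where
  "edge_act T g = map_prod (act T g) (act T g)"

definition acts_by_automorphisms :: "('g, 'b) monoid_scheme \<Rightarrow> ('g, 'v) gtree \<Rightarrow> bool" where
  "acts_by_automorphisms G T \<longleftrightarrow>
     group_action G (verts T) (act T) \<and>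
     (\<forall>g\<in>carrier G. \<forall>e\<in>edges T. edge_act T g e \<in> edges T)"

definition without_inversions :: "('g, 'b) monoid_scheme \<Rightarrow> ('g, 'v) gtree \<Rightarrow> bool" where
  "without_inversions G T \<longleftrightarrow>
     (\<forall>g\<in>carrier G. \<forall>e\<in>edges T. edge_act T g e \<noteq> prod.swap e)"

definition minimal_gtree :: "('g, 'b) monoid_scheme \<Rightarrow> ('g, 'v) gtree \<Rightarrow> bool" where
  "minimal_gtree G T \<longleftrightarrow>
     (\<forall>S F. S \<subseteq> verts T \<and> F \<subseteq> edges T \<and> is_tree S F \<and>
        (\<forall>g\<in>carrier G. act T g ` S \<subseteq> S \<and> edge_act T g ` F \<subseteq> F)
        \<longrightarrow> S = verts T \<and> F = edges T)"

definition is_gtree :: "('g, 'b) monoid_scheme \<Rightarrow> ('g, 'v) gtree \<Rightarrow> bool" where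
  "is_gtree G T \<longleftrightarrow>
     is_tree (verts T) (edges T) \<and> acts_by_automorphisms G T \<and>
     without_inversions G T \<and> minimal_gtree G T"

abbreviation vertex_stab :: "('g, 'b) monoid_scheme \<Rightarrow> ('g, 'v) gtree \<Rightarrow> 'v \<Rightarrow> 'g set" where
  "vertex_stab G T v \<equiv> stabilizer G (act T) v"

abbreviation edge_stab :: "('g, 'b) monoid_scheme \<Rightarrow> ('g, 'v) gtree \<Rightarrow> 'v \<times> 'v \<Rightarrow> 'g set" where
  "edge_stab G T e \<equiv> stabilizer G (edge_act T) e"

definition edges_from :: "('g, 'v) gtree \<Rightarrow> 'v \<Rightarrow> ('v \<times> 'v) set" where
  "edges_from T v = {e \<in> edges T. fst e = v}"

definition same_orbit :: "('g, 'b) monoid_scheme \<Rightarrow> ('g, 'v) gtree \<Rightarrow> 'v \<Rightarrow> 'v \<Rightarrow> bool" where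
  "same_orbit G T u v \<longleftrightarrow> (\<exists>g\<in>carrier G. act T g u = v)"

definition no_subdivision_vertices :: "('g, 'b) monoid_scheme \<Rightarrow> ('g, 'v) gtree \<Rightarrow> bool" where
  "no_subdivision_vertices G T \<longleftrightarrow>
     \<not> (\<exists>v\<in>verts T. \<exists>e f. e \<noteq> f \<and> edges_from T v = {e, f} \<and>
           edge_stab G T e = vertex_stab G T v \<and> vertex_stab G T v = edge_stab G T f)"

definition locally_finite_gtree :: "('g, 'v) gtree \<Rightarrow> bool" where
  "locally_finite_gtree T \<longleftrightarrow> (\<forall>v\<in>verts T. finite (edges_from T v))"

text \<open>
  The quantifier ranges over oriented edges, so both orientations of a loop are covered.
  The two inclusions of the edge group of the loop into its vertex group are, up to conjugation,
  the inclusions of \<open>G\<^sub>e\<close> into the stabilizers of the two endpoints of \<open>e\<close>.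
\<close>

definition has_ascending_loop :: "('g, 'b) monoid_scheme \<Rightarrow> ('g, 'v) gtree \<Rightarrow> bool" where
  "has_ascending_loop G T \<longleftrightarrow>
     (\<exists>e\<in>edges T. same_orbit G T (fst e) (snd e) \<and>
        edge_stab G T e = vertex_stab G T (fst e) \<and>
        edge_stab G T e \<subset> vertex_stab G T (snd e))"

text \<open>
  A subgroup fixing an interior point of an edge fixes both of its endpoints, as there are no
  inversions; so fixing a point of the tree means fixing a vertex.
\<close>

definition elliptic :: "('g, 'v) gtree \<Rightarrow> 'g set \<Rightarrow> bool" where
  "elliptic T H \<longleftrightarrow> (\<exists>v\<in>verts T. \<forall>h\<in>H. act T h v = v)"

section \<open>Ends\<close>

definition ray :: "('g, 'v) gtree \<Rightarrow> (nat \<Rightarrow> 'v) \<Rightarrow> bool" where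
  "ray T r \<longleftrightarrow> inj r \<and> (\<forall>i. r i \<in> verts T \<and> (r i, r (Suc i)) \<in> edges T)"

definition cofinal_rays :: "(nat \<Rightarrow> 'v) \<Rightarrow> (nat \<Rightarrow> 'v) \<Rightarrow> bool" where
  "cofinal_rays r s \<longleftrightarrow> (\<exists>m n. \<forall>k. r (m + k) = s (n + k))"

definition ends :: "('g, 'v) gtree \<Rightarrow> (nat \<Rightarrow> 'v) set set" where
  "ends T = {{s. ray T s \<and> cofinal_rays r s} | r. ray T r}"

definition end_act :: "('g, 'v) gtree \<Rightarrow> 'g \<Rightarrow> (nat \<Rightarrow> 'v) set \<Rightarrow> (nat \<Rightarrow> 'v) set" where
  "end_act T g \<epsilon> = (\<lambda>r. act T g \<circ> r) ` \<epsilon>"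

definition irreducible_gtree :: "('g, 'b) monoid_scheme \<Rightarrow> ('g, 'v) gtree \<Rightarrow> bool" where
  "irreducible_gtree G T \<longleftrightarrow>
     \<not> (\<exists>\<epsilon>\<in>ends T. \<forall>g\<in>carrier G. end_act T g \<epsilon> = \<epsilon>) \<and>
     \<not> (\<exists>\<epsilon>\<in>ends T. \<exists>\<delta>\<in>ends T. \<epsilon> \<noteq> \<delta> \<and>
          (\<forall>g\<in>carrier G. {end_act T g \<epsilon>, end_act T g \<delta>} = {\<epsilon>, \<delta>}))"

section \<open>First Betti number of the quotient graph\<close>

text \<open>
  Vertices and oriented edges of \<open>T/G\<close> are orbits.  If \<open>X\<close> is the orbit of \<open>e\<close>, then \<open>fst ` X\<close> is
  the orbit of the origin of \<open>e\<close> and \<open>prod.swap ` X\<close> is the orbit of the reversed edge.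

  Since a graph has no 2-cells, its first homology with real coefficients is the space of
  1-cycles: finitely supported functions on oriented edges, antisymmetric under reversal, whose
  boundary vanishes.
\<close>

definition quotient_verts :: "('g, 'b) monoid_scheme \<Rightarrow> ('g, 'v) gtree \<Rightarrow> 'v set set" where
  "quotient_verts G T = orbits G (verts T) (act T)"

definition quotient_edges :: "('g, 'b) monoid_scheme \<Rightarrow> ('g, 'v) gtree \<Rightarrow> ('v \<times> 'v) set set" where
  "quotient_edges G T = orbits G (edges T) (edge_act T)"

definition quotient_cycles ::
    "('g, 'b) monoid_scheme \<Rightarrow> ('g, 'v) gtree \<Rightarrow> (('v \<times> 'v) set \<Rightarrow> real) set" where
  "quotient_cycles G T =
     {c. finite {X. c X \<noteq> 0} \<and> {X. c X \<noteq> 0} \<subseteq> quotient_edges G T \<and>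
         (\<forall>X\<in>quotient_edges G T. c (prod.swap ` X) = - c X) \<and>
         (\<forall>Y\<in>quotient_verts G T. (\<Sum>X | c X \<noteq> 0 \<and> fst ` X = Y. c X) = 0)}"

definition fun_scale :: "real \<Rightarrow> ('a \<Rightarrow> real) \<Rightarrow> 'a \<Rightarrow> real" where
  "fun_scale a c = (\<lambda>x. a * c x)"

lemma vector_space_fun_scale: "vector_space fun_scale"
  by unfold_locales (auto simp: fun_scale_def fun_eq_iff algebra_simps)

text \<open>
  \<open>dim\<close> is 0 on infinite-dimensional spaces; this does not occur here, since \<open>T/G\<close> is a finite
  graph when \<open>G\<close> is finitely generated.
\<close>

definition quotient_betti1 :: "('g, 'b) monoid_scheme \<Rightarrow> ('g, 'v) gtree \<Rightarrow> nat" where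
  "quotient_betti1 G T = vector_space.dim fun_scale (quotient_cycles G T)"

section \<open>Equivariant isomorphisms and collapses\<close>

definition equivariant ::
    "('g, 'b) monoid_scheme \<Rightarrow> ('g, 'v) gtree \<Rightarrow> ('g, 'v) gtree \<Rightarrow> ('v \<Rightarrow> 'v) \<Rightarrow> bool" where
  "equivariant G T T' f \<longleftrightarrow> (\<forall>g\<in>carrier G. \<forall>v\<in>verts T. f (act T g v) = act T' g (f v))"

definition gtree_isomorphism ::
    "('g, 'b) monoid_scheme \<Rightarrow> ('g, 'v) gtree \<Rightarrow> ('g, 'v) gtree \<Rightarrow> ('v \<Rightarrow> 'v) \<Rightarrow> bool" where
  "gtree_isomorphism G T T' f \<longleftrightarrow>
     bij_betw f (verts T) (verts T') \<and>
     (\<forall>u\<in>verts T. \<forall>v\<in>verts T. (f u, f v) \<in> edges T' \<longleftrightarrow> (u, v) \<in> edges T) \<and>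
     equivariant G T T' f"

definition iso_class :: "('g, 'b) monoid_scheme \<Rightarrow> ('g, 'v) gtree \<Rightarrow> ('g, 'v) gtree set" where
  "iso_class G T = {T'. is_gtree G T' \<and> (\<exists>f. gtree_isomorphism G T T' f)}"

text \<open>
  \<open>contraction G F T T' f\<close>: the G-tree \<open>T'\<close> is the result of contracting each edge in the invariant
  symmetric set \<open>F\<close> to a point, with quotient map \<open>f\<close>.  This determines \<open>T'\<close> up to isomorphism.
\<close>

definition contraction ::
    "('g, 'b) monoid_scheme \<Rightarrow> ('v \<times> 'v) set \<Rightarrow> ('g, 'v) gtree \<Rightarrow> ('g, 'v) gtree \<Rightarrow>
     ('v \<Rightarrow> 'v) \<Rightarrow> bool" where
  "contraction G F T T' f \<longleftrightarrow>
     is_gtree G T' \<and> equivariant G T T' f \<and>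
     f ` verts T = verts T' \<and>
     (\<forall>u\<in>verts T. \<forall>v\<in>verts T. f u = f v \<longleftrightarrow> (u, v) \<in> F\<^sup>*) \<and>
     edges T' = map_prod f f ` (edges T - F)"

definition collapsible :: "('g, 'b) monoid_scheme \<Rightarrow> ('g, 'v) gtree \<Rightarrow> 'v \<times> 'v \<Rightarrow> bool" where
  "collapsible G T e \<longleftrightarrow>
     e \<in> edges T \<and> \<not> same_orbit G T (fst e) (snd e) \<and>
     (edge_stab G T e = vertex_stab G T (fst e) \<or> edge_stab G T e = vertex_stab G T (snd e))"

definition reduced :: "('g, 'b) monoid_scheme \<Rightarrow> ('g, 'v) gtree \<Rightarrow> bool" where
  "reduced G T \<longleftrightarrow> \<not> (\<exists>e. collapsible G T e)"

definition collapse_move ::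
    "('g, 'b) monoid_scheme \<Rightarrow> ('g, 'v) gtree \<Rightarrow> ('g, 'v) gtree \<Rightarrow> ('v \<Rightarrow> 'v) \<Rightarrow> bool" where
  "collapse_move G T T' f \<longleftrightarrow>
     (\<exists>e. collapsible G T e \<and>
        contraction G (orbit G (edge_act T) e \<union> orbit G (edge_act T) (prod.swap e)) T T' f)"

text \<open>
  \<open>collapse_map G T T' f\<close>: \<open>f\<close> is the composite map \<open>T \<rightarrow> T'\<close> of a finite, possibly empty, sequence of
  collapse moves.  G-trees are identified when they are isomorphic, so the empty sequence may
  end in any tree isomorphic to \<open>T\<close>.
\<close>

inductive collapse_map ::
    "('g, 'b) monoid_scheme \<Rightarrow> ('g, 'v) gtree \<Rightarrow> ('g, 'v) gtree \<Rightarrow> ('v \<Rightarrow> 'v) \<Rightarrow> bool"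
  for G T where
  iso: "is_gtree G T \<Longrightarrow> is_gtree G T' \<Longrightarrow> gtree_isomorphism G T T' f \<Longrightarrow> collapse_map G T T' f"
| step: "collapse_map G T T' f \<Longrightarrow> collapse_move G T' T'' h \<Longrightarrow> collapse_map G T T'' (h \<circ> f)"

definition dominates ::
    "('g, 'b) monoid_scheme \<Rightarrow> ('g, 'v) gtree \<Rightarrow> ('g, 'v) gtree \<Rightarrow> bool" where
  "dominates G T T' \<longleftrightarrow> (\<exists>f. collapse_map G T T' f)"

section \<open>Deformation spaces\<close>

definition metric_gtree ::
    "('g, 'b) monoid_scheme \<Rightarrow> ('g, 'v) gtree \<Rightarrow> ('v \<times> 'v \<Rightarrow> real) \<Rightarrow> bool" where
  "metric_gtree G T l \<longleftrightarrow>
     is_gtree G T \<and>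
     (\<forall>e\<in>edges T. l e > 0 \<and> l (prod.swap e) = l e \<and>
        (\<forall>g\<in>carrier G. l (edge_act T g e) = l e))"

text \<open>
  A deformation space is represented by the set of all metric G-trees (simplicial G-tree plus
  invariant edge lengths) that represent its points.  Passing to classes modulo equivariant
  isometry and rescaling is not needed: the properties of the space used below are invariant
  under it, and the members of the collapse poset are taken up to isomorphism.
\<close>

type_synonym ('g, 'v) defspace = "(('g, 'v) gtree \<times> ('v \<times> 'v \<Rightarrow> real)) set"

definition deformation_space ::
    "('g, 'b) monoid_scheme \<Rightarrow> ('g, 'v) gtree \<Rightarrow> ('g, 'v) defspace" where
  "deformation_space G T0 =
     {(T, l). metric_gtree G T l \<and> (\<forall>H. subgroup H G \<longrightarrow> (elliptic T H \<longleftrightarrow> elliptic T0 H))}"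

definition irreducible_space :: "('g, 'b) monoid_scheme \<Rightarrow> ('g, 'v) defspace \<Rightarrow> bool" where
  "irreducible_space G D \<longleftrightarrow> (\<forall>(T, l)\<in>D. irreducible_gtree G T)"

definition locally_finite_space :: "('g, 'v) defspace \<Rightarrow> bool" where
  "locally_finite_space D \<longleftrightarrow> (\<forall>(T, l)\<in>D. locally_finite_gtree T)"

definition non_ascending_space :: "('g, 'b) monoid_scheme \<Rightarrow> ('g, 'v) defspace \<Rightarrow> bool" where
  "non_ascending_space G D \<longleftrightarrow> \<not> (\<exists>(T, l)\<in>D. has_ascending_loop G T)"

section \<open>The collapse poset and the complex \<open>W\<close>\<close>

text \<open>
  \<open>Col_trees\<close> consists of all representatives of the elements of the poset \<open>Col(D)\<close>, whose elements
  proper are isomorphism classes; \<open>red_trees\<close> is likewise the set of representatives of \<open>red(T)\<close>.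
\<close>

definition Col_trees :: "('g, 'b) monoid_scheme \<Rightarrow> ('g, 'v) defspace \<Rightarrow> ('g, 'v) gtree set" where
  "Col_trees G D = {T. (\<exists>l. (T, l) \<in> D) \<and> no_subdivision_vertices G T}"

definition Col_le ::
    "('g, 'b) monoid_scheme \<Rightarrow> ('g, 'v) gtree set \<Rightarrow> ('g, 'v) gtree set \<Rightarrow> bool" where
  "Col_le G X Y \<longleftrightarrow> (\<exists>T\<in>X. \<exists>T'\<in>Y. dominates G T' T)"

definition red_trees ::
    "('g, 'b) monoid_scheme \<Rightarrow> ('g, 'v) defspace \<Rightarrow> ('g, 'v) gtree \<Rightarrow> ('g, 'v) gtree set" where
  "red_trees G D T = {T' \<in> Col_trees G D. dominates G T T' \<and> reduced G T'}"

definition surviving ::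
    "('g, 'b) monoid_scheme \<Rightarrow> ('g, 'v) defspace \<Rightarrow> ('g, 'v) gtree \<Rightarrow> 'v \<times> 'v \<Rightarrow> bool" where
  "surviving G D T e \<longleftrightarrow>
     (\<exists>T'\<in>red_trees G D T. \<exists>f. collapse_map G T T' f \<and> f (fst e) \<noteq> f (snd e))"

text \<open>\<open>is_TW G D T T'\<close>: \<open>T'\<close> is a copy of the tree obtained from \<open>T\<close> by collapsing all non-surviving edges.\<close>

definition is_TW ::
    "('g, 'b) monoid_scheme \<Rightarrow> ('g, 'v) defspace \<Rightarrow> ('g, 'v) gtree \<Rightarrow> ('g, 'v) gtree \<Rightarrow> bool" where
  "is_TW G D T T' \<longleftrightarrow> (\<exists>f. contraction G {e \<in> edges T. \<not> surviving G D T e} T T' f)"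

definition W_poset :: "('g, 'b) monoid_scheme \<Rightarrow> ('g, 'v) defspace \<Rightarrow> ('g, 'v) gtree set set" where
  "W_poset G D = {iso_class G T' | T T'. T \<in> Col_trees G D \<and> is_TW G D T T'}"

definition order_complex :: "('a \<Rightarrow> 'a \<Rightarrow> bool) \<Rightarrow> 'a set \<Rightarrow> 'a set set" where
  "order_complex R P =
     {\<sigma>. \<sigma> \<subseteq> P \<and> finite \<sigma> \<and> \<sigma> \<noteq> {} \<and> Complete_Partial_Order.chain R \<sigma>}"

definition finite_dimensional_complex :: "'a set set \<Rightarrow> bool" where
  "finite_dimensional_complex K \<longleftrightarrow> (\<exists>n. \<forall>\<sigma>\<in>K. card \<sigma> \<le> Suc n)"

definition W_complex ::
    "('g, 'b) monoid_scheme \<Rightarrow> ('g, 'v) defspace \<Rightarrow> ('g, 'v) gtree set set set" where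
  "W_complex G D = order_complex (Col_le G) (W_poset G D)"

end

theory Submission
  imports Defs
begin

text \<open>
  A collapse move strictly lowers the number of vertices of the quotient graph, so the dimension of
  \<open>W\<close> is bounded by the number of vertices of \<open>T/G\<close> for the trees \<open>T\<close> all of whose edges survive.
  Counting mod 2 cochains shows that \<open>T/G\<close> has at most \<open>|S|\<close> more edges than vertices, for a generating set \<open>S\<close>; hence
  it suffices to bound the number of vertices of valence at most 2. Let \<open>v\<close> be one of them. If \<open>G\<^sub>v\<close>
  fixes no edge at \<open>v\<close>, then \<open>G\<^sub>v\<close> is a maximal elliptic subgroup with a unique fixed point, and the number
  of conjugacy classes of those depends only on the deformation space. \<open>G\<^sub>v\<close> cannot fix two edges at
  \<open>v\<close>, because there are no subdivision vertices. If it fixes exactly one edge \<open>e\<close>, then in a reduced tree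
  in which \<open>e\<close> survives \<open>e\<close> becomes an ascending loop. This is impossible when the space is
  non-ascending. When \<open>b\<^sub>1 \<le> 1\<close>, all such vertices lie on one and the same circle of \<open>T/G\<close>, along
  which the stabilizers grow by a factor of at least 2 at each of them, and the total growth is a value of
  the modular function, bounded by its values at the generators.
\<close>

section \<open>Paths in trees\<close>

text \<open>Survival is exploited through a reduced tree \<open>R\<close> below the given one. Both
  have the same elliptic subgroups, so the stabilizer of a vertex of \<open>R\<close> fixes a vertex
  upstairs, and then also one in the fibre. If \<open>(v, u)\<close> is the only edge at
  \<open>v\<close> fixed by the stabilizer of \<open>v\<close> and leaves the fibre of
  \<open>v\<close>, this fixed vertex must be \<open>v\<close> itself, since the path to it would
  have to start with \<open>(v, u)\<close>. So the stabilizer of \<open>v\<close> does not grow,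
  which turns the edge into a loop. Vertices of neither exceptional kind have valence at least 3 in
  the quotient, whence the factor 3 in the bound. In the locally finite case one ascending loop
  gives by itself no bound on the number of exceptional vertices on it. The logarithm of the index
  ratio of stabilizers is a potential with invariant increments, so its integral along a path
  depends only on the chain traced in the quotient. The cycle of the loop has coefficient 1 at a
  surviving edge; when all cycles are proportional, every period is therefore an integer multiple of
  that of the loop. Some generator has a nonzero period, which then dominates the period of the
  loop.\<close>

definition simple_path :: "('v \<times> 'v) set \<Rightarrow> 'v \<Rightarrow> 'v list \<Rightarrow> 'v \<Rightarrow> bool" where
  "simple_path E u xs v \<longleftrightarrow> xs \<noteq> [] \<and> distinct xs \<and> hd xs = u \<and> last xs = v \<and>
     successively (\<lambda>x y. (x, y) \<in> E) xs"

lemma simple_path_Cons_iff: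
  "simple_path E u (x # xs) v \<longleftrightarrow>
     x = u \<and> (if xs = [] then u = v else u \<notin> set xs \<and> (u, hd xs) \<in> E \<and> simple_path E (hd xs) xs v)"
  by (auto simp: simple_path_def successively_Cons)

lemma simple_path_Cons:
  "simple_path E y xs v \<Longrightarrow> (x, y) \<in> E \<Longrightarrow> x \<notin> set xs \<Longrightarrow> simple_path E x (x # xs) v"
  by (cases xs) (auto simp: simple_path_def)

lemma simple_path_mono: "simple_path E u xs v \<Longrightarrow> E \<subseteq> F \<Longrightarrow> simple_path F u xs v"
  unfolding simple_path_def by (auto elim: successively_mono)

lemma simple_path_prefix: "simple_path E u (xs @ y # ys) v \<Longrightarrow> simple_path E u (xs @ [y]) y"
  by (auto simp: simple_path_def successively_append_iff hd_append split: if_splits)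

lemma simple_path_suffix: "simple_path E u (xs @ y # ys) v \<Longrightarrow> simple_path E y (y # ys) v"
  by (auto simp: simple_path_def successively_append_iff)

lemma simple_path_rev: "simple_path E u xs v \<Longrightarrow> sym E \<Longrightarrow> simple_path E v (rev xs) u"
  unfolding simple_path_def by (auto simp: hd_rev last_rev elim!: successively_mono dest: symD)

lemma simple_path_edge: "(u, v) \<in> E \<Longrightarrow> u \<noteq> v \<Longrightarrow> simple_path E u [u, v] v"
  by (simp add: simple_path_def)

lemma simple_path_append:
  assumes "simple_path E u xs v" "simple_path E v (v # ys) w" "set xs \<inter> set ys = {}"
  shows "simple_path E u (xs @ ys) w"
  using assms by (cases ys) (auto simp: simple_path_def successively_append_iff successively_Cons)

lemma rtrancl_imp_simple_path: "(u, v) \<in> F\<^sup>* \<Longrightarrow> \<exists>xs. simple_path F u xs v"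
proof (induction rule: rtrancl_induct)
  case base
  then show ?case by (intro exI[of _ "[u]"]) (simp add: simple_path_def)
next
  case (step y z)
  then obtain xs where xs: "simple_path F u xs y" by blast
  show ?case
  proof (cases "z \<in> set xs")
    case True
    then obtain as bs where "xs = as @ z # bs" by (meson split_list)
    then show ?thesis using simple_path_prefix xs by metis
  next
    case False
    then have "simple_path F u (xs @ [z]) z"
      using xs step by (intro simple_path_append[OF xs simple_path_edge])
        (auto simp: simple_path_def)
    then show ?thesis by blast
  qed
qed

lemma simple_path_imp_rtrancl: "simple_path E u xs v \<Longrightarrow> x \<in> set xs \<Longrightarrow> (u, x) \<in> E\<^sup>*"
proof (induction xs arbitrary: u)
  case (Cons y ys)
  then show ?case
    by (cases "ys = []") (auto simp: simple_path_Cons_iff intro: converse_rtrancl_into_rtrancl)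
qed simp

text \<open>The part of \<open>is_tree\<close> that passes to every symmetric subset of the edges
  (\<open>acyclic_graph_subset\<close>); for a subgraph only the vertex set and connectedness remain
  to be checked.\<close>

definition acyclic_graph :: "('v \<times> 'v) set \<Rightarrow> bool" where
  "acyclic_graph E \<longleftrightarrow> sym E \<and> irrefl E \<and>
     \<not> (\<exists>vs. 3 \<le> length vs \<and> distinct vs \<and>
            successively (\<lambda>u v. (u, v) \<in> E) vs \<and> (last vs, hd vs) \<in> E)"

lemma acyclic_graph_subset:
  assumes "acyclic_graph E" "F \<subseteq> E" "sym F"
  shows "acyclic_graph F"
  unfolding acyclic_graph_def
proof (intro conjI notI)
  show "irrefl F" using assms by (auto simp: acyclic_graph_def irrefl_def)
  assume "\<exists>vs. 3 \<le> length vs \<and> distinct vs \<and> successively (\<lambda>u v. (u, v) \<in> F) vs \<and> (last vs, hd vs) \<in> F"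
  then obtain vs where "3 \<le> length vs" "distinct vs" "successively (\<lambda>u v. (u, v) \<in> F) vs"
    "(last vs, hd vs) \<in> F" by blast
  moreover from this have "successively (\<lambda>u v. (u, v) \<in> E) vs"
    using \<open>F \<subseteq> E\<close> by (auto elim: successively_mono)
  ultimately show False using assms unfolding acyclic_graph_def by blast
qed (use assms in auto)

lemma is_tree_iff:
  "is_tree V E \<longleftrightarrow> V \<noteq> {} \<and> E \<subseteq> V \<times> V \<and> acyclic_graph E \<and> (\<forall>u\<in>V. \<forall>v\<in>V. (u, v) \<in> E\<^sup>*)"
  unfolding is_tree_def acyclic_graph_def by blast

text \<open>Two paths that part at \<open>u\<close> meet again at the latest in \<open>v\<close>.
  Following one of them to its first vertex on the other, and returning along the other, gives a
  cycle \<open>vs\<close>; it has at least three vertices because the second vertices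
  differ.\<close>

lemma simple_path_unique:
  assumes "acyclic_graph E"
  shows "simple_path E u xs v \<Longrightarrow> simple_path E u ys v \<Longrightarrow> xs = ys"
proof (induction xs arbitrary: u ys)
  case Nil
  then show ?case by (simp add: simple_path_def)
next
  case (Cons x xs)
  obtain y ys' where ys: "ys = y # ys'" using Cons.prems by (cases ys) (auto simp: simple_path_def)
  have xy: "x = u" "y = u" using Cons.prems ys by (auto simp: simple_path_def)
  show ?case
  proof (cases "xs = [] \<or> ys' = []")
    case True
    then show ?thesis
      using Cons.prems unfolding ys simple_path_def
      by (cases "xs = []"; cases "ys' = []") (auto dest: last_in_set)
  next
    case False
    then have px: "simple_path E (hd xs) xs v" "(u, hd xs) \<in> E" "u \<notin> set xs"
      and py: "simple_path E (hd ys') ys' v" "(u, hd ys') \<in> E" "u \<notin> set ys'"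
      using Cons.prems unfolding ys by (auto simp: simple_path_Cons_iff)
    show ?thesis
    proof (cases "hd xs = hd ys'")
      case True
      then show ?thesis using Cons.IH px(1) py(1) xy ys by metis
    next
      case neq: False
      have "last xs \<in> set ys'"
        using px py False by (auto simp: simple_path_def dest: last_in_set)
      then have "\<exists>z\<in>set xs. z \<in> set ys'" using False last_in_set by blast
      then obtain as z bs where xs: "xs = as @ z # bs" and z: "z \<in> set ys'"
        and as: "\<forall>w\<in>set as. w \<notin> set ys'"
        using split_list_first_prop[of xs "\<lambda>z. z \<in> set ys'"] by blast
      obtain cs ds where ys': "ys' = cs @ z # ds" using z by (meson split_list)
      define vs where "vs = (u # as) @ [z] @ rev cs"
      have "distinct vs"
        using px py as unfolding vs_def xs ys' simple_path_def by auto
      moreover have "3 \<le> length vs"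
        using neq unfolding vs_def xs ys' by (cases as; cases cs) auto
      moreover have "successively (\<lambda>u v. (u, v) \<in> E) vs"
      proof -
        have s: "successively (\<lambda>u v. (u, v) \<in> E) (rev (cs @ [z]))"
          using simple_path_prefix[OF py(1)[unfolded ys']] assms simple_path_rev
          unfolding acyclic_graph_def simple_path_def by metis
        have t: "successively (\<lambda>u v. (u, v) \<in> E) (u # as @ [z])"
          using simple_path_prefix[OF px(1)[unfolded xs]] px(2)
          unfolding xs simple_path_def by (cases as) (auto simp: successively_Cons)
        show ?thesis using s t unfolding vs_def
          by (cases "rev cs") (auto simp: successively_append_iff successively_Cons hd_append split: if_splits)
      qed
      moreover have "(last vs, hd vs) \<in> E"
        using py(2) assms unfolding vs_def ys' acyclic_graph_def
        by (cases cs) (auto dest: symD)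
      ultimately show ?thesis using assms unfolding acyclic_graph_def by blast
    qed
  qed
qed

lemma successively_map_closed:
  assumes "successively (\<lambda>x y. (x, y) \<in> E) xs" "\<And>x y. (x, y) \<in> E \<Longrightarrow> (f x, f y) \<in> F"
  shows "successively (\<lambda>x y. (x, y) \<in> F) (map f xs)"
  using assms by (auto simp: successively_map elim: successively_mono)

definition path_between :: "('v \<times> 'v) set \<Rightarrow> 'v \<Rightarrow> 'v \<Rightarrow> 'v list" where
  "path_between E u v = (THE xs. simple_path E u xs v)"

locale tree =
  fixes V :: "'v set" and E :: "('v \<times> 'v) set"
  assumes tree: "is_tree V E"
begin

lemma acyc: "acyclic_graph E" and symE: "sym E" and irreflE: "irrefl E" and
  edges_subset: "E \<subseteq> V \<times> V" and nonempty: "V \<noteq> {}" and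
  connected: "u \<in> V \<Longrightarrow> v \<in> V \<Longrightarrow> (u, v) \<in> E\<^sup>*"
  using tree by (auto simp: is_tree_iff acyclic_graph_def)

lemma edge_verts: "(x, y) \<in> E \<Longrightarrow> x \<in> V" "(x, y) \<in> E \<Longrightarrow> y \<in> V" "(x, y) \<in> E \<Longrightarrow> x \<noteq> y"
  "(x, y) \<in> E \<Longrightarrow> (y, x) \<in> E"
  using edges_subset irreflE symE by (auto simp: irrefl_def dest: symD)

lemma path_between_eq: "simple_path E u xs v \<Longrightarrow> path_between E u v = xs"
  unfolding path_between_def using simple_path_unique[OF acyc] by blast

lemma path_between: "u \<in> V \<Longrightarrow> v \<in> V \<Longrightarrow> simple_path E u (path_between E u v) v"
  using path_between_eq rtrancl_imp_simple_path[OF connected] by metis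

lemma simple_path_verts:
  assumes "simple_path E u xs v" "u \<in> V"
  shows "set xs \<subseteq> V"
proof
  fix x assume "x \<in> set xs"
  then have "(u, x) \<in> E\<^sup>*" using assms simple_path_imp_rtrancl by metis
  then show "x \<in> V" using assms(2) by (induction rule: rtrancl_induct) (auto dest: edge_verts)
qed

lemma path_subset: "u \<in> V \<Longrightarrow> v \<in> V \<Longrightarrow> set (path_between E u v) \<subseteq> V"
  using path_between simple_path_verts by blast

end

section \<open>Group actions on trees\<close>

locale G_tree = group G for G (structure) and T :: "('g, 'v) gtree" +
  assumes gtree: "is_gtree G T"
begin

sublocale tree "verts T" "edges T"
  using gtree by unfold_locales (simp add: is_gtree_def)

sublocale action: group_action G "verts T" "act T"
  using gtree by (simp add: is_gtree_def acts_by_automorphisms_def)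

lemma act_closed: "g \<in> carrier G \<Longrightarrow> x \<in> verts T \<Longrightarrow> act T g x \<in> verts T"
  using action.element_image by blast

lemma act_mult: "g \<in> carrier G \<Longrightarrow> h \<in> carrier G \<Longrightarrow> x \<in> verts T \<Longrightarrow>
    act T (g \<otimes> h) x = act T g (act T h x)"
  using action.composition_rule by simp

lemma act_one: "x \<in> verts T \<Longrightarrow> act T \<one> x = x"
  using action.id_eq_one by (metis restrict_apply')

lemma act_inv: "g \<in> carrier G \<Longrightarrow> x \<in> verts T \<Longrightarrow> act T (inv g) (act T g x) = x"
    "g \<in> carrier G \<Longrightarrow> x \<in> verts T \<Longrightarrow> act T g (act T (inv g) x) = x"
  by (simp_all flip: act_mult add: act_one)

lemma act_inj: "g \<in> carrier G \<Longrightarrow> x \<in> verts T \<Longrightarrow> y \<in> verts T \<Longrightarrow> act T g x = act T g y \<Longrightarrow> x = y"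
  by (metis act_inv(1))

lemma act_edge: "g \<in> carrier G \<Longrightarrow> (x, y) \<in> edges T \<Longrightarrow> (act T g x, act T g y) \<in> edges T"
  using gtree by (fastforce simp: is_gtree_def acts_by_automorphisms_def edge_act_def)

lemma act_edge_iff:
  assumes "g \<in> carrier G" "x \<in> verts T" "y \<in> verts T"
  shows "(act T g x, act T g y) \<in> edges T \<longleftrightarrow> (x, y) \<in> edges T"
  using act_edge[of g x y] act_edge[of "inv g" "act T g x" "act T g y"] assms by (auto simp: act_inv)

lemma no_inversion: "g \<in> carrier G \<Longrightarrow> (x, y) \<in> edges T \<Longrightarrow> act T g x = y \<Longrightarrow> act T g y \<noteq> x"
  using gtree by (fastforce simp: is_gtree_def without_inversions_def edge_act_def)

abbreviation St :: "'v \<Rightarrow> 'g set" where "St \<equiv> vertex_stab G T"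

lemma in_St: "g \<in> St x \<longleftrightarrow> g \<in> carrier G \<and> act T g x = x"
  by (auto simp: stabilizer_def)

lemma edge_stab_eq: "edge_stab G T (x, y) = St x \<inter> St y"
  by (auto simp: stabilizer_def edge_act_def)

lemma St_subgroup: "x \<in> verts T \<Longrightarrow> subgroup (St x) G"
  by (rule action.stabilizer_subgroup)

lemma St_act_subset:
  assumes "g \<in> carrier G" "x \<in> verts T" "y \<in> verts T" "St x \<subseteq> St y"
  shows "St (act T g x) \<subseteq> St (act T g y)"
proof
  fix h assume h: "h \<in> St (act T g x)"
  then have "inv g \<otimes> (h \<otimes> g) \<in> St x"
    using assms by (auto simp: in_St act_mult act_inv act_closed)
  then have "inv g \<otimes> (h \<otimes> g) \<in> St y" using assms by blast
  then have "act T g (act T (inv g \<otimes> (h \<otimes> g)) y) = act T g y" by (simp add: in_St)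
  then show "h \<in> St (act T g y)"
    using h assms by (auto simp: in_St act_mult act_inv act_closed)
qed

lemma St_act_subset_iff:
  assumes "g \<in> carrier G" "x \<in> verts T" "y \<in> verts T"
  shows "St (act T g x) \<subseteq> St (act T g y) \<longleftrightarrow> St x \<subseteq> St y"
  using St_act_subset[of g x y] St_act_subset[of "inv g" "act T g x" "act T g y"] assms
  by (auto simp: act_inv act_closed)

lemma St_act:
  assumes "g \<in> carrier G" "x \<in> verts T"
  shows "St (act T g x) = (\<lambda>a. g \<otimes> a \<otimes> inv g) ` St x"
proof (intro equalityI subsetI)
  fix h assume h: "h \<in> St (act T g x)"
  moreover from this assms have "g \<otimes> (inv g \<otimes> h) = h" by (simp add: in_St flip: m_assoc)
  ultimately have "inv g \<otimes> h \<otimes> g \<in> St x" "h = g \<otimes> (inv g \<otimes> h \<otimes> g) \<otimes> inv g"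
    using assms by (auto simp: in_St act_mult act_inv act_closed m_assoc)
  then show "h \<in> (\<lambda>a. g \<otimes> a \<otimes> inv g) ` St x" by blast
qed (use assms in \<open>auto simp: in_St act_mult act_inv act_closed\<close>)

lemma path_map:
  assumes "g \<in> carrier G" "x \<in> verts T" "y \<in> verts T"
  shows "path_between (edges T) (act T g x) (act T g y) = map (act T g) (path_between (edges T) x y)"
proof (rule path_between_eq)
  let ?p = "path_between (edges T) x y"
  have p: "simple_path (edges T) x ?p y" using assms by (intro path_between)
  then have "set ?p \<subseteq> verts T" using assms simple_path_verts by blast
  then have "inj_on (act T g) (set ?p)" using act_inj assms by (meson inj_onI subsetD)
  moreover have "successively (\<lambda>x y. (x, y) \<in> edges T) (map (act T g) ?p)"
    using p assms by (intro successively_map_closed) (auto simp: simple_path_def act_edge)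
  ultimately show "simple_path (edges T) (act T g x) (map (act T g) ?p) (act T g y)"
    using p by (auto simp: simple_path_def hd_map last_map distinct_map)
qed

text \<open>By uniqueness of paths, \<open>g\<close> maps the path between two fixed vertices to
  itself in the same order, so it fixes the path pointwise.\<close>

lemma path_fixed:
  assumes "g \<in> St x" "g \<in> St y" "x \<in> verts T" "y \<in> verts T" "z \<in> set (path_between (edges T) x y)"
  shows "g \<in> St z"
proof -
  have "map (act T g) (path_between (edges T) x y) = path_between (edges T) x y"
    using path_map[of g x y] assms by (auto simp: in_St)
  then have "act T g z = z" using assms(5) map_idI map_eq_conv[of "act T g" _ "\<lambda>x. x"] by simp
  then show ?thesis using assms by (simp add: in_St)
qed

section \<open>Orbits of vertices and of oriented edges\<close>

abbreviation orb :: "'v \<Rightarrow> 'v set" where "orb \<equiv> orbit G (act T)"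
abbreviation eorb :: "'v \<times> 'v \<Rightarrow> ('v \<times> 'v) set" where "eorb \<equiv> orbit G (edge_act T)"

lemma in_orb: "y \<in> orb x \<longleftrightarrow> (\<exists>g\<in>carrier G. y = act T g x)"
  by (auto simp: orbit_def)

lemma in_eorb: "(x', y') \<in> eorb (x, y) \<longleftrightarrow> (\<exists>g\<in>carrier G. x' = act T g x \<and> y' = act T g y)"
  by (auto simp: orbit_def edge_act_def)

lemma orb_refl: "x \<in> verts T \<Longrightarrow> x \<in> orb x"
  by (metis in_orb act_one one_closed)

lemma orb_subset: "x \<in> verts T \<Longrightarrow> orb x \<subseteq> verts T"
  by (auto simp: in_orb act_closed)

lemma orb_act: "x \<in> verts T \<Longrightarrow> g \<in> carrier G \<Longrightarrow> orb (act T g x) = orb x"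
proof (intro equalityI subsetI)
  fix y assume a: "x \<in> verts T" "g \<in> carrier G" "y \<in> orb x"
  then obtain h where "h \<in> carrier G" "y = act T h x" by (auto simp: in_orb)
  with a show "y \<in> orb (act T g x)"
    by (auto simp: in_orb act_mult act_inv act_closed intro!: bexI[of _ "h \<otimes> inv g"])
qed (auto simp: in_orb simp flip: act_mult)

lemma orb_eqI: "x \<in> verts T \<Longrightarrow> y \<in> orb x \<Longrightarrow> orb y = orb x"
  by (auto simp: in_orb orb_act)

lemma orb_eq_iff: "x \<in> verts T \<Longrightarrow> y \<in> verts T \<Longrightarrow> orb x = orb y \<longleftrightarrow> (\<exists>g\<in>carrier G. x = act T g y)"
  by (metis orb_eqI orb_refl in_orb)

lemma eorb_refl: "e \<in> edges T \<Longrightarrow> e \<in> eorb e"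
  by (cases e) (metis in_eorb act_one one_closed edge_verts(1,2))

lemma eorb_subset: "e \<in> edges T \<Longrightarrow> eorb e \<subseteq> edges T"
  by (cases e) (auto simp: in_eorb act_edge)

lemma eorb_eqI:
  assumes "e \<in> edges T" "e' \<in> eorb e"
  shows "eorb e' = eorb e"
proof -
  obtain x y x' y' where e: "e = (x, y)" "e' = (x', y')" by (cases e; cases e')
  then obtain g where g: "g \<in> carrier G" "x' = act T g x" "y' = act T g y"
    using assms by (auto simp: in_eorb)
  have xy: "x \<in> verts T" "y \<in> verts T" using assms e edge_verts by auto
  have "(u, v) \<in> eorb e' \<longleftrightarrow> (u, v) \<in> eorb e" for u v
  proof
    assume "(u, v) \<in> eorb e'"
    then obtain h where "h \<in> carrier G" "u = act T h x'" "v = act T h y'" by (auto simp: e in_eorb)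
    then show "(u, v) \<in> eorb e" using g xy
      by (auto simp: e in_eorb simp flip: act_mult intro!: bexI[of _ "h \<otimes> g"])
  next
    assume "(u, v) \<in> eorb e"
    then obtain h where "h \<in> carrier G" "u = act T h x" "v = act T h y" by (auto simp: e in_eorb)
    then show "(u, v) \<in> eorb e'" using g xy
      by (auto simp: e in_eorb act_mult act_inv act_closed intro!: bexI[of _ "h \<otimes> inv g"])
  qed
  then show ?thesis by auto
qed

lemma quotient_verts_eq: "quotient_verts G T = orb ` verts T"
  by (auto simp: quotient_verts_def orbits_def)

lemma quotient_edges_eq: "quotient_edges G T = eorb ` edges T"
  by (auto simp: quotient_edges_def orbits_def)

lemma fst_eorb: "(x, y) \<in> edges T \<Longrightarrow> fst ` eorb (x, y) = orb x"
  by (force simp: in_orb orbit_def edge_act_def)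

lemma swap_eorb: "prod.swap ` eorb (x, y) = eorb (y, x)"
  by (force simp: orbit_def edge_act_def)

text \<open>An element exchanging the ends of the edge would be an inversion. Hence reversal has no
  fixed point among the oriented edges of the quotient graph.\<close>

lemma eorb_swap_neq: "(x, y) \<in> edges T \<Longrightarrow> eorb (x, y) \<noteq> eorb (y, x)"
  using eorb_refl[of "(x, y)"] no_inversion by (metis edge_verts(4) in_eorb)

lemma in_quotient_edge_iff: "X \<in> quotient_edges G T \<Longrightarrow> e \<in> edges T \<Longrightarrow> e \<in> X \<longleftrightarrow> X = eorb e"
  unfolding quotient_edges_eq using eorb_eqI eorb_refl by blast

lemma in_quotient_vert_iff: "Y \<in> quotient_verts G T \<Longrightarrow> x \<in> verts T \<Longrightarrow> x \<in> Y \<longleftrightarrow> Y = orb x"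
  unfolding quotient_verts_eq using orb_eqI orb_refl by blast

lemma generate_induct_act:
  assumes S: "S \<subseteq> carrier G" "generate G S = carrier G" and g: "g \<in> carrier G"
    and P1: "P \<one>" and PS: "\<And>s. s \<in> S \<Longrightarrow> P s"
    and Pi: "\<And>s. s \<in> carrier G \<Longrightarrow> P s \<Longrightarrow> P (inv s)"
    and Pm: "\<And>s t. s \<in> carrier G \<Longrightarrow> t \<in> carrier G \<Longrightarrow> P s \<Longrightarrow> P t \<Longrightarrow> P (s \<otimes> t)"
  shows "P g"
proof -
  have "g \<in> generate G S" using S g by simp
  then show ?thesis
  proof (induction rule: generate.induct)
    case (inv h) then show ?case using PS Pi S by blast
  next
    case (eng h1 h2) then show ?case using Pm S(2) by blast
  qed (use P1 PS in auto)
qed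

text \<open>The translates of these paths form an invariant subtree, so minimality applies.\<close>

lemma path_cover:
  assumes S: "S \<subseteq> carrier G" "generate G S = carrier G" and y: "y \<in> verts T"
  defines "W \<equiv> insert y (\<Union>s\<in>S. set (path_between (edges T) y (act T s y)))"
  assumes x: "x \<in> verts T" shows "\<exists>g\<in>carrier G. \<exists>w\<in>W. x = act T g w"
    and "(u, v) \<in> edges T \<Longrightarrow> \<exists>g\<in>carrier G. \<exists>w\<in>W. \<exists>w'\<in>W. u = act T g w \<and> v = act T g w'"
proof -
  define V' where "V' = {act T g w | g w. g \<in> carrier G \<and> w \<in> W}"
  define F where "F = {(act T g w, act T g w') | g w w'. g \<in> carrier G \<and> w \<in> W \<and> w' \<in> W \<and> (w, w') \<in> edges T}"
  have sV: "act T s y \<in> verts T" if "s \<in> carrier G" for s using that y act_closed by blast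
  have WV: "W \<subseteq> verts T"
    unfolding W_def by (intro insert_subsetI UN_least path_subset sV y subsetD[OF S(1)])
  have FE: "F \<subseteq> edges T" by (auto simp: F_def act_edge)
  have symF: "sym F"
    unfolding F_def sym_def using edge_verts(4) by blast
  have Fact: "(act T g a, act T g b) \<in> F" if "g \<in> carrier G" "(a, b) \<in> F" for g a b
  proof -
    obtain h w w' where h: "h \<in> carrier G" "w \<in> W" "w' \<in> W" "(w, w') \<in> edges T"
      "a = act T h w" "b = act T h w'" using \<open>(a, b) \<in> F\<close> by (auto simp: F_def)
    then have "act T g a = act T (g \<otimes> h) w" "act T g b = act T (g \<otimes> h) w'"
      using that WV by (auto simp: act_mult subsetD)
    then show ?thesis using h that unfolding F_def by blast
  qed
  have Fact': "(act T g a, act T g b) \<in> F\<^sup>*" if "g \<in> carrier G" "(a, b) \<in> F\<^sup>*" for g a b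
    using that(2) by (induction rule: rtrancl_induct) (auto intro: Fact[OF that(1)] rtrancl_into_rtrancl)
  have symF': "(b, a) \<in> F\<^sup>*" if "(a, b) \<in> F\<^sup>*" for a b
    using symD[OF sym_rtrancl[OF symF] that] .
  have sp: "simple_path F y (path_between (edges T) y (act T s y)) (act T s y)" if "s \<in> S" for s
  proof -
    let ?p = "path_between (edges T) y (act T s y)"
    have p: "simple_path (edges T) y ?p (act T s y)" using path_between y sV S(1) that by blast
    have "(a, b) \<in> F" if "a \<in> set ?p" "b \<in> set ?p" "(a, b) \<in> edges T" for a b
    proof -
      have "a \<in> W" "b \<in> W" using \<open>s \<in> S\<close> that unfolding W_def by auto
      moreover have "a = act T \<one> a" "b = act T \<one> b" using that edge_verts act_one by auto
      ultimately show ?thesis using that unfolding F_def by blast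
    qed
    then show ?thesis using p unfolding simple_path_def by (auto elim!: successively_mono)
  qed
  have W_conn: "(y, w) \<in> F\<^sup>*" if "w \<in> W" for w
    using that simple_path_imp_rtrancl[OF sp] unfolding W_def by blast
  \<comment> \<open>The elements that move \<open>y\<close> within its \<open>F\<close>-component
    form a subgroup containing \<open>S\<close>, because \<open>F\<close> is invariant and
    symmetric.\<close>
  have "(y, act T g y) \<in> F\<^sup>*" if "g \<in> carrier G" for g
  proof (rule generate_induct_act[OF S that])
    show "(y, act T \<one> y) \<in> F\<^sup>*" using y act_one by simp
    show "(y, act T s y) \<in> F\<^sup>*" if "s \<in> S" for s
      using simple_path_imp_rtrancl[OF sp[OF that]] sp[OF that]
      by (metis last_in_set simple_path_def)
    show "(y, act T (inv s) y) \<in> F\<^sup>*" if "s \<in> carrier G" "(y, act T s y) \<in> F\<^sup>*" for s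
      using Fact'[of "inv s" y "act T s y"] that y by (auto simp: act_inv symF')
    show "(y, act T (s \<otimes> t) y) \<in> F\<^sup>*"
      if "s \<in> carrier G" "t \<in> carrier G" "(y, act T s y) \<in> F\<^sup>*" "(y, act T t y) \<in> F\<^sup>*" for s t
      using Fact'[of s y "act T t y"] that y by (auto simp: act_mult)
  qed
  then have y_conn: "(y, z) \<in> F\<^sup>*" if "z \<in> V'" for z
    using that rtrancl_trans[OF _ Fact'[OF _ W_conn]] unfolding V'_def by blast
  have conn: "(a, b) \<in> F\<^sup>*" if "a \<in> V'" "b \<in> V'" for a b
    using rtrancl_trans[OF symF'[OF y_conn] y_conn] that by simp
  have "y \<in> V'" unfolding V'_def W_def using y act_one by force
  moreover have "F \<subseteq> V' \<times> V'" by (auto simp: F_def V'_def)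
  ultimately have "is_tree V' F"
    using conn acyclic_graph_subset[OF acyc FE symF] by (auto simp: is_tree_iff)
  have V'V: "V' \<subseteq> verts T" using WV act_closed by (auto simp: V'_def)
  have V'act: "act T g ` V' \<subseteq> V'" if "g \<in> carrier G" for g
  proof
    fix z assume "z \<in> act T g ` V'"
    then obtain h w where "h \<in> carrier G" "w \<in> W" "z = act T g (act T h w)" by (auto simp: V'_def)
    then have "z = act T (g \<otimes> h) w" using WV that by (auto simp: act_mult subsetD)
    then show "z \<in> V'" using \<open>h \<in> carrier G\<close> \<open>w \<in> W\<close> that unfolding V'_def by blast
  qed
  have Fact2: "edge_act T g ` F \<subseteq> F" if "g \<in> carrier G" for g
    using Fact[OF that] by (auto simp: edge_act_def)
  have "V' = verts T \<and> F = edges T"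
  proof -
    have "\<forall>S F. S \<subseteq> verts T \<and> F \<subseteq> edges T \<and> is_tree S F \<and>
        (\<forall>g\<in>carrier G. act T g ` S \<subseteq> S \<and> edge_act T g ` F \<subseteq> F) \<longrightarrow> S = verts T \<and> F = edges T"
      using gtree unfolding is_gtree_def minimal_gtree_def by (elim conjE)
    note this[THEN spec[of _ V'], THEN spec[of _ F]]
    then show ?thesis
      using V'V FE V'act Fact2 \<open>is_tree V' F\<close> by blast
  qed
  then show "\<exists>g\<in>carrier G. \<exists>w\<in>W. x = act T g w"
    "(u, v) \<in> edges T \<Longrightarrow> \<exists>g\<in>carrier G. \<exists>w\<in>W. \<exists>w'\<in>W. u = act T g w \<and> v = act T g w'"
    using x unfolding V'_def F_def by blast+
qed

text \<open>The paths from one vertex to its images under the generators have finitely many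
  vertices, and by \<open>path_cover\<close> these meet every vertex orbit, and pairs of them meet
  every edge orbit.\<close>

lemma finite_quotient:
  assumes S: "S \<subseteq> carrier G" "generate G S = carrier G" "finite S"
  shows "finite (quotient_verts G T)" "finite (quotient_edges G T)"
proof -
  obtain y where y: "y \<in> verts T" using nonempty by blast
  define W where "W = insert y (\<Union>s\<in>S. set (path_between (edges T) y (act T s y)))"
  note cover = path_cover[OF S(1,2) y, folded W_def]
  have W: "finite W" using S(3) by (simp add: W_def)
  have WV: "W \<subseteq> verts T"
    unfolding W_def by (intro insert_subsetI UN_least path_subset act_closed y subsetD[OF S(1)])
  have "quotient_verts G T \<subseteq> orb ` W"
  proof
    fix Y assume "Y \<in> quotient_verts G T"
    then obtain x where "x \<in> verts T" "Y = orb x" by (auto simp: quotient_verts_eq)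
    then obtain g w where "g \<in> carrier G" "w \<in> W" "Y = orb (act T g w)" using cover(1)[of x] by blast
    then show "Y \<in> orb ` W" using orb_act WV by blast
  qed
  then show "finite (quotient_verts G T)" using W finite_surj by auto
  have "quotient_edges G T \<subseteq> eorb ` (W \<times> W)"
  proof
    fix X assume "X \<in> quotient_edges G T"
    then obtain u v where uv: "(u, v) \<in> edges T" "X = eorb (u, v)" by (auto simp: quotient_edges_eq)
    then obtain g w w' where w: "g \<in> carrier G" "w \<in> W" "w' \<in> W" "u = act T g w" "v = act T g w'"
      using cover(2)[OF y uv(1)] by (elim bexE conjE)
    then have "(w, w') \<in> edges T" using uv(1) act_edge_iff[of g w w'] subsetD[OF WV] by simp
    then have "X = eorb (w, w')"
      unfolding uv(2) by (rule eorb_eqI) (use w in \<open>auto simp: in_eorb\<close>)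
    then show "X \<in> eorb ` (W \<times> W)" using w by blast
  qed
  then show "finite (quotient_edges G T)" using finite_surj[OF finite_cartesian_product[OF W W]] by simp
qed

end

section \<open>Collapses\<close>

text \<open>A form of \<open>contraction\<close> that mentions only the map: the contracted edges
  are those with equal images, and the last clause says that they connect each fibre. Such maps
  include isomorphisms and single moves, and they can be composed and factored.\<close>

definition collapses_to ::
    "('g, 'b) monoid_scheme \<Rightarrow> ('g, 'v) gtree \<Rightarrow> ('g, 'v) gtree \<Rightarrow> ('v \<Rightarrow> 'v) \<Rightarrow> bool" where
  "collapses_to G T T' f \<longleftrightarrow>
     equivariant G T T' f \<and> f ` verts T = verts T' \<and>
     edges T' = map_prod f f ` {e \<in> edges T. f (fst e) \<noteq> f (snd e)} \<and>
     (\<forall>u\<in>verts T. \<forall>v\<in>verts T. f u = f v \<longrightarrow> (u, v) \<in> {e \<in> edges T. f (fst e) = f (snd e)}\<^sup>*)"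

lemma collapses_to_edge:
  assumes "collapses_to G T T' f"
  shows "(x, y) \<in> edges T \<Longrightarrow> f x \<noteq> f y \<Longrightarrow> (f x, f y) \<in> edges T'"
    and "(r, s) \<in> edges T' \<Longrightarrow> \<exists>x y. (x, y) \<in> edges T \<and> r = f x \<and> s = f y \<and> f x \<noteq> f y"
  using assms unfolding collapses_to_def by force+

lemma collapses_to_rtrancl:
  assumes "collapses_to G T T' f" "u \<in> verts T" "v \<in> verts T" "f u = f v"
  shows "(u, v) \<in> {e \<in> edges T. f (fst e) = f (snd e)}\<^sup>*"
  using assms unfolding collapses_to_def by blast

text \<open>Since \<open>T'\<close> has no loops, an edge outside \<open>F\<close> cannot have equal
  images, so \<open>F\<close> is recovered from \<open>f\<close>.\<close>

lemma contraction_collapses_to: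
  assumes "contraction G F T T' f" "F \<subseteq> edges T" "is_gtree G T"
  shows "collapses_to G T T' f" "e \<in> edges T \<Longrightarrow> f (fst e) = f (snd e) \<longleftrightarrow> e \<in> F"
proof -
  have c: "equivariant G T T' f" "f ` verts T = verts T'" "edges T' = map_prod f f ` (edges T - F)"
    and i: "\<forall>u\<in>verts T. \<forall>v\<in>verts T. f u = f v \<longleftrightarrow> (u, v) \<in> F\<^sup>*" and T': "is_gtree G T'"
    using assms(1) unfolding contraction_def by blast+
  have *: "f (fst e) = f (snd e) \<longleftrightarrow> e \<in> F" if e: "e \<in> edges T" for e
  proof
    have v: "fst e \<in> verts T" "snd e \<in> verts T"
      using assms(3) e unfolding is_gtree_def is_tree_def by auto
    show "f (fst e) = f (snd e)" if "e \<in> F"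
      using i v that by (metis prod.collapse r_into_rtrancl)
    show "e \<in> F" if "f (fst e) = f (snd e)"
    proof (rule ccontr)
      assume "e \<notin> F"
      then have "map_prod f f e \<in> edges T'" using c(3) e by blast
      then show False using T' that unfolding is_gtree_def is_tree_def irrefl_def by (cases e) auto
    qed
  qed
  then show "e \<in> edges T \<Longrightarrow> f (fst e) = f (snd e) \<longleftrightarrow> e \<in> F" .
  have "{e \<in> edges T. f (fst e) = f (snd e)} = F" "{e \<in> edges T. f (fst e) \<noteq> f (snd e)} = edges T - F"
    using * assms(2) by blast+
  then show "collapses_to G T T' f" using c i unfolding collapses_to_def by simp
qed

lemma gtree_isomorphism_collapses_to:
  assumes "gtree_isomorphism G T T' f" "is_gtree G T" "is_gtree G T'"
  shows "collapses_to G T T' f"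
proof -
  have f: "inj_on f (verts T)" "f ` verts T = verts T'"
    "\<And>u v. u \<in> verts T \<Longrightarrow> v \<in> verts T \<Longrightarrow> (f u, f v) \<in> edges T' \<longleftrightarrow> (u, v) \<in> edges T"
    using assms(1) unfolding gtree_isomorphism_def bij_betw_def by auto
  have E: "edges T \<subseteq> verts T \<times> verts T" "edges T' \<subseteq> verts T' \<times> verts T'" "irrefl (edges T)"
    using assms(2,3) unfolding is_gtree_def is_tree_def by auto
  have ne: "f (fst e) \<noteq> f (snd e)" if "e \<in> edges T" for e
  proof -
    have "fst e \<noteq> snd e" "fst e \<in> verts T" "snd e \<in> verts T"
      using that E by (cases e; auto simp: irrefl_def)+
    then show ?thesis using inj_onD[OF f(1)] by metis
  qed
  have "edges T' = map_prod f f ` edges T"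
  proof (intro equalityI subsetI)
    fix e assume e: "e \<in> edges T'"
    then obtain u v where "u \<in> verts T" "v \<in> verts T" "e = (f u, f v)"
      using E f(2) by (cases e) blast
    then show "e \<in> map_prod f f ` edges T" using e f(3) by force
  qed (use E f in auto)
  moreover have "{e \<in> edges T. f (fst e) \<noteq> f (snd e)} = edges T" using ne by auto
  moreover have "f u = f v \<Longrightarrow> (u, v) \<in> R\<^sup>*" if "u \<in> verts T" "v \<in> verts T" for u v R
    using that f(1) by (auto simp: inj_on_def)
  ultimately show ?thesis
    using assms(1) f(2) unfolding collapses_to_def gtree_isomorphism_def by simp
qed

lemma rtrancl_map_closed:
  "(a, b) \<in> R\<^sup>* \<Longrightarrow> (\<And>x y. (x, y) \<in> R \<Longrightarrow> (f x, f y) \<in> S\<^sup>*) \<Longrightarrow> (f a, f b) \<in> S\<^sup>*"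
  by (induction rule: rtrancl_induct) (auto intro: rtrancl_trans)

text \<open>Fibres of the composite are connected: a path in a fibre of \<open>h\<close> lifts edge
  by edge to \<open>T\<close>, and the end of one lift is joined to the start of the next inside a
  connected fibre of \<open>f\<close>.\<close>

lemma collapses_to_comp:
  assumes T: "is_gtree G T" and f: "collapses_to G T T' f" and h: "collapses_to G T' T'' h"
  shows "collapses_to G T T'' (h \<circ> f)"
proof -
  have E: "x \<in> verts T" "y \<in> verts T" if "(x, y) \<in> edges T" for x y
    using that T unfolding is_gtree_def is_tree_def by auto
  have eq: "equivariant G T T'' (h \<circ> f)" and img: "(h \<circ> f) ` verts T = verts T''"
  proof -
    have fh: "f ` verts T = verts T'" "h ` verts T' = verts T''"
      "equivariant G T T' f" "equivariant G T' T'' h"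
      using f h by (simp_all add: collapses_to_def)
    then show "equivariant G T T'' (h \<circ> f)" unfolding equivariant_def by force
    show "(h \<circ> f) ` verts T = verts T''" using fh by (simp flip: image_image)
  qed
  let ?C = "{e \<in> edges T. (h \<circ> f) (fst e) = (h \<circ> f) (snd e)}"
  have "edges T'' = map_prod (h \<circ> f) (h \<circ> f) ` {e \<in> edges T. (h \<circ> f) (fst e) \<noteq> (h \<circ> f) (snd e)}"
  proof (intro equalityI subsetI)
    fix e assume "e \<in> edges T''"
    then obtain r s where rs: "(r, s) \<in> edges T'" "e = (h r, h s)" "h r \<noteq> h s"
      using collapses_to_edge(2)[OF h] by (cases e) metis
    then obtain x y where "(x, y) \<in> edges T" "r = f x" "s = f y"
      using collapses_to_edge(2)[OF f] by metis
    then show "e \<in> map_prod (h \<circ> f) (h \<circ> f) ` {e \<in> edges T. (h \<circ> f) (fst e) \<noteq> (h \<circ> f) (snd e)}"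
      using rs by (intro image_eqI[of _ _ "(x, y)"]) auto
  next
    fix e assume "e \<in> map_prod (h \<circ> f) (h \<circ> f) ` {e \<in> edges T. (h \<circ> f) (fst e) \<noteq> (h \<circ> f) (snd e)}"
    then obtain x y where "(x, y) \<in> edges T" "h (f x) \<noteq> h (f y)" "e = (h (f x), h (f y))" by auto
    then show "e \<in> edges T''" using collapses_to_edge(1)[OF f] collapses_to_edge(1)[OF h] by metis
  qed
  moreover have "(u, v) \<in> ?C\<^sup>*" if uv: "u \<in> verts T" "v \<in> verts T" "(h \<circ> f) u = (h \<circ> f) v" for u v
  proof -
    have lift: "(x, y) \<in> ?C\<^sup>*" if "x \<in> verts T" "y \<in> verts T" "f x = f y" for x y
      using collapses_to_rtrancl[OF f that] by (rule rtrancl_mono[THEN subsetD, rotated]) auto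
    have "(f u, f v) \<in> {e \<in> edges T'. h (fst e) = h (snd e)}\<^sup>*"
      using uv f by (intro collapses_to_rtrancl[OF h]) (auto simp: collapses_to_def)
    moreover have "\<exists>w\<in>verts T. f w = b \<and> (u, w) \<in> ?C\<^sup>*"
      if "(f u, b) \<in> {e \<in> edges T'. h (fst e) = h (snd e)}\<^sup>*" for b
      using that
    proof (induction rule: rtrancl_induct)
      case (step b c)
      then obtain w where w: "w \<in> verts T" "f w = b" "(u, w) \<in> ?C\<^sup>*" by blast
      obtain x y where xy: "(x, y) \<in> edges T" "b = f x" "c = f y"
        using collapses_to_edge(2)[OF f] step(2) by blast
      have "(w, x) \<in> ?C\<^sup>*" using lift w xy E by simp
      moreover have "(x, y) \<in> ?C" using xy step(2) by auto
      ultimately have "(u, y) \<in> ?C\<^sup>*" using w(3) by (meson rtrancl.rtrancl_into_rtrancl rtrancl_trans)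
      then show ?case using xy E by blast
    qed (use uv in auto)
    ultimately obtain w where "w \<in> verts T" "f w = f v" "(u, w) \<in> ?C\<^sup>*" by blast
    then show ?thesis using lift[of w v] uv by (metis (no_types, lifting) rtrancl_trans)
  qed
  ultimately show ?thesis using eq img unfolding collapses_to_def by blast
qed

text \<open>This lets a collapse of \<open>T\<close> onto a reduced tree pass through the tree in
  which only surviving edges are left. By \<open>le\<close> the map \<open>h\<close> does not depend
  on the chosen preimage, and its fibres are connected as images of fibres of
  \<open>f\<close>.\<close>

lemma collapses_to_factor:
  assumes T: "is_gtree G T" and f: "collapses_to G T T'' f" and p: "collapses_to G T T' p"
    and le: "\<And>u v. u \<in> verts T \<Longrightarrow> v \<in> verts T \<Longrightarrow> p u = p v \<Longrightarrow> f u = f v"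
  obtains h where "collapses_to G T' T'' h" "\<And>u. u \<in> verts T \<Longrightarrow> h (p u) = f u"
proof -
  define h where "h r = f (SOME u. u \<in> verts T \<and> p u = r)" for r
  have hp: "h (p u) = f u" if "u \<in> verts T" for u
  proof -
    have "(SOME w. w \<in> verts T \<and> p w = p u) \<in> verts T \<and> p (SOME w. w \<in> verts T \<and> p w = p u) = p u"
      by (rule someI[of "\<lambda>w. w \<in> verts T \<and> p w = p u" u]) (simp add: that)
    then show ?thesis unfolding h_def using le that by blast
  qed
  have E: "x \<in> verts T" "y \<in> verts T" if "(x, y) \<in> edges T" for x y
    using that T unfolding is_gtree_def is_tree_def by auto
  have act: "act T g u \<in> verts T" if "g \<in> carrier G" "u \<in> verts T" for g u
    using T that group_action.element_image[of G "verts T" "act T"]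
    unfolding is_gtree_def acts_by_automorphisms_def by blast
  have V': "verts T' = p ` verts T" using p unfolding collapses_to_def by simp
  have "collapses_to G T' T'' h"
    unfolding collapses_to_def
  proof (intro conjI ballI impI)
    show "equivariant G T' T'' h"
      unfolding equivariant_def
    proof (intro ballI)
      fix g r assume "g \<in> carrier G" "r \<in> verts T'"
      then obtain u where u: "u \<in> verts T" "r = p u" using V' by blast
      have "act T' g r = p (act T g u)" "act T'' g (f u) = f (act T g u)"
        using conjunct1[OF p[unfolded collapses_to_def]] conjunct1[OF f[unfolded collapses_to_def]]
          u \<open>g \<in> carrier G\<close> unfolding equivariant_def by simp_all
      then show "h (act T' g r) = act T'' g (h r)" using hp u act \<open>g \<in> carrier G\<close> by simp
    qed
    have "f ` verts T = verts T''" using f by (simp add: collapses_to_def)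
    then show "h ` verts T' = verts T''" using hp by (simp add: V' image_image cong: image_cong)
    show "edges T'' = map_prod h h ` {e \<in> edges T'. h (fst e) \<noteq> h (snd e)}"
    proof (intro equalityI subsetI)
      fix e assume "e \<in> edges T''"
      then obtain x y where xy: "(x, y) \<in> edges T" "e = (f x, f y)" "f x \<noteq> f y"
        using collapses_to_edge(2)[OF f] by (cases e) metis
      then have "(p x, p y) \<in> edges T'" using collapses_to_edge(1)[OF p] le E by metis
      then show "e \<in> map_prod h h ` {e \<in> edges T'. h (fst e) \<noteq> h (snd e)}"
        using xy hp E by (intro image_eqI[of _ _ "(p x, p y)"]) auto
    next
      fix e assume "e \<in> map_prod h h ` {e \<in> edges T'. h (fst e) \<noteq> h (snd e)}"
      then obtain r s where rs: "(r, s) \<in> edges T'" "h r \<noteq> h s" "e = (h r, h s)" by auto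
      then obtain x y where "(x, y) \<in> edges T" "r = p x" "s = p y"
        using collapses_to_edge(2)[OF p] by metis
      then show "e \<in> edges T''" using collapses_to_edge(1)[OF f] rs hp E by metis
    qed
    fix r s assume rs: "r \<in> verts T'" "s \<in> verts T'" "h r = h s"
    then obtain u v where uv: "u \<in> verts T" "v \<in> verts T" "r = p u" "s = p v" using V' by blast
    then have "(u, v) \<in> {e \<in> edges T. f (fst e) = f (snd e)}\<^sup>*"
      using collapses_to_rtrancl[OF f] hp rs by simp
    then have "(p u, p v) \<in> {e \<in> edges T'. h (fst e) = h (snd e)}\<^sup>*"
    proof (rule rtrancl_map_closed)
      fix x y assume xy: "(x, y) \<in> {e \<in> edges T. f (fst e) = f (snd e)}"
      show "(p x, p y) \<in> {e \<in> edges T'. h (fst e) = h (snd e)}\<^sup>*"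
      proof (cases "p x = p y")
        case False
        then show ?thesis
          using xy collapses_to_edge(1)[OF p, of x y] hp E by (intro r_into_rtrancl) auto
      qed simp
    qed
    then show "(r, s) \<in> {e \<in> edges T'. h (fst e) = h (snd e)}\<^sup>*" using uv by simp
  qed
  then show thesis using that hp by blast
qed

section \<open>Stabilizers along a collapse map\<close>

context G_tree
begin

text \<open>\<open>v\<close> is a leaf of the subtree fixed by \<open>G\<^sub>v\<close>, and \<open>(v, u)\<close> is the edge of that subtree at \<open>v\<close>.\<close>

definition stab_leaf :: "'v \<Rightarrow> 'v \<Rightarrow> bool" where
  "stab_leaf v u \<longleftrightarrow> (v, u) \<in> edges T \<and> St v \<subseteq> St u \<and> (\<forall>w. (v, w) \<in> edges T \<and> St v \<subseteq> St w \<longrightarrow> w = u)"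

lemma stab_leaf_act:
  assumes "g \<in> carrier G" "stab_leaf v u"
  shows "stab_leaf (act T g v) (act T g u)"
  unfolding stab_leaf_def
proof (intro conjI allI impI)
  have v: "(v, u) \<in> edges T" "v \<in> verts T" "u \<in> verts T" "St v \<subseteq> St u"
    using assms(2) edge_verts unfolding stab_leaf_def by auto
  then show "(act T g v, act T g u) \<in> edges T" "St (act T g v) \<subseteq> St (act T g u)"
    using assms(1) act_edge St_act_subset by auto
  fix w assume w: "(act T g v, w) \<in> edges T \<and> St (act T g v) \<subseteq> St w"
  define w' where "w' = act T (inv g) w"
  have "w \<in> verts T" using w edge_verts by auto
  then have w': "w = act T g w'" "w' \<in> verts T" using assms(1) by (auto simp: w'_def act_inv act_closed)
  then have "(v, w') \<in> edges T" "St v \<subseteq> St w'"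
    using w v assms(1) act_edge_iff St_act_subset_iff by auto
  then show "w = act T g u" using assms(2) w' unfolding stab_leaf_def by blast
qed

end

locale collapse =
  T: G_tree G T + R: G_tree G R for G (structure) and T R :: "('g, 'v) gtree" +
  fixes h :: "'v \<Rightarrow> 'v"
  assumes collapses: "collapses_to G T R h"
begin

lemma h_verts: "x \<in> verts T \<Longrightarrow> h x \<in> verts R"
  using collapses unfolding collapses_to_def by blast

lemma h_act: "g \<in> carrier G \<Longrightarrow> x \<in> verts T \<Longrightarrow> h (act T g x) = act R g (h x)"
  using collapses unfolding collapses_to_def equivariant_def by blast

lemma h_surj: "r \<in> verts R \<Longrightarrow> \<exists>x\<in>verts T. h x = r"
proof -
  assume "r \<in> verts R"
  also have "verts R = h ` verts T" using collapses by (simp add: collapses_to_def)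
  finally show "\<exists>x\<in>verts T. h x = r" by blast
qed

lemma h_edge: "(x, y) \<in> edges T \<Longrightarrow> h x \<noteq> h y \<Longrightarrow> (h x, h y) \<in> edges R"
  using collapses_to_edge(1)[OF collapses] .

lemma edge_lift: "(r, s) \<in> edges R \<Longrightarrow> \<exists>x y. (x, y) \<in> edges T \<and> h x = r \<and> h y = s"
  using collapses_to_edge(2)[OF collapses] by metis

lemma St_subset: "x \<in> verts T \<Longrightarrow> T.St x \<subseteq> R.St (h x)"
  by (auto simp: T.in_St R.in_St simp flip: h_act)

text \<open>Collapsed edges join any two vertices of a fibre, and a path made of them is the only
  path in the tree; so fibres are subtrees.\<close>

lemma path_in_fibre:
  assumes "x \<in> verts T" "y \<in> verts T" "h x = h y" "z \<in> set (path_between (edges T) x y)"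
  shows "h z = h x"
proof -
  let ?C = "{e \<in> edges T. h (fst e) = h (snd e)}"
  obtain xs where xs: "simple_path ?C x xs y"
    using rtrancl_imp_simple_path[OF collapses_to_rtrancl[OF collapses assms(1-3)]] by blast
  then have "path_between (edges T) x y = xs"
    by (intro T.path_between_eq) (auto elim: simple_path_mono)
  then have "(x, z) \<in> ?C\<^sup>*" using simple_path_imp_rtrancl[OF xs] assms(4) by simp
  then show ?thesis by (induction rule: rtrancl_induct) auto
qed

text \<open>From \<open>x\<close> to \<open>y'\<close> one can move inside the first fibre and then
  cross by the second edge, or cross by the first edge and then move inside the other fibre. The two
  paths agree, and as the fibres are disjoint neither contains a detour.\<close>

lemma edge_lift_unique:
  assumes "(x, y) \<in> edges T" "(x', y') \<in> edges T" "h x = h x'" "h y = h y'" "h x \<noteq> h y"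
  shows "x = x'" "y = y'"
proof -
  note v = T.edge_verts(1,2)[OF assms(1)] T.edge_verts(1,2)[OF assms(2)]
  define p where "p = path_between (edges T) x x'"
  define q where "q = path_between (edges T) y y'"
  have p: "simple_path (edges T) x p x'" and q: "simple_path (edges T) y q y'"
    using v T.path_between unfolding p_def q_def by auto
  have hp: "\<And>z. z \<in> set p \<Longrightarrow> h z = h x" and hq: "\<And>z. z \<in> set q \<Longrightarrow> h z = h y"
    using path_in_fibre[OF v(1,3) assms(3)] path_in_fibre[OF v(2,4) assms(4)]
    unfolding p_def q_def by simp_all
  have "y' \<notin> set p" "x \<notin> set q" using hp hq assms by auto
  then have "simple_path (edges T) x (p @ [y']) y'"
    using assms(2) by (intro simple_path_append[OF p simple_path_edge]) (auto simp: T.edge_verts)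
  moreover have "simple_path (edges T) x (x # q) y'"
    using simple_path_Cons q assms(1) \<open>x \<notin> set q\<close> by metis
  ultimately have eq: "p @ [y'] = x # q" using simple_path_unique[OF T.acyc] by blast
  then obtain p' where p': "p = x # p'" "q = p' @ [y']" using p by (cases p) (auto simp: simple_path_def)
  have "p' = []"
  proof (rule ccontr)
    assume "p' \<noteq> []"
    then have "hd p' \<in> set p" "hd p' \<in> set q" using p' by auto
    then show False using hp[of "hd p'"] hq[of "hd p'"] assms(5) by simp
  qed
  then show "x = x'" "y = y'" using p q p' by (auto simp: simple_path_def)
qed

text \<open>A group acting on a fibre and fixing a vertex \<open>w\<close> anywhere in the tree fixes the vertex of
  the fibre closest to \<open>w\<close>.\<close>

lemma fibre_root:
  assumes r: "r \<in> verts R" and ell: "elliptic T (R.St r)"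
  shows "\<exists>z\<in>verts T. h z = r \<and> T.St z = R.St r"
proof -
  obtain w where w: "w \<in> verts T" and fix_w: "\<And>k. k \<in> R.St r \<Longrightarrow> act T k w = w"
    using ell unfolding elliptic_def by blast
  obtain x where x: "x \<in> verts T" "h x = r" using h_surj r by blast
  have px: "simple_path (edges T) w (path_between (edges T) w x) x" using T.path_between w x by blast
  then have "x \<in> set (path_between (edges T) w x)" unfolding simple_path_def by (metis last_in_set)
  then obtain as z bs where split: "path_between (edges T) w x = as @ z # bs" and z: "h z = r"
    and as: "\<forall>a\<in>set as. h a \<noteq> r"
    using split_list_first_prop[of _ "\<lambda>z. h z = r"] x(2) by metis
  have pz: "simple_path (edges T) w (as @ [z]) z" using px unfolding split by (rule simple_path_prefix)
  then have zV: "z \<in> verts T" and asV: "set as \<subseteq> verts T" using T.simple_path_verts[OF pz w] by auto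
  have "act T k z = z" if k: "k \<in> R.St r" for k
  proof -
    have kG: "k \<in> carrier G" using k by (simp add: R.in_St)
    have kz: "act T k z \<in> verts T" "h (act T k z) = r" using k kG zV z by (auto simp: h_act T.act_closed R.in_St)
    obtain cs where cs: "path_between (edges T) z (act T k z) = z # cs"
      using T.path_between[OF zV kz(1)] by (cases "path_between (edges T) z (act T k z)") (auto simp: simple_path_def)
    have hcs: "\<forall>c\<in>set cs. h c = r" using path_in_fibre[OF zV kz(1)] cs z kz by simp
    have "z \<notin> set cs" using T.path_between[OF zV kz(1)] cs by (auto simp: simple_path_def)
    then have "simple_path (edges T) w ((as @ [z]) @ cs) (act T k z)"
      using T.path_between[OF zV kz(1)] as hcs unfolding cs by (intro simple_path_append[OF pz]) auto
    moreover have "path_between (edges T) w (act T k z) = map (act T k) (as @ [z])"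
      using T.path_map[OF kG w zV] T.path_between_eq[OF pz] fix_w[OF k] by simp
    ultimately have eq: "as @ z # cs = map (act T k) as @ [act T k z]"
      using T.path_between_eq by force
    have "h (act T k a) \<noteq> r" if "a \<in> set as" for a
    proof
      assume "h (act T k a) = r"
      then have "act R k (h a) = act R k r" using that asV h_act kG k by (auto simp: R.in_St)
      then show False using R.act_inj kG r h_verts that asV as by blast
    qed
    \<comment> \<open>The path from \<open>w\<close> to \<open>act T k z\<close> is known in two
      ways: through \<open>z\<close> and then inside the fibre, and as the image of the path to
      \<open>z\<close>. Its part in the fibre is \<open>z # cs\<close> by the first and the single
      vertex \<open>act T k z\<close> by the second.\<close>
    then have "filter (\<lambda>c. h c = r) (map (act T k) as @ [act T k z]) = [act T k z]"
      using kz by (auto simp: filter_empty_conv)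
    moreover have "filter (\<lambda>c. h c = r) (as @ z # cs) = z # cs"
      using as hcs z by (auto simp: filter_empty_conv filter_id_conv)
    ultimately show ?thesis using eq by simp
  qed
  then have "R.St r \<subseteq> T.St z" by (auto simp: T.in_St R.in_St)
  then show ?thesis using zV z St_subset by blast
qed

end

text \<open>The assumption \<open>ell\<close> says that the collapse creates no new elliptic
  subgroups, that is, that it stays in the deformation space.\<close>

locale reduced_collapse = collapse +
  assumes reduced: "reduced G R" and ell: "\<And>r. r \<in> verts R \<Longrightarrow> elliptic T (R.St r)"
begin

text \<open>By \<open>fibre_root\<close> the stabilizer of \<open>h v\<close> fixes a vertex
  \<open>z\<close> of the fibre. If \<open>z\<close> were not \<open>v\<close>, the path from
  \<open>v\<close> to \<open>z\<close> would be fixed by \<open>T.St v\<close> and hence begin with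
  the edge \<open>(v, u)\<close>, which leaves the fibre.\<close>

lemma stab_leaf_St:
  assumes "T.stab_leaf v u" "h v \<noteq> h u"
  shows "T.St v = R.St (h v)"
proof -
  have v: "v \<in> verts T" using assms T.edge_verts unfolding T.stab_leaf_def by auto
  obtain z where z: "z \<in> verts T" "h z = h v" "T.St z = R.St (h v)"
    using fibre_root[OF h_verts ell] h_verts v by blast
  have "z = v"
  proof (rule ccontr)
    assume "z \<noteq> v"
    let ?p = "path_between (edges T) v z"
    have p: "simple_path (edges T) v ?p z" using T.path_between v z by blast
    then obtain x xs where xs: "?p = v # x # xs" "(v, x) \<in> edges T"
      using \<open>z \<noteq> v\<close> unfolding simple_path_def
      by (cases ?p; cases "tl ?p") auto
    have "T.St v \<subseteq> T.St x"
      using T.path_fixed[of _ v z x] v z xs(1) St_subset[OF v] by (auto simp del: T.in_St)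
    then have "x = u" using assms(1) xs unfolding T.stab_leaf_def by blast
    moreover have "h x = h v" using path_in_fibre[of v z x] v z xs by simp
    ultimately show False using assms(2) by simp
  qed
  then show ?thesis using z by simp
qed

text \<open>Collapsing the fibres turns the edge \<open>(v, u)\<close> into an edge whose stabilizer is the full
  stabilizer of its origin; since \<open>R\<close> is reduced, that edge is a loop of the quotient graph.\<close>

lemma stab_leaf_loop:
  assumes vu: "T.stab_leaf v u" and ne: "h v \<noteq> h u"
  obtains g p n where "g \<in> carrier G" "h u = act R g (h v)" "has_ascending_loop G R"
    "length p = Suc n" "0 < n" "p ! 0 = v" "p ! 1 = u" "p ! n = act T g v"
    "\<And>i. i < n \<Longrightarrow> (p ! i, p ! Suc i) \<in> edges T" "\<And>i. i < n \<Longrightarrow> T.St (p ! i) \<subseteq> T.St (p ! Suc i)"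
    "\<And>i. i < n \<Longrightarrow> 0 < i \<Longrightarrow> h (p ! i) = h (p ! Suc i)"
    "\<And>i w. i < n \<Longrightarrow> T.stab_leaf (p ! Suc i) w \<Longrightarrow> \<not> T.St (p ! Suc i) \<subseteq> T.St (p ! i)"
proof -
  have e: "(v, u) \<in> edges T" "T.St v \<subseteq> T.St u" using vu unfolding T.stab_leaf_def by auto
  then have v: "v \<in> verts T" "u \<in> verts T" using T.edge_verts by auto
  note Stv = stab_leaf_St[OF vu ne]
  have e': "(h v, h u) \<in> edges R" using h_edge e ne by blast
  have "R.St (h v) \<subseteq> R.St (h u)" using e St_subset[OF v(2)] Stv by simp
  then have es: "edge_stab G R (h v, h u) = R.St (h v)" unfolding R.edge_stab_eq by blast
  then have "same_orbit G R (h v) (h u)" using reduced e' unfolding reduced_def collapsible_def by auto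
  then obtain g where g: "g \<in> carrier G" "h u = act R g (h v)" unfolding same_orbit_def by auto
  have gv: "act T g v \<in> verts T" "h (act T g v) = h u" using g v T.act_closed h_act by auto
  have Stgv: "T.St (act T g v) = R.St (h u)"
    using T.St_act[OF g(1) v(1)] R.St_act[OF g(1) h_verts[OF v(1)]] g Stv by simp
  define q where "q = path_between (edges T) u (act T g v)"
  have q: "simple_path (edges T) u q (act T g v)" using T.path_between v gv unfolding q_def by blast
  have hq: "h x = h u" if "x \<in> set q" for x using path_in_fibre[of u "act T g v" x] v gv that unfolding q_def by simp
  have qV: "set q \<subseteq> verts T" using T.simple_path_verts q v by blast
  \<comment> \<open>The path crosses the edge \<open>(v, u)\<close> and then stays in the fibre over
    \<open>h u\<close> until it reaches the translate of \<open>v\<close> there.\<close>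
  define p where "p = v # q"
  define n where "n = length q"
  have "v \<notin> set q" using hq ne by auto
  then have p: "simple_path (edges T) v p (act T g v)"
    using simple_path_Cons q e unfolding p_def by metis
  have n: "0 < n" "length p = Suc n" using q by (auto simp: n_def p_def simple_path_def)
  have p1: "p ! 0 = v" "p ! 1 = u" "p ! n = act T g v"
    using q n by (auto simp: p_def n_def simple_path_def hd_conv_nth last_conv_nth)
  have pE: "(p ! i, p ! Suc i) \<in> edges T" if "i < n" for i
    using p that n by (auto simp: simple_path_def successively_conv_nth)
  have ph: "h (p ! i) = h u" if "0 < i" "i \<le> n" for i
    using hq[of "q ! (i - 1)"] that by (simp add: p_def n_def)
  have pV: "p ! i \<in> verts T" if "i \<le> n" for i
    using T.simple_path_verts[OF p v(1)] nth_mem[of i p] that n by (simp add: subset_iff)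
  \<comment> \<open>The end \<open>act T g v\<close> has the whole stabilizer of \<open>h u\<close>,
    which contains the stabilizer of each vertex of this fibre; what fixes a vertex of
    \<open>p\<close> and the end also fixes everything in between.\<close>
  have pS: "T.St (p ! i) \<subseteq> T.St (p ! Suc i)" if "i < n" for i
  proof (cases i)
    case 0 then show ?thesis using e p1 by simp
  next
    case (Suc j)
    have split: "p = take i p @ p ! i # drop (Suc i) p" using that n by (simp add: id_take_nth_drop)
    then have "simple_path (edges T) (p ! i) (p ! i # drop (Suc i) p) (act T g v)"
      using simple_path_suffix p by metis
    then have "path_between (edges T) (p ! i) (act T g v) = p ! i # drop (Suc i) p"
      by (rule T.path_between_eq)
    moreover have "p ! Suc i \<in> set (drop (Suc i) p)" using that n by (metis Cons_nth_drop_Suc Suc_mono list.set_intros(1))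
    ultimately have mem: "p ! Suc i \<in> set (path_between (edges T) (p ! i) (act T g v))" by simp
    have "T.St (p ! i) \<subseteq> T.St (act T g v)"
      using St_subset[OF pV[of i]] ph[of i] that Suc Stgv by simp
    then show ?thesis using T.path_fixed[OF _ _ pV[of i] gv(1) mem] that by (meson less_imp_le subset_iff)
  qed
  have mono: "T.St (p ! i) \<subseteq> T.St (p ! j)" if "i \<le> j" "j \<le> n" for i j
    using that by (induction rule: dec_induct) (use pS in \<open>auto dest!: Suc_le_lessD\<close>)
  \<comment> \<open>Otherwise \<open>p\<close> would arrive along the translate by \<open>g\<close>
    of the edge \<open>(v, u)\<close>. That edge is not collapsed, so it is the first edge of
    \<open>p\<close>, and then \<open>g\<close> inverts \<open>(v, u)\<close>.\<close>
  have pn: "\<not> T.St (act T g v) \<subseteq> T.St (p ! (n - 1))"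
  proof
    assume a: "T.St (act T g v) \<subseteq> T.St (p ! (n - 1))"
    have "(p ! (n - 1), act T g v) \<in> edges T" using pE[of "n - 1"] n p1 by simp
    then have "p ! (n - 1) = act T g u"
      using T.stab_leaf_act[OF g(1) vu] a T.edge_verts(4) unfolding T.stab_leaf_def by blast
    moreover have "h (act T g u) \<noteq> h (act T g v)"
      using R.act_inj[OF g(1) h_verts[OF v(2)] h_verts[OF v(1)]] h_act[OF g(1)] ne v by metis
    ultimately have "n = 1" using ph[of "n - 1"] gv n by (cases "n - 1 = 0") auto
    then have "v = act T g u" "u = act T g v" using p1 \<open>p ! (n - 1) = act T g u\<close> by auto
    then show False using T.no_inversion[OF g(1) e(1)] by metis
  qed
  \<comment> \<open>At an inner vertex of \<open>p\<close> the next edge is already the unique edge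
    fixed by the stabilizer, and a path does not turn back.\<close>
  have strict: "\<not> T.St (p ! Suc i) \<subseteq> T.St (p ! i)" if i: "i < n" and w: "T.stab_leaf (p ! Suc i) w" for i w
  proof (cases "Suc i = n")
    case True then show ?thesis using pn p1 by force
  next
    case False
    then have i2: "Suc (Suc i) \<le> n" using i by simp
    then have "p ! Suc (Suc i) = w" using pE[of "Suc i"] pS[of "Suc i"] w unfolding T.stab_leaf_def by auto
    moreover have "p ! i \<noteq> p ! Suc (Suc i)"
      using p i2 n by (auto simp: simple_path_def nth_eq_iff_index_eq)
    ultimately show ?thesis using w pE[OF i] T.edge_verts(4) unfolding T.stab_leaf_def by blast
  qed
  have "\<not> T.St (act T g v) \<subseteq> T.St v"
    using pn mono[of 0 "n - 1"] n p1 by auto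
  then have "R.St (h v) \<subset> R.St (h u)" using Stv Stgv \<open>R.St (h v) \<subseteq> R.St (h u)\<close> by auto
  then have "has_ascending_loop G R"
    using e' es \<open>same_orbit G R (h v) (h u)\<close> unfolding has_ascending_loop_def by (intro bexI[of _ "(h v, h u)"]) auto
  then show thesis
    using that[OF g _ n(2,1) p1 pE pS _ strict] ph by simp
qed

end

section \<open>Counting vertices of the quotient graph\<close>

context tree
begin

lemma path_self: "u \<in> V \<Longrightarrow> path_between E u u = [u]"
  by (rule path_between_eq) (simp add: simple_path_def)

lemma path_edge: "(u, v) \<in> E \<Longrightarrow> path_between E u v = [u, v]"
  by (rule path_between_eq) (simp add: simple_path_edge edge_verts)

lemma path_split:
  assumes "u \<in> V" "v \<in> V" "path_between E u v = as @ z # bs"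
  shows "path_between E u z = as @ [z]" "path_between E z v = z # bs"
  using path_between[OF assms(1,2)] assms(3)
  by (auto intro!: path_between_eq dest: simple_path_prefix simple_path_suffix)

lemma path_snoc_edge:
  assumes "(x, z) \<in> E" "u \<in> V"
  shows "path_between E u z = path_between E u x @ [z] \<or> path_between E u x = path_between E u z @ [x]"
proof (cases "z \<in> set (path_between E u x)")
  case False
  have "simple_path E u (path_between E u x @ [z]) z"
    using path_between[of u x] assms False edge_verts(1,3)[OF assms(1)]
    by (intro simple_path_append[OF _ simple_path_edge]) auto
  then show ?thesis using path_between_eq by blast
next
  case True
  then obtain as bs where split: "path_between E u x = as @ z # bs" by (meson split_list)
  note path_split[OF assms(2) _ split]
  moreover have "path_between E z x = [z, x]" using assms edge_verts path_edge by blast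
  ultimately show ?thesis using split assms edge_verts by simp
qed

end

context G_tree
begin

definition rigid :: "'v \<Rightarrow> bool" where
  "rigid v \<longleftrightarrow> v \<in> verts T \<and> (\<forall>w. (v, w) \<in> edges T \<longrightarrow> \<not> St v \<subseteq> St w)"

lemma elliptic_iff: "H \<subseteq> carrier G \<Longrightarrow> elliptic T H \<longleftrightarrow> (\<exists>v\<in>verts T. H \<subseteq> St v)"
  unfolding elliptic_def by (meson in_St subset_iff)

lemma St_carrier: "St x \<subseteq> carrier G"
  by (auto simp: in_St)

text \<open>The vertices fixed by \<open>St v\<close> span a subtree, so a second one would yield an
  edge at \<open>v\<close> with fixed end.\<close>

lemma rigid_unique_fixed:
  assumes "rigid v" "w \<in> verts T" "St v \<subseteq> St w"
  shows "w = v"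
proof (rule ccontr)
  assume "w \<noteq> v"
  have v: "v \<in> verts T" using assms by (simp add: rigid_def)
  have "simple_path (edges T) v (path_between (edges T) v w) w" using path_between v assms by blast
  then obtain x xs where xs: "path_between (edges T) v w = v # x # xs" "(v, x) \<in> edges T"
    using \<open>w \<noteq> v\<close> unfolding simple_path_def
    by (cases "path_between (edges T) v w"; cases "tl (path_between (edges T) v w)") auto
  then have "St v \<subseteq> St x" using path_fixed[OF _ _ v assms(2), of _ x] assms(3) by auto
  then show False using assms(1) xs unfolding rigid_def by blast
qed

lemma rigid_act:
  assumes "rigid v" "g \<in> carrier G"
  shows "rigid (act T g v)"
  unfolding rigid_def
proof (intro conjI allI impI notI)
  have v: "v \<in> verts T" using assms by (simp add: rigid_def)
  then show "act T g v \<in> verts T" using assms act_closed by blast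
  fix w assume w: "(act T g v, w) \<in> edges T" "St (act T g v) \<subseteq> St w"
  have wV: "w \<in> verts T" using w edge_verts by blast
  then have "w = act T g (act T (inv g) w)" "act T (inv g) w \<in> verts T"
    using assms by (auto simp: act_inv act_closed)
  then have "(v, act T (inv g) w) \<in> edges T" "St v \<subseteq> St (act T (inv g) w)"
    using act_edge_iff[OF assms(2) v] St_act_subset_iff[OF assms(2) v] w by metis+
  then show False using assms(1) unfolding rigid_def by blast
qed

text \<open>Each vertex stabilizer of \<open>T0\<close> fixes some vertex \<open>w x\<close> of
  \<open>T\<close>. If \<open>v\<close> is rigid, \<open>St v\<close> lies in the stabilizer of some
  \<open>x\<close> in \<open>T0\<close>, hence in that of \<open>w x\<close>, which forces
  \<open>w x = v\<close>. So the orbits of \<open>T0\<close> reach all rigid orbits.\<close>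

lemma card_rigid_orbits:
  fixes T0 :: "('g, 'v) gtree"
  assumes T0: "G_tree G T0" and fin: "finite (quotient_verts G T0)"
    and ell: "\<And>H. subgroup H G \<Longrightarrow> elliptic T H \<longleftrightarrow> elliptic T0 H"
  shows "finite (orb ` {v. rigid v})" "card (orb ` {v. rigid v}) \<le> card (quotient_verts G T0)"
proof -
  interpret T0: G_tree G T0 by fact
  have fixed: "\<exists>w\<in>verts T. T0.St x \<subseteq> St w" if "x \<in> verts T0" for x
  proof -
    have "elliptic T0 (T0.St x)" using that T0.elliptic_iff[OF T0.St_carrier] by blast
    then have "elliptic T (T0.St x)" using ell T0.St_subgroup that by blast
    then show ?thesis using elliptic_iff[OF T0.St_carrier] by blast
  qed
  define w where "w x = (SOME w. w \<in> verts T \<and> T0.St x \<subseteq> St w)" for x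
  have w: "w x \<in> verts T \<and> T0.St x \<subseteq> St (w x)" if "x \<in> verts T0" for x
    unfolding w_def using someI_ex[of "\<lambda>w. w \<in> verts T \<and> T0.St x \<subseteq> St w"] fixed[OF that] by blast
  \<comment> \<open>The choice of \<open>w\<close> is not equivariant; one vertex is therefore fixed
    in each orbit of \<open>T0\<close>, and \<open>v\<close> is translated accordingly.\<close>
  define rep where "rep Z = (SOME z. z \<in> Z)" for Z :: "'v set"
  have "orb ` {v. rigid v} \<subseteq> (\<lambda>Z. orb (w (rep Z))) ` quotient_verts G T0"
  proof
    fix Y assume "Y \<in> orb ` {v. rigid v}"
    then obtain v where v: "rigid v" "Y = orb v" "v \<in> verts T" by (auto simp: rigid_def)
    have "elliptic T (St v)" using v elliptic_iff[OF St_carrier] by blast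
    then have "elliptic T0 (St v)" using ell St_subgroup v by blast
    then obtain x where x: "x \<in> verts T0" "St v \<subseteq> T0.St x"
      using T0.elliptic_iff[OF St_carrier] by blast
    have "rep (T0.orb x) \<in> T0.orb x" unfolding rep_def using T0.orb_refl[OF x(1)] by (rule someI)
    then obtain g where g: "g \<in> carrier G" "rep (T0.orb x) = act T0 g x" by (auto simp: T0.in_orb)
    have "St (act T g v) \<subseteq> T0.St (act T0 g x)"
      using x(2) unfolding St_act[OF g(1) v(3)] T0.St_act[OF g(1) x(1)] by blast
    then have "St (act T g v) \<subseteq> St (w (act T0 g x))" using w[of "act T0 g x"] T0.act_closed g x by blast
    then have "w (act T0 g x) = act T g v"
      using rigid_unique_fixed[OF rigid_act[OF v(1) g(1)]] w T0.act_closed g x by blast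
    then have "Y = orb (w (rep (T0.orb x)))" using v g orb_act by simp
    then show "Y \<in> (\<lambda>Z. orb (w (rep Z))) ` quotient_verts G T0"
      using x unfolding T0.quotient_verts_eq by blast
  qed
  then show "finite (orb ` {v. rigid v})" "card (orb ` {v. rigid v}) \<le> card (quotient_verts G T0)"
    using surj_card_le[OF fin] finite_surj[OF fin] by simp_all
qed

end

text \<open>The integral of a mod 2 cochain \<open>w\<close> along a walk; addition mod 2 is
  inequality of truth values.\<close>

fun walk_parity :: "('v \<Rightarrow> 'v \<Rightarrow> bool) \<Rightarrow> 'v list \<Rightarrow> bool" where
  "walk_parity w (x # y # zs) = (w x y \<noteq> walk_parity w (y # zs))"
| "walk_parity w _ = False"

lemma walk_parity_snoc: "xs \<noteq> [] \<Longrightarrow> walk_parity w (xs @ [z]) = (walk_parity w xs \<noteq> w (last xs) z)"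
  by (induction w xs rule: walk_parity.induct) auto

lemma walk_parity_xor:
  assumes "successively (\<lambda>x y. (x, y) \<in> E) xs" "\<And>x y. (x, y) \<in> E \<Longrightarrow> w x y = (w1 x y \<noteq> w2 x y)"
  shows "walk_parity w xs = (walk_parity w1 xs \<noteq> walk_parity w2 xs)"
  using assms(1) by (induction xs rule: induct_list012) (auto simp: assms(2))

section \<open>Mod 2 cochains and the size of the quotient graph\<close>

context G_tree
begin

text \<open>On a tree, integration from \<open>y\<close> gives a primitive \<open>b\<close> of
  \<open>w\<close>. By invariance of \<open>w\<close>, the difference of
  \<open>b (act T g x)\<close> and \<open>b x\<close> does not depend on \<open>x\<close>; it
  vanishes for the generators by \<open>van\<close>, hence for all of the group.\<close>

lemma invariant_coboundary:
  assumes S: "S \<subseteq> carrier G" "generate G S = carrier G" and y: "y \<in> verts T"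
    and sym: "\<And>x z. w x z = w z x"
    and inv: "\<And>g x z. g \<in> carrier G \<Longrightarrow> (x, z) \<in> edges T \<Longrightarrow> w (act T g x) (act T g z) = w x z"
    and van: "\<And>s. s \<in> S \<Longrightarrow> \<not> walk_parity w (path_between (edges T) y (act T s y))"
  shows "\<exists>b :: 'v \<Rightarrow> bool. (\<forall>g\<in>carrier G. \<forall>x\<in>verts T. b (act T g x) = b x) \<and>
             (\<forall>x z. (x, z) \<in> edges T \<longrightarrow> w x z = (b x \<noteq> b z))"
proof -
  define b where "b x = walk_parity w (path_between (edges T) y x)" for x
  have ne: "path_between (edges T) y x \<noteq> []" "last (path_between (edges T) y x) = x" if "x \<in> verts T" for x
    using path_between[OF y that] unfolding simple_path_def by auto
  have b_edge: "b z = (b x \<noteq> w x z)" if xz: "(x, z) \<in> edges T" for x z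
    using path_snoc_edge[OF xz y] ne[OF edge_verts(1)[OF xz]] ne[OF edge_verts(2)[OF xz]]
      walk_parity_snoc[of "path_between (edges T) y x" w z]
      walk_parity_snoc[of "path_between (edges T) y z" w x] sym[of x z]
    unfolding b_def by metis
  have const: "(b (act T g x) = b x) = (b (act T g y) = b y)" if g: "g \<in> carrier G" and x: "x \<in> verts T" for g x
    using connected[OF y x]
  proof (induction rule: rtrancl_induct)
    case (step x z)
    then show ?case using b_edge[OF step(2)] b_edge[OF act_edge[OF g step(2)]] inv[OF g step(2)] by auto
  qed simp
  have "b y = False" unfolding b_def using path_self[OF y] by simp
  then have bS: "b (act T s x) = b x" if "s \<in> S" "x \<in> verts T" for s x
    using const[of s x] van[OF that(1)] S that unfolding b_def by auto
  have "\<forall>x\<in>verts T. b (act T g x) = b x" if "g \<in> carrier G" for g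
  proof (rule generate_induct_act[OF S that])
    show "\<forall>x\<in>verts T. b (act T (inv s) x) = b x" if "s \<in> carrier G" "\<forall>x\<in>verts T. b (act T s x) = b x" for s
      using that act_inv(2)[OF that(1)] act_closed[OF inv_closed[OF that(1)]] by metis
  qed (use bS in \<open>auto simp: act_one act_mult act_closed\<close>)
  moreover have "\<forall>x z. (x, z) \<in> edges T \<longrightarrow> w x z = (b x \<noteq> b z)" using b_edge by blast
  ultimately show ?thesis by (intro exI[of _ b]) blast
qed

text \<open>An orientation of the quotient graph: each edge orbit differs from its reverse, and an
  injective numbering singles out the one with the smaller number.\<close>

lemma quotient_edges_half:
  assumes "finite (quotient_edges G T)"
  obtains P where "P \<subseteq> quotient_edges G T" "card (quotient_edges G T) \<le> 2 * card P"
    "\<And>x y. (x, y) \<in> edges T \<Longrightarrow> eorb (x, y) \<in> P \<longleftrightarrow> eorb (y, x) \<notin> P"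
proof -
  obtain f :: "('v \<times> 'v) set \<Rightarrow> nat" where f: "inj_on f (quotient_edges G T)"
    using finite_imp_inj_to_nat_seg[OF assms] by (elim exE conjE)
  define P where "P = {X \<in> quotient_edges G T. f X < f (prod.swap ` X)}"
  have PE: "eorb (x, y) \<in> P \<longleftrightarrow> eorb (y, x) \<notin> P" if xy: "(x, y) \<in> edges T" for x y
  proof -
    have "eorb (x, y) \<in> quotient_edges G T" "eorb (y, x) \<in> quotient_edges G T"
      unfolding quotient_edges_eq using xy edge_verts(4) by auto
    moreover have "f (eorb (x, y)) \<noteq> f (eorb (y, x))"
      using inj_onD[OF f _ calculation] eorb_swap_neq[OF xy] by blast
    ultimately show ?thesis unfolding P_def by (auto simp: swap_eorb)
  qed
  have "quotient_edges G T \<subseteq> P \<union> (\<lambda>X. prod.swap ` X) ` P"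
  proof
    fix X assume "X \<in> quotient_edges G T"
    then obtain x y where xy: "(x, y) \<in> edges T" "X = eorb (x, y)" by (auto simp: quotient_edges_eq)
    show "X \<in> P \<union> (\<lambda>X. prod.swap ` X) ` P"
    proof (cases "X \<in> P")
      case False
      then have "eorb (y, x) \<in> P" using PE[OF xy(1)] xy by simp
      moreover have "X = prod.swap ` eorb (y, x)" using xy swap_eorb by simp
      ultimately show ?thesis by blast
    qed simp
  qed
  moreover have fP: "finite P" unfolding P_def using assms by simp
  ultimately have "card (quotient_edges G T) \<le> card (P \<union> (\<lambda>X. prod.swap ` X) ` P)"
    by (intro card_mono) auto
  also have "\<dots> \<le> card P + card ((\<lambda>X. prod.swap ` X) ` P)" by (rule card_Un_le)
  also have "\<dots> \<le> 2 * card P" using card_image_le[OF fP] by simp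
  finally show thesis using that[of P] PE unfolding P_def by blast
qed

text \<open>Counting mod 2 cochains on the quotient graph: they are determined by their periods along
  the generators up to coboundaries.\<close>

lemma card_quotient_edges_le:
  assumes S: "S \<subseteq> carrier G" "generate G S = carrier G" "finite S"
  shows "card (quotient_edges G T) \<le> 2 * (card S + card (quotient_verts G T))"
proof -
  note fin = finite_quotient[OF S]
  obtain P where P: "P \<subseteq> quotient_edges G T" "card (quotient_edges G T) \<le> 2 * card P"
    and PE: "\<And>x y. (x, y) \<in> edges T \<Longrightarrow> eorb (x, y) \<in> P \<longleftrightarrow> eorb (y, x) \<notin> P"
    using quotient_edges_half[OF fin(2)] by metis
  have fP: "finite P" using P fin finite_subset by blast
  obtain y where y: "y \<in> verts T" using nonempty by blast
  \<comment> \<open>A set \<open>A\<close> of oriented edges is a cochain with indicator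
    \<open>w A\<close> on \<open>T\<close> and periods \<open>\<Phi> A\<close>;
    \<open>\<delta> B\<close> is the coboundary of a set of vertex orbits, and \<open>A0 C\<close>
    is some cochain with periods \<open>C\<close>, if there is one.\<close>
  define w where "w A x z \<longleftrightarrow> eorb (x, z) \<in> A \<or> eorb (z, x) \<in> A" for A x z
  define \<Phi> where "\<Phi> A = {s \<in> S. walk_parity (w A) (path_between (edges T) y (act T s y))}" for A
  define \<delta> where "\<delta> B = {X \<in> P. \<exists>x z. (x, z) \<in> edges T \<and> X = eorb (x, z) \<and> (orb x \<in> B) \<noteq> (orb z \<in> B)}" for B
  define A0 where "A0 C = (SOME A. A \<subseteq> P \<and> \<Phi> A = C)" for C
  \<comment> \<open>A cochain is recovered from its periods and a primitive of its difference to the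
    chosen cochain with the same periods.\<close>
  have "Pow P \<subseteq> (\<lambda>(C, B). sym_diff (A0 C) (\<delta> B)) ` (Pow S \<times> Pow (quotient_verts G T))"
  proof
    fix A assume "A \<in> Pow P"
    then have A: "A \<subseteq> P" by simp
    have A0: "A0 (\<Phi> A) \<subseteq> P \<and> \<Phi> (A0 (\<Phi> A)) = \<Phi> A"
      unfolding A0_def by (rule someI[of "\<lambda>A'. A' \<subseteq> P \<and> \<Phi> A' = \<Phi> A" A]) (simp add: A)
    define D where "D = sym_diff A (A0 (\<Phi> A))"
    have DP: "D \<subseteq> P" using A A0 by (auto simp: D_def)
    have wD: "w D x z = (w A x z \<noteq> w (A0 (\<Phi> A)) x z)" if xz: "(x, z) \<in> edges T" for x z
      using PE[OF xz] A A0 unfolding w_def D_def by blast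
    have van: "\<not> walk_parity (w D) (path_between (edges T) y (act T s y))" if s: "s \<in> S" for s
    proof -
      have "successively (\<lambda>x y. (x, y) \<in> edges T) (path_between (edges T) y (act T s y))"
        using path_between[OF y act_closed[OF subsetD[OF S(1) s] y]] by (simp add: simple_path_def)
      from walk_parity_xor[OF this, of "w D" "w A" "w (A0 (\<Phi> A))"] wD show ?thesis using A0 s unfolding \<Phi>_def by blast
    qed
    have "eorb (act T g x, act T g z) = eorb (x, z)" if "g \<in> carrier G" "(x, z) \<in> edges T" for g x z
      using that by (intro eorb_eqI) (auto simp: in_eorb)
    then have inv: "w D (act T g x) (act T g z) = w D x z" if "g \<in> carrier G" "(x, z) \<in> edges T" for g x z
      using that edge_verts(4) unfolding w_def by simp
    have sym: "w D x z = w D z x" for x z unfolding w_def by blast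
    have "\<exists>b :: 'v \<Rightarrow> bool. (\<forall>g\<in>carrier G. \<forall>x\<in>verts T. b (act T g x) = b x) \<and>
             (\<forall>x z. (x, z) \<in> edges T \<longrightarrow> w D x z = (b x \<noteq> b z))"
      by (rule invariant_coboundary[OF S(1,2) y sym]) (use inv van in auto)
    then obtain b :: "'v \<Rightarrow> bool" where b: "\<And>g x. g \<in> carrier G \<Longrightarrow> x \<in> verts T \<Longrightarrow> b (act T g x) = b x"
      and wb: "\<And>x z. (x, z) \<in> edges T \<Longrightarrow> w D x z = (b x \<noteq> b z)"
      by blast
    define B where "B = orb ` {x \<in> verts T. b x}"
    have inB: "orb x \<in> B \<longleftrightarrow> b x" if x: "x \<in> verts T" for x
    proof
      assume "orb x \<in> B"
      then obtain x' where x': "x' \<in> verts T" "b x'" "orb x = orb x'" unfolding B_def by blast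
      then show "b x" using orb_eq_iff[OF x x'(1)] b by auto
    qed (use x in \<open>auto simp: B_def\<close>)
    have "X \<in> D \<longleftrightarrow> X \<in> \<delta> B" if X: "X \<in> P" for X
    proof
      assume "X \<in> D"
      obtain x z where xz: "(x, z) \<in> edges T" "X = eorb (x, z)" using X P by (auto simp: quotient_edges_eq)
      then have "w D x z" using \<open>X \<in> D\<close> by (simp add: w_def)
      then show "X \<in> \<delta> B" using xz X wb inB edge_verts unfolding \<delta>_def by blast
    next
      assume "X \<in> \<delta> B"
      then obtain x z where xz: "(x, z) \<in> edges T" "X = eorb (x, z)" "(orb x \<in> B) \<noteq> (orb z \<in> B)"
        unfolding \<delta>_def by blast
      then have "w D x z" using wb inB edge_verts by blast
      then show "X \<in> D" using xz X PE[OF xz(1)] DP unfolding w_def by blast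
    qed
    then have "D = \<delta> B" using DP unfolding \<delta>_def by blast
    then have "A = sym_diff (A0 (\<Phi> A)) (\<delta> B)" unfolding D_def by blast
    moreover have "\<Phi> A \<in> Pow S" "B \<in> Pow (quotient_verts G T)"
      unfolding \<Phi>_def B_def quotient_verts_eq by auto
    ultimately show "A \<in> (\<lambda>(C, B). sym_diff (A0 C) (\<delta> B)) ` (Pow S \<times> Pow (quotient_verts G T))"
      by (intro image_eqI[of _ _ "(\<Phi> A, B)"]) auto
  qed
  then have "card (Pow P) \<le> card (Pow S \<times> Pow (quotient_verts G T))"
    using S(3) fin by (intro surj_card_le) auto
  then have "(2::nat) ^ card P \<le> 2 ^ (card S + card (quotient_verts G T))"
    using S(3) fin fP by (simp add: card_Pow card_cartesian_product power_add)
  then have "card P \<le> card S + card (quotient_verts G T)" by (simp add: power_le_imp_le_exp)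
  then show ?thesis using P by simp
qed

text \<open>At a vertex that is neither rigid nor a leaf, \<open>St v\<close> fixes two edges; as
  \<open>v\<close> is not a subdivision vertex there is a third one, and the three lie in different
  orbits. Comparing the sum of the valences with \<open>card_quotient_edges_le\<close> leaves one
  copy of the number of vertices to be bounded.\<close>

lemma card_quotient_verts_le:
  assumes S: "S \<subseteq> carrier G" "generate G S = carrier G" "finite S"
    and nosub: "no_subdivision_vertices G T"
  shows "card (quotient_verts G T) \<le>
    2 * card S + 3 * (card (orb ` {v. rigid v}) + card (orb ` {v. \<exists>u. stab_leaf v u}))"
proof -
  note fin = finite_quotient[OF S]
  let ?Q = "quotient_verts G T" and ?R = "orb ` {v. rigid v}" and ?L = "orb ` {v. \<exists>u. stab_leaf v u}"
  define deg where "deg Y = card {X \<in> quotient_edges G T. fst ` X = Y}" for Y :: "'v set"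
  have "fst ` X \<in> ?Q" if "X \<in> quotient_edges G T" for X
    using that fst_eorb edge_verts unfolding quotient_edges_eq quotient_verts_eq by fastforce
  then have sum_deg: "(\<Sum>Y\<in>?Q. deg Y) = card (quotient_edges G T)"
    using sum.group[OF fin(2,1), of "\<lambda>X. fst ` X" "\<lambda>_. 1::nat"] unfolding deg_def by auto
  have deg3: "3 \<le> deg Y" if Y: "Y \<in> ?Q - ?R - ?L" for Y
  proof -
    obtain v where v: "v \<in> verts T" "Y = orb v" using Y by (auto simp: quotient_verts_eq)
    then obtain u where u: "(v, u) \<in> edges T" "St v \<subseteq> St u" using Y unfolding rigid_def by blast
    then obtain w where w: "(v, w) \<in> edges T" "St v \<subseteq> St w" "w \<noteq> u"
      using Y v unfolding stab_leaf_def by blast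
    have "edge_stab G T (v, u) = St v" "edge_stab G T (v, w) = St v"
      using u w unfolding edge_stab_eq by auto
    then have "edges_from T v \<noteq> {(v, u), (v, w)}"
      using nosub v w(3) unfolding no_subdivision_vertices_def by blast
    then obtain t where t: "(v, t) \<in> edges T" "t \<noteq> u" "t \<noteq> w"
      using u w unfolding edges_from_def by (auto simp: set_eq_iff)
    \<comment> \<open>An element taking one edge at \<open>v\<close> to another lies in
      \<open>St v\<close>, so it fixes \<open>a\<close>.\<close>
    have neq: "eorb (v, b) \<noteq> eorb (v, a)" if "(v, a) \<in> edges T" "(v, b) \<in> edges T" "St v \<subseteq> St a" "a \<noteq> b" for a b
    proof
      assume "eorb (v, b) = eorb (v, a)"
      then have "(v, b) \<in> eorb (v, a)" using eorb_refl[OF that(2)] by simp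
      then obtain g where "g \<in> carrier G" "v = act T g v" "b = act T g a" unfolding in_eorb by blast
      then have "g \<in> St a" using that(3) by (metis in_St subsetD)
      then show False using that \<open>b = act T g a\<close> by (simp add: in_St)
    qed
    have "{eorb (v, u), eorb (v, w), eorb (v, t)} \<subseteq> {X \<in> quotient_edges G T. fst ` X = Y}"
      using u w t v fst_eorb unfolding quotient_edges_eq by auto
    moreover have "card {eorb (v, u), eorb (v, w), eorb (v, t)} = 3"
      using neq[OF u(1) w(1)] neq[OF u(1) t(1)] neq[OF w(1) t(1)] u w t by (simp add: card_insert_if)
    moreover have "finite {X \<in> quotient_edges G T. fst ` X = Y}" using fin(2) by simp
    ultimately show ?thesis unfolding deg_def by (metis (lifting) card_mono)
  qed
  have "3 * card (?Q - ?R - ?L) = (\<Sum>Y\<in>?Q - ?R - ?L. 3)" by simp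
  also have "\<dots> \<le> (\<Sum>Y\<in>?Q - ?R - ?L. deg Y)" by (intro sum_mono deg3)
  also have "\<dots> \<le> (\<Sum>Y\<in>?Q. deg Y)" using fin by (intro sum_mono2) auto
  finally have "3 * card (?Q - ?R - ?L) \<le> 2 * (card S + card ?Q)"
    using card_quotient_edges_le[OF S] sum_deg by simp
  moreover have "card ?Q \<le> card (?Q - ?R - ?L) + (card ?R + card ?L)"
  proof -
    have sub: "?R \<subseteq> ?Q" "?L \<subseteq> ?Q"
      unfolding quotient_verts_eq rigid_def stab_leaf_def using edge_verts by auto
    then have "card ?Q \<le> card ((?Q - ?R - ?L) \<union> (?R \<union> ?L))"
      using fin by (intro card_mono) (auto intro: finite_subset)
    also have "\<dots> \<le> card (?Q - ?R - ?L) + (card ?R + card ?L)"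
      by (meson add_left_mono card_Un_le le_trans)
    finally show ?thesis .
  qed
  moreover have "q \<le> 2 * s + 3 * (r + l)" if "3 * c \<le> 2 * (s + q)" "q \<le> c + (r + l)" for q s c r l :: nat
    using that by arith
  ultimately show ?thesis by blast
qed

end

section \<open>Subdivision vertices under collapses\<close>

context collapse
begin

text \<open>The two edges at a subdivision vertex \<open>v\<close> of \<open>R\<close> lift to
  \<open>(a, a')\<close> and \<open>(b, b')\<close>, and uniqueness of lifts makes
  \<open>R.St v\<close> fix both. The rest of \<open>T\<close> is attached to the fibre only at
  \<open>a\<close> and \<open>b\<close>. By minimality the fibre is just the path from
  \<open>a\<close> to \<open>b\<close>, so \<open>a\<close> is a subdivision vertex of
  \<open>T\<close>.\<close>

lemma no_subdivision_collapse:
  assumes nosub: "no_subdivision_vertices G T"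
  shows "no_subdivision_vertices G R"
  unfolding no_subdivision_vertices_def
proof (intro notI, elim bexE exE conjE)
  fix v e1 e2
  assume v: "v \<in> verts R" and ne: "e1 \<noteq> e2" and ef: "edges_from R v = {e1, e2}"
    and es: "edge_stab G R e1 = R.St v" "R.St v = edge_stab G R e2"
  obtain r1 r2 where r: "e1 = (v, r1)" "e2 = (v, r2)" "(v, r1) \<in> edges R" "(v, r2) \<in> edges R"
  proof -
    have "e1 \<in> edges_from R v" "e2 \<in> edges_from R v" unfolding ef by auto
    then show thesis using that unfolding edges_from_def by (cases e1; cases e2) auto
  qed
  have Hr: "R.St v \<subseteq> R.St r1" "R.St v \<subseteq> R.St r2" using es unfolding r R.edge_stab_eq by auto
  obtain a a' where a: "(a, a') \<in> edges T" "h a = v" "h a' = r1" using edge_lift r(3) by metis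
  obtain b b' where b: "(b, b') \<in> edges T" "h b = v" "h b' = r2" using edge_lift r(4) by metis
  have r_ne: "v \<noteq> r1" "v \<noteq> r2" using R.edge_verts r by auto
  have fixes_lift: "act T k x = x \<and> act T k y = y"
    if "k \<in> R.St v" "(x, y) \<in> edges T" "h x = v" "R.St v \<subseteq> R.St (h y)" "v \<noteq> h y" for k x y
  proof -
    have k: "k \<in> carrier G" "act R k (h x) = h x" "act R k (h y) = h y" using that by (auto simp: R.in_St)
    then show ?thesis
      using edge_lift_unique[OF that(2) T.act_edge[OF k(1) that(2)]] h_act[OF k(1)] T.edge_verts[OF that(2)] that
      by auto
  qed
  have H: "T.St a = R.St v" "T.St b = R.St v" "R.St v \<subseteq> T.St a'" "R.St v \<subseteq> T.St b'"
    using fixes_lift[of _ a a'] fixes_lift[of _ b b'] a b r_ne Hr St_subset[of a] St_subset[of b]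
      T.edge_verts[OF a(1)] T.edge_verts[OF b(1)] by (auto simp: T.in_St R.in_St)
  have aV: "a \<in> verts T" and bV: "b \<in> verts T" using a b T.edge_verts by auto
  have out: "(x, y) = (a, a') \<or> (x, y) = (b, b')" if xy: "(x, y) \<in> edges T" "h x = v" "h y \<noteq> v" for x y
  proof -
    have "(v, h y) \<in> edges_from R v" using h_edge[OF xy(1)] xy unfolding edges_from_def by simp
    then have "h y = r1 \<or> h y = r2" using ef r by auto
    then show ?thesis
      using edge_lift_unique[OF xy(1) a(1)] edge_lift_unique[OF xy(1) b(1)] xy a b r_ne by metis
  qed
  define xs where "xs = path_between (edges T) a b"
  have xs: "simple_path (edges T) a xs b" using T.path_between aV bV unfolding xs_def by blast
  have hxs: "h x = v" if "x \<in> set xs" for x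
    using path_in_fibre[OF aV bV, of x] a b that unfolding xs_def by simp
  \<comment> \<open>An element moving \<open>a\<close> within the fibre fixes \<open>v\<close>, and
    \<open>R.St v\<close> equals \<open>T.St a\<close>.\<close>
  have orb_a: "\<alpha> = a" if "\<alpha> \<in> T.orb a" "h \<alpha> = v" for \<alpha>
  proof -
    obtain g where "g \<in> carrier G" "\<alpha> = act T g a" using \<open>\<alpha> \<in> T.orb a\<close> by (auto simp: T.in_orb)
    then have "g \<in> T.St a" using that h_act[OF _ aV] a unfolding H by (auto simp: R.in_St)
    then show ?thesis using \<open>\<alpha> = act T g a\<close> by (simp add: T.in_St)
  qed
  \<comment> \<open>A path starting in the orbit of \<open>a\<close> starts at \<open>a\<close> or
    outside the fibre, and it can enter the fibre only along one of the two lifted edges.\<close>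
  have enter: "\<exists>c\<in>set as. c = a \<or> c = b"
    if p: "simple_path (edges T) \<alpha> (as @ z # bs) \<beta>" and "\<alpha> \<in> T.orb a" and z: "h z = v" "z \<noteq> a" "z \<noteq> b"
    for \<alpha> \<beta> as bs z
  proof (cases "h \<alpha> = v")
    case True
    then have "\<alpha> = a" using orb_a that by blast
    then show ?thesis using p z by (cases as) (auto simp: simple_path_def)
  next
    case False
    then have "\<alpha> \<in> set as" using p z by (cases as) (auto simp: simple_path_def)
    then obtain cs q ds where as: "as = cs @ q # ds" and q: "h q \<noteq> v" and ds: "\<forall>d\<in>set ds. h d = v"
      using split_list_last_prop[of as "\<lambda>q. h q \<noteq> v"] False by auto
    define q' where "q' = hd (ds @ [z])"
    have "(q, q') \<in> edges T"
      using p unfolding simple_path_def as q'_def by (cases ds) (auto simp: successively_append_iff)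
    moreover have "h q' = v" using ds z unfolding q'_def by (cases ds) auto
    ultimately have "q' = a \<or> q' = b" using out[of q' q] T.edge_verts(4) q by blast
    moreover from this have "q' \<in> set ds" using z unfolding q'_def by (cases ds) auto
    ultimately show ?thesis unfolding as by auto
  qed
  have fibre: "z \<in> set xs" if zV: "z \<in> verts T" and z: "h z = v" for z
  proof (cases "z = a \<or> z = b")
    case True
    then show ?thesis using xs unfolding simple_path_def by (metis hd_in_set last_in_set)
  next
    case False
    \<comment> \<open>With the whole group as generating set, \<open>path_cover\<close> puts every
      vertex on a path between two translates of \<open>a\<close>. If \<open>z\<close> is on it,
      then \<open>a\<close> and \<open>b\<close> lie on either side of \<open>z\<close>.\<close>
    have "generate G (carrier G) = carrier G"
      using T.generate_incl[of "carrier G"] generate.incl[of _ "carrier G" G] by blast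
    from T.path_cover(1)[OF subset_refl this aV zV] False
    obtain g w where g: "g \<in> carrier G" "z = act T g w"
      and w: "w \<in> insert a (\<Union>s\<in>carrier G. set (path_between (edges T) a (act T s a)))" by blast
    obtain s where s: "s \<in> carrier G" "w \<in> set (path_between (edges T) a (act T s a))"
    proof (cases "w = a")
      case True
      then show thesis using that[of \<one>] T.act_one[OF aV] T.path_self[OF aV] by simp
    next
      case False
      then show thesis using that w by blast
    qed
    define \<alpha> \<beta> where "\<alpha> = act T g a" and "\<beta> = act T g (act T s a)"
    have sa: "act T s a \<in> verts T" using T.act_closed aV s by blast
    have "\<beta> = act T (g \<otimes> s) a" unfolding \<beta>_def using T.act_mult aV g s by simp
    then have \<alpha>\<beta>: "\<alpha> \<in> T.orb a" "\<beta> \<in> T.orb a" unfolding \<alpha>_def T.in_orb using g s by auto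
    have "z \<in> set (path_between (edges T) \<alpha> \<beta>)"
      unfolding \<alpha>_def \<beta>_def T.path_map[OF g(1) aV sa] using g s by simp
    then obtain as bs where split: "path_between (edges T) \<alpha> \<beta> = as @ z # bs" by (meson split_list)
    have p: "simple_path (edges T) \<alpha> (as @ z # bs) \<beta>"
      using T.path_between[of \<alpha> \<beta>] T.act_closed g(1) aV sa unfolding split[symmetric] \<alpha>_def \<beta>_def by blast
    have p': "simple_path (edges T) \<beta> (rev bs @ z # rev as) \<alpha>"
      using simple_path_rev[OF p T.symE] by simp
    obtain c1 where c1: "c1 \<in> set as" "c1 = a \<or> c1 = b" using enter[OF p \<alpha>\<beta>(1) z] False by blast
    obtain c2 where c2: "c2 \<in> set bs" "c2 = a \<or> c2 = b" using enter[OF p' \<alpha>\<beta>(2) z] False by auto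
    have "c1 \<noteq> c2" using p c1 c2 unfolding simple_path_def by auto
    obtain as1 as2 where as: "as = as1 @ c1 # as2" using c1 by (meson split_list)
    obtain bs1 bs2 where bs: "bs = bs1 @ c2 # bs2" using c2 by (meson split_list)
    have "simple_path (edges T) c1 (c1 # as2 @ z # bs1 @ c2 # bs2) \<beta>"
      using simple_path_suffix[of "edges T" \<alpha> as1 c1] p unfolding as bs by simp
    then have m: "simple_path (edges T) c1 ((c1 # as2 @ z # bs1) @ [c2]) c2"
      by (intro simple_path_prefix[of _ _ _ _ bs2 \<beta>]) simp
    consider "c1 = a" "c2 = b" | "c1 = b" "c2 = a" using c1 c2 \<open>c1 \<noteq> c2\<close> by blast
    then show ?thesis
    proof cases
      case 1
      then show ?thesis using T.path_between_eq[OF m] unfolding xs_def by auto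
    next
      case 2
      then show ?thesis using T.path_between_eq[OF simple_path_rev[OF m T.symE]] unfolding xs_def by auto
    qed
  qed
  have stab: "edge_stab G T (a, x) = T.St a" if "R.St v \<subseteq> T.St x" for x
    using that H unfolding T.edge_stab_eq by blast
  show False
  proof (cases "a = b")
    case True
    have "edges_from T a = {(a, a'), (a, b')}"
    proof (intro equalityI subsetI)
      fix e assume "e \<in> edges_from T a"
      then obtain q where q: "e = (a, q)" "(a, q) \<in> edges T" unfolding edges_from_def by (cases e) auto
      have "h q \<noteq> v"
      proof
        assume "h q = v"
        then have "q \<in> set xs" using fibre T.edge_verts q by blast
        then show False using T.edge_verts(3) q T.path_self[OF aV] unfolding xs_def True[symmetric] by auto
      qed
      then show "e \<in> {(a, a'), (a, b')}" using out[OF q(2)] a True q by blast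
    qed (use a b True in \<open>auto simp: edges_from_def\<close>)
    moreover have "(a, a') \<noteq> (a, b')" using a b r ne by auto
    ultimately show False
      using nosub aV stab H(3,4) unfolding no_subdivision_vertices_def by metis
  next
    case False
    then obtain x1 ys where xs1: "xs = a # x1 # ys" "(a, x1) \<in> edges T"
      using xs unfolding simple_path_def by (cases xs; cases "tl xs") auto
    have "edges_from T a = {(a, a'), (a, x1)}"
    proof (intro equalityI subsetI)
      fix e assume "e \<in> edges_from T a"
      then obtain q where q: "e = (a, q)" "(a, q) \<in> edges T" unfolding edges_from_def by (cases e) auto
      show "e \<in> {(a, a'), (a, x1)}"
      proof (cases "h q = v")
        case True
        then have "q \<in> set xs" using fibre T.edge_verts q by blast
        then obtain as bs where split: "xs = as @ q # bs" by (meson split_list)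
        then have "as @ [q] = [a, q]"
          using T.path_split(1)[OF aV bV split[unfolded xs_def]] T.path_edge[OF q(2)] by simp
        then show ?thesis using split xs1 q by auto
      next
        case False
        then show ?thesis using out[OF q(2)] a \<open>a \<noteq> b\<close> q by blast
      qed
    qed (use a xs1 in \<open>auto simp: edges_from_def\<close>)
    moreover have "(a, a') \<noteq> (a, x1)" using hxs[of x1] xs1 a r_ne by auto
    moreover have "R.St v \<subseteq> T.St x1"
      using T.path_fixed[OF _ _ aV bV, of _ x1] H xs1 unfolding xs_def by auto
    ultimately show False
      using nosub aV stab H(3) unfolding no_subdivision_vertices_def by metis
  qed
qed

end

section \<open>Commensurable subgroups\<close>

lemma card_image_same_kernel:
  assumes "\<And>x y. x \<in> A \<Longrightarrow> y \<in> A \<Longrightarrow> f x = f y \<longleftrightarrow> g x = g y"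
  shows "card (f ` A) = card (g ` A)" "finite (f ` A) \<longleftrightarrow> finite (g ` A)"
proof -
  define \<phi> where "\<phi> = g \<circ> inv_into A f"
  have \<phi>: "\<phi> (f x) = g x" if "x \<in> A" for x
  proof -
    have "inv_into A f (f x) \<in> A" "f (inv_into A f (f x)) = f x"
      using that by (auto intro: inv_into_into f_inv_into_f)
    then show ?thesis using assms that unfolding \<phi>_def by auto
  qed
  have "bij_betw \<phi> (f ` A) (g ` A)"
    unfolding bij_betw_def
  proof
    show "inj_on \<phi> (f ` A)" using \<phi> assms by (auto simp: inj_on_def)
    show "\<phi> ` f ` A = g ` A" using \<phi> by (auto simp: image_image cong: image_cong)
  qed
  then show "card (f ` A) = card (g ` A)" "finite (f ` A) \<longleftrightarrow> finite (g ` A)"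
    using bij_betw_same_card bij_betw_finite by blast+
qed

lemma finite_image_coarser:
  assumes "finite (f ` A)" "\<And>x y. x \<in> A \<Longrightarrow> y \<in> A \<Longrightarrow> f x = f y \<Longrightarrow> g x = g y"
  shows "finite (g ` A)"
proof -
  have "g ` A \<subseteq> (g \<circ> inv_into A f) ` (f ` A)"
  proof
    fix z assume "z \<in> g ` A"
    then obtain x where x: "x \<in> A" "z = g x" by blast
    then have "g (inv_into A f (f x)) = g x"
      using assms(2)[of "inv_into A f (f x)" x] by (auto intro: inv_into_into f_inv_into_f)
    then show "z \<in> (g \<circ> inv_into A f) ` (f ` A)" using x by force
  qed
  then show ?thesis using assms(1) finite_surj by blast
qed

context group
begin

text \<open>Here \<open>B\<close> need not lie in \<open>A\<close>. The sets correspond to the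
  cosets of the intersection in \<open>A\<close> (\<open>index_Int\<close>), so
  \<open>index_in A B\<close> is the index of \<open>A \<inter> B\<close> in
  \<open>A\<close>.\<close>

definition cosets_in :: "'a set \<Rightarrow> 'a set \<Rightarrow> 'a set set" where
  "cosets_in A B = (\<lambda>a. a <# B) ` A"

definition index_in :: "'a set \<Rightarrow> 'a set \<Rightarrow> nat" where
  "index_in A B = card (cosets_in A B)"

definition commensurable :: "'a set \<Rightarrow> 'a set \<Rightarrow> bool" where
  "commensurable A B \<longleftrightarrow> finite (cosets_in A B) \<and> finite (cosets_in B A)"

definition index_ratio :: "'a set \<Rightarrow> 'a set \<Rightarrow> real" where
  "index_ratio A B = real (index_in A B) / real (index_in B A)"

definition conj_set :: "'a \<Rightarrow> 'a set \<Rightarrow> 'a set" where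
  "conj_set g A = (\<lambda>a. g \<otimes> a \<otimes> inv g) ` A"

lemma l_coset_eq_iff:
  assumes B: "subgroup B G" and a: "a \<in> carrier G" "b \<in> carrier G"
  shows "a <# B = b <# B \<longleftrightarrow> inv a \<otimes> b \<in> B"
proof
  assume "a <# B = b <# B"
  moreover have "b \<in> b <# B" using subgroup.one_closed[OF B] a unfolding l_coset_def by force
  ultimately obtain c where "c \<in> B" "b = a \<otimes> c" unfolding l_coset_def by blast
  then show "inv a \<otimes> b \<in> B" using a subgroup.subset[OF B] by (auto simp: m_assoc[symmetric])
next
  assume h: "inv a \<otimes> b \<in> B"
  have Bc: "\<And>c. c \<in> B \<Longrightarrow> c \<in> carrier G" using subgroup.subset[OF B] by blast
  show "a <# B = b <# B"
  proof (intro equalityI subsetI)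
    fix z assume "z \<in> a <# B"
    then obtain c where c: "c \<in> B" "z = a \<otimes> c" unfolding l_coset_def by blast
    have "inv (inv a \<otimes> b) \<otimes> c \<in> B" using h c B by (simp add: subgroup.m_inv_closed subgroup.m_closed)
    moreover have "z = b \<otimes> (inv (inv a \<otimes> b) \<otimes> c)"
      using a c Bc by (simp add: inv_mult_group flip: m_assoc)
    ultimately show "z \<in> b <# B" unfolding l_coset_def by blast
  next
    fix z assume "z \<in> b <# B"
    then obtain c where c: "c \<in> B" "z = b \<otimes> c" unfolding l_coset_def by blast
    have "(inv a \<otimes> b) \<otimes> c \<in> B" using h c B by (simp add: subgroup.m_closed)
    moreover have "z = a \<otimes> ((inv a \<otimes> b) \<otimes> c)" using a c Bc by (simp flip: m_assoc)
    ultimately show "z \<in> a <# B" unfolding l_coset_def by blast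
  qed
qed

lemma l_coset_in_iff:
  assumes "subgroup A G" "subgroup B G" "a \<in> A" "b \<in> A"
  shows "a <# B = b <# B \<longleftrightarrow> inv a \<otimes> b \<in> B"
  using l_coset_eq_iff assms subgroup.subset by blast

text \<open>A coset of \<open>C\<close> in \<open>A\<close> amounts to a coset of \<open>B\<close>
  and, relative to its representative chosen by \<open>t\<close>, a coset of \<open>C\<close> in
  \<open>B\<close>. Being a bijection, this gives the product formula also for infinite indices,
  which \<open>card\<close> counts as 0.\<close>

lemma index_tower:
  assumes A: "subgroup A G" and B: "subgroup B G" and C: "subgroup C G" and "C \<subseteq> B" "B \<subseteq> A"
  shows "index_in A C = index_in A B * index_in B C"
    and "finite (cosets_in A C) \<longleftrightarrow> finite (cosets_in A B) \<and> finite (cosets_in B C)"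
proof -
  define t where "t K = (SOME a. a \<in> A \<and> a <# B = K)" for K
  have t: "t (a <# B) \<in> A \<and> t (a <# B) <# B = a <# B" if "a \<in> A" for a
    unfolding t_def by (rule someI[of "\<lambda>b. b \<in> A \<and> b <# B = a <# B" a]) (simp add: that)
  define g where "g a = (a <# B, (inv (t (a <# B)) \<otimes> a) <# C)" for a
  have Ac: "\<And>a. a \<in> A \<Longrightarrow> a \<in> carrier G" using subgroup.subset[OF A] by blast
  have tB: "inv (t (a <# B)) \<otimes> a \<in> B" if "a \<in> A" for a
    using l_coset_in_iff[OF A B] t[OF that] that by blast
  have ker: "a <# C = b <# C \<longleftrightarrow> g a = g b" if ab: "a \<in> A" "b \<in> A" for a b
  proof (cases "a <# B = b <# B")
    case True
    have tc: "t (b <# B) \<in> carrier G" using t ab Ac by blast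
    have "inv (inv (t (b <# B)) \<otimes> a) \<otimes> (inv (t (b <# B)) \<otimes> b) = inv a \<otimes> b"
    proof -
      have "t (b <# B) \<otimes> (inv (t (b <# B)) \<otimes> b) = b" using tc Ac ab by (simp flip: m_assoc)
      then show ?thesis using tc Ac ab by (simp add: inv_mult_group m_assoc)
    qed
    then show ?thesis
      using l_coset_eq_iff[OF C] tc Ac ab True unfolding g_def by simp
  next
    case False
    then show ?thesis
      using l_coset_in_iff[OF A B ab] l_coset_in_iff[OF A C ab] \<open>C \<subseteq> B\<close> unfolding g_def by auto
  qed
  have "g ` A = cosets_in A B \<times> cosets_in B C"
  proof (intro equalityI subsetI)
    fix z assume "z \<in> g ` A"
    then show "z \<in> cosets_in A B \<times> cosets_in B C" using tB unfolding g_def cosets_in_def by auto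
  next
    fix z assume "z \<in> cosets_in A B \<times> cosets_in B C"
    then obtain a b where z: "z = (a <# B, b <# C)" "a \<in> A" "b \<in> B" unfolding cosets_in_def by auto
    define c where "c = t (a <# B) \<otimes> b"
    have tc: "t (a <# B) \<in> A" "b \<in> A" using t z \<open>B \<subseteq> A\<close> by auto
    then have cA: "c \<in> A" unfolding c_def using subgroup.m_closed[OF A] by blast
    have i: "inv (t (a <# B)) \<otimes> c = b" using tc Ac unfolding c_def by (simp flip: m_assoc)
    then have "t (a <# B) <# B = c <# B" using l_coset_in_iff[OF A B tc(1) cA] z by simp
    then have "c <# B = a <# B" using t z by simp
    then have "g c = z" using i unfolding g_def z by simp
    then show "z \<in> g ` A" using cA by blast
  qed
  then have card: "card ((\<lambda>a. a <# C) ` A) = card (cosets_in A B \<times> cosets_in B C)"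
    and fin: "finite ((\<lambda>a. a <# C) ` A) \<longleftrightarrow> finite (cosets_in A B \<times> cosets_in B C)"
    using card_image_same_kernel[of A "\<lambda>a. a <# C" g, OF ker] by simp_all
  show "index_in A C = index_in A B * index_in B C"
    using card unfolding index_in_def by (simp add: cosets_in_def card_cartesian_product)
  have "cosets_in A B \<noteq> {}" "cosets_in B C \<noteq> {}"
    using subgroup.one_closed A B unfolding cosets_in_def by blast+
  then show "finite (cosets_in A C) \<longleftrightarrow> finite (cosets_in A B) \<and> finite (cosets_in B C)"
    using fin by (simp add: cosets_in_def finite_cartesian_product_iff)
qed

lemma index_Int:
  assumes "subgroup A G" "subgroup B G"
  shows "index_in A B = index_in A (A \<inter> B)"
    and "finite (cosets_in A B) \<longleftrightarrow> finite (cosets_in A (A \<inter> B))"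
proof -
  have sub: "subgroup (A \<inter> B) G" using subgroups_Inter_pair assms by blast
  have "a <# B = b <# B \<longleftrightarrow> a <# (A \<inter> B) = b <# (A \<inter> B)" if "a \<in> A" "b \<in> A" for a b
    unfolding l_coset_in_iff[OF assms that] l_coset_in_iff[OF assms(1) sub that]
    using assms(1) that by (simp add: subgroup.m_closed subgroup.m_inv_closed)
  from card_image_same_kernel[of A "\<lambda>a. a <# B" "\<lambda>a. a <# (A \<inter> B)", OF this]
  show "index_in A B = index_in A (A \<inter> B)"
    "finite (cosets_in A B) \<longleftrightarrow> finite (cosets_in A (A \<inter> B))"
    unfolding index_in_def cosets_in_def by auto
qed

lemma finite_cosets_subset: "finite (cosets_in A B) \<Longrightarrow> A' \<subseteq> A \<Longrightarrow> finite (cosets_in A' B)"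
  unfolding cosets_in_def by (meson finite_subset image_mono)

lemma finite_cosets_weaken:
  assumes "subgroup A G" "subgroup B G" "subgroup C G" "B \<subseteq> C" "finite (cosets_in A B)"
  shows "finite (cosets_in A C)"
  using assms(5) l_coset_in_iff[OF assms(1,2)] l_coset_in_iff[OF assms(1,3)] assms(4)
  unfolding cosets_in_def by (elim finite_image_coarser) blast

lemma finite_cosets_trans:
  assumes A: "subgroup A G" and B: "subgroup B G" and C: "subgroup C G"
    and fin: "finite (cosets_in A B)" "finite (cosets_in B C)"
  shows "finite (cosets_in A (A \<inter> B \<inter> C))" "finite (cosets_in A C)"
proof -
  have AB: "subgroup (A \<inter> B) G" and ABC: "subgroup (A \<inter> B \<inter> C) G"
    using subgroups_Inter_pair A B C by blast+
  have "finite (cosets_in (A \<inter> B) C)" using fin(2) by (rule finite_cosets_subset) blast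
  then have "finite (cosets_in (A \<inter> B) (A \<inter> B \<inter> C))" using index_Int(2)[OF AB C] by simp
  moreover have "finite (cosets_in A (A \<inter> B))" using index_Int(2)[OF A B] fin by simp
  ultimately show "finite (cosets_in A (A \<inter> B \<inter> C))" using index_tower(2)[OF A AB ABC] by blast
  then show "finite (cosets_in A C)" using finite_cosets_weaken[OF A ABC C] by blast
qed

lemma index_pos: "subgroup A G \<Longrightarrow> finite (cosets_in A B) \<Longrightarrow> 0 < index_in A B"
  unfolding index_in_def cosets_in_def using subgroup.one_closed by (fastforce simp: card_gt_0_iff)

lemma commensurable_sym: "commensurable A B \<Longrightarrow> commensurable B A"
  unfolding commensurable_def by blast

lemma commensurable_trans:
  assumes "subgroup A G" "subgroup B G" "subgroup C G" "commensurable A B" "commensurable B C"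
  shows "commensurable A C"
  using assms finite_cosets_trans(2) unfolding commensurable_def by blast

lemma index_ratio_pos: "subgroup A G \<Longrightarrow> subgroup B G \<Longrightarrow> commensurable A B \<Longrightarrow> 0 < index_ratio A B"
  unfolding index_ratio_def commensurable_def using index_pos by simp

text \<open>The index of \<open>M\<close> in \<open>A \<inter> B\<close> is a common factor of
  numerator and denominator, and it cancels because it is finite and nonzero.\<close>

lemma index_ratio_via:
  assumes A: "subgroup A G" and B: "subgroup B G" and M: "subgroup M G" "M \<subseteq> A" "M \<subseteq> B"
    and fin: "finite (cosets_in A M)" "finite (cosets_in B M)"
  shows "index_ratio A B = real (index_in A M) / real (index_in B M)"
proof -
  have AB: "subgroup (A \<inter> B) G" using subgroups_Inter_pair A B by blast
  have "index_in A M = index_in A B * index_in (A \<inter> B) M"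
    using index_tower(1)[OF A AB M(1)] M index_Int(1)[OF A B] by simp
  moreover have "index_in B M = index_in B A * index_in (A \<inter> B) M"
    using index_tower(1)[OF B AB M(1)] M index_Int(1)[OF B A] by (simp add: Int_commute)
  moreover have "0 < index_in (A \<inter> B) M"
    using finite_cosets_subset[OF fin(1)] index_pos[OF AB] by blast
  ultimately show ?thesis unfolding index_ratio_def by simp
qed

text \<open>All three ratios are computed in the triple intersection \<open>M\<close>, where the
  index of \<open>M\<close> in \<open>B\<close> cancels.\<close>

lemma index_ratio_mult:
  assumes A: "subgroup A G" and B: "subgroup B G" and C: "subgroup C G"
    and AB: "commensurable A B" and BC: "commensurable B C"
  shows "index_ratio A B * index_ratio B C = index_ratio A C"
proof -
  define M where "M = A \<inter> B \<inter> C"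
  have M: "subgroup M G" "M \<subseteq> A" "M \<subseteq> B" "M \<subseteq> C"
    unfolding M_def using subgroups_Inter_pair A B C by blast+
  have f: "finite (cosets_in A B)" "finite (cosets_in B A)" "finite (cosets_in B C)" "finite (cosets_in C B)"
    using AB BC unfolding commensurable_def by auto
  have "B \<inter> A \<inter> (A \<inter> C) = M" "C \<inter> B \<inter> A = M" unfolding M_def by blast+
  then have fin: "finite (cosets_in A M)" "finite (cosets_in C M)"
    using finite_cosets_trans(1)[OF A B C f(1,3)] finite_cosets_trans(1)[OF C B A f(4,2)] unfolding M_def by auto
  have "finite (cosets_in B M)"
    using finite_cosets_trans(2)[OF B A M(1) f(2) fin(1)] .
  then have "0 < index_in B M" using index_pos[OF B] by blast
  then show ?thesis
    using index_ratio_via[OF A B M(1,2,3) fin(1)] index_ratio_via[OF B C M(1,3,4) _ fin(2)]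
      index_ratio_via[OF A C M(1,2,4) fin] \<open>finite (cosets_in B M)\<close> by simp
qed

lemma subgroup_conj_set:
  assumes g: "g \<in> carrier G" and A: "subgroup A G"
  shows "subgroup (conj_set g A) G"
proof -
  have Ac: "\<And>a. a \<in> A \<Longrightarrow> a \<in> carrier G" using subgroup.subset[OF A] by blast
  show ?thesis
  proof (rule subgroupI)
    show "conj_set g A \<subseteq> carrier G" using g Ac unfolding conj_set_def by auto
    show "conj_set g A \<noteq> {}" using subgroup.one_closed[OF A] unfolding conj_set_def by blast
  next
    fix x assume "x \<in> conj_set g A"
    then obtain a where a: "a \<in> A" "x = g \<otimes> a \<otimes> inv g" unfolding conj_set_def by blast
    then have "inv x = g \<otimes> inv a \<otimes> inv g" using g Ac by (simp add: inv_mult_group m_assoc)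
    then show "inv x \<in> conj_set g A" using a subgroup.m_inv_closed[OF A] unfolding conj_set_def by blast
  next
    fix x y assume "x \<in> conj_set g A" "y \<in> conj_set g A"
    then obtain a b where ab: "a \<in> A" "x = g \<otimes> a \<otimes> inv g" "b \<in> A" "y = g \<otimes> b \<otimes> inv g"
      unfolding conj_set_def by blast
    have "inv g \<otimes> (g \<otimes> (b \<otimes> inv g)) = b \<otimes> inv g" using ab g Ac by (simp flip: m_assoc)
    then have "x \<otimes> y = g \<otimes> (a \<otimes> b) \<otimes> inv g" using ab g Ac by (simp add: m_assoc)
    then show "x \<otimes> y \<in> conj_set g A" using ab subgroup.m_closed[OF A] unfolding conj_set_def by blast
  qed
qed

lemma index_conj_set:
  assumes g: "g \<in> carrier G" and A: "subgroup A G" and B: "subgroup B G"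
  shows "index_in (conj_set g A) (conj_set g B) = index_in A B"
    and "finite (cosets_in (conj_set g A) (conj_set g B)) \<longleftrightarrow> finite (cosets_in A B)"
proof -
  let ?c = "\<lambda>a. g \<otimes> a \<otimes> inv g"
  have Ac: "\<And>a. a \<in> A \<Longrightarrow> a \<in> carrier G" and Bc: "\<And>b. b \<in> B \<Longrightarrow> b \<in> carrier G"
    using subgroup.subset A B by blast+
  have "a <# B = b <# B \<longleftrightarrow> ?c a <# conj_set g B = ?c b <# conj_set g B" if ab: "a \<in> A" "b \<in> A" for a b
  proof -
    have "inv g \<otimes> (g \<otimes> (b \<otimes> inv g)) = b \<otimes> inv g" using ab g Ac by (simp flip: m_assoc)
    then have "inv (?c a) \<otimes> ?c b = ?c (inv a \<otimes> b)" using ab g Ac by (simp add: inv_mult_group m_assoc)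
    moreover have "?c x \<in> conj_set g B \<longleftrightarrow> x \<in> B" if x: "x \<in> carrier G" for x
    proof
      assume "?c x \<in> conj_set g B"
      then obtain y where "y \<in> B" "?c x = ?c y" unfolding conj_set_def by blast
      then have "x = y" using g x Bc by simp
      then show "x \<in> B" using \<open>y \<in> B\<close> by simp
    qed (auto simp: conj_set_def)
    ultimately show ?thesis
      using ab g Ac l_coset_eq_iff[OF B] l_coset_eq_iff[OF subgroup_conj_set[OF g B]] by simp
  qed
  from card_image_same_kernel[of A "\<lambda>a. a <# B" "\<lambda>a. ?c a <# conj_set g B", OF this]
  show "index_in (conj_set g A) (conj_set g B) = index_in A B"
    "finite (cosets_in (conj_set g A) (conj_set g B)) \<longleftrightarrow> finite (cosets_in A B)"
    unfolding index_in_def cosets_in_def conj_set_def[of g A] by (auto simp: image_image)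
qed

lemma commensurable_conj_set:
  "g \<in> carrier G \<Longrightarrow> subgroup A G \<Longrightarrow> subgroup B G \<Longrightarrow> commensurable A B \<Longrightarrow>
    commensurable (conj_set g A) (conj_set g B)"
  unfolding commensurable_def using index_conj_set by blast

lemma index_ratio_conj_set:
  "g \<in> carrier G \<Longrightarrow> subgroup A G \<Longrightarrow> subgroup B G \<Longrightarrow>
    index_ratio (conj_set g A) (conj_set g B) = index_ratio A B"
  unfolding index_ratio_def using index_conj_set by simp

lemma cosets_in_self:
  assumes A: "subgroup A G"
  shows "cosets_in A A = {A}"
proof -
  have "a <# A = \<one> <# A" if "a \<in> A" for a
    using l_coset_in_iff[OF A A that subgroup.one_closed[OF A]] A that subgroup.subset[OF A]
    by (simp add: subgroup.m_inv_closed subset_iff)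
  then show ?thesis using lcos_mult_one[OF subgroup.subset[OF A]] subgroup.one_closed[OF A]
    unfolding cosets_in_def by auto
qed

lemma index_ratio_self: "subgroup A G \<Longrightarrow> index_ratio A A = 1"
  unfolding index_ratio_def index_in_def using cosets_in_self by simp

text \<open>The smaller group \<open>A\<close> forms a single coset of \<open>B\<close>, so the
  ratio is the index of \<open>A\<close> in \<open>B\<close>; two cosets exist as soon as the
  inclusion is proper. This is the origin of the summand \<open>ln 2\<close> for each leaf
  orbit.\<close>

lemma index_ratio_subset:
  assumes A: "subgroup A G" and B: "subgroup B G" and "A \<subseteq> B" and comm: "commensurable B A"
  shows "1 \<le> index_ratio B A" and "\<not> B \<subseteq> A \<Longrightarrow> 2 \<le> index_ratio B A"
proof -
  have one: "index_in A B = index_in A A"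
    using index_Int(1)[OF A B] \<open>A \<subseteq> B\<close> by (simp add: Int_absorb2)
  have r: "index_ratio B A = real (index_in B A)" using cosets_in_self[OF A] unfolding index_ratio_def one by (simp add: index_in_def)
  have fin: "finite (cosets_in B A)" using comm unfolding commensurable_def by blast
  then show "1 \<le> index_ratio B A" using index_pos[OF B, of A] unfolding r by simp
  show "2 \<le> index_ratio B A" if nBA: "\<not> B \<subseteq> A"
  proof -
    obtain b where b: "b \<in> B" "b \<notin> A" using nBA by blast
    have "\<one> <# A \<noteq> b <# A"
      using l_coset_in_iff[OF B A subgroup.one_closed[OF B] b(1)] b subgroup.subset[OF B] by auto
    then have "card {\<one> <# A, b <# A} = 2" by simp
    moreover have "{\<one> <# A, b <# A} \<subseteq> cosets_in B A"
      using subgroup.one_closed[OF B] b unfolding cosets_in_def by blast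
    ultimately have "2 \<le> index_in B A" unfolding index_in_def using card_mono[OF fin] by metis
    then show ?thesis unfolding r by simp
  qed
qed

text \<open>The common value is the modular function of the commensurability class.\<close>

lemma index_ratio_modular:
  assumes g: "g \<in> carrier G" and H: "subgroup H G" and K: "subgroup K G"
    and HK: "commensurable H K" and cH: "commensurable (conj_set g H) H"
  shows "index_ratio (conj_set g H) H = index_ratio (conj_set g K) K"
proof -
  note gH = subgroup_conj_set[OF g H] and gK = subgroup_conj_set[OF g K]
  note KH = commensurable_sym[OF HK]
  note c = commensurable_conj_set[OF g K H KH]
  have 1: "index_ratio (conj_set g K) (conj_set g H) * index_ratio (conj_set g H) H = index_ratio (conj_set g K) H"
    by (rule index_ratio_mult[OF gK gH H c cH])
  have "commensurable (conj_set g K) H" by (rule commensurable_trans[OF gK gH H c cH])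
  then have 2: "index_ratio (conj_set g K) H * index_ratio H K = index_ratio (conj_set g K) K"
    by (rule index_ratio_mult[OF gK H K _ HK])
  \<comment> \<open>Passing from \<open>H\<close> to \<open>K\<close> costs two correction factors,
    one of them conjugated by \<open>g\<close>. Conjugation does not change it, so the two are
    inverse to each other.\<close>
  have "index_ratio K H * index_ratio H K = 1"
    using index_ratio_mult[OF K H K KH HK] index_ratio_self[OF K] by simp
  then show ?thesis
    using 1 2 index_ratio_conj_set[OF g K H] by (metis mult.assoc mult.commute mult_1)
qed

end

section \<open>Cycles of the quotient graph\<close>

context G_tree
begin

text \<open>The 1-chain traced in the quotient graph: an edge counts positively on its own orbit and
  negatively on the reversed one, which builds in the antisymmetry.\<close>

definition path_cycle :: "'v list \<Rightarrow> ('v \<times> 'v) set \<Rightarrow> real" where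
  "path_cycle xs X = (if X \<in> quotient_edges G T
     then \<Sum>i<length xs - 1. of_bool ((xs ! i, xs ! Suc i) \<in> X) - of_bool ((xs ! Suc i, xs ! i) \<in> X) else 0)"

lemma sum_over_edge_orbit:
  assumes "finite (quotient_edges G T)" "e \<in> edges T"
  shows "(\<Sum>X\<in>{X \<in> quotient_edges G T. Q X}. of_bool (e \<in> X) * f X) = (of_bool (Q (eorb e)) * f (eorb e) :: real)"
proof -
  have "(\<Sum>X\<in>{X \<in> quotient_edges G T. Q X}. of_bool (e \<in> X) * f X) =
      (\<Sum>X\<in>{X \<in> quotient_edges G T. Q X}. if X = eorb e then f (eorb e) else 0)"
    using in_quotient_edge_iff[OF _ assms(2)] by (intro sum.cong) auto
  also have "\<dots> = of_bool (Q (eorb e)) * f (eorb e)"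
    using assms by (simp add: sum.delta quotient_edges_eq)
  finally show ?thesis .
qed

text \<open>The boundary telescopes to the difference of the two ends of the path, which lie in the
  same orbit.\<close>

lemma path_cycle_in_cycles:
  assumes fin: "finite (quotient_edges G T)" and len: "length xs = Suc n"
    and E: "\<And>i. i < n \<Longrightarrow> (xs ! i, xs ! Suc i) \<in> edges T"
    and V: "xs ! 0 \<in> verts T" and loop: "xs ! n \<in> orb (xs ! 0)"
  shows "path_cycle xs \<in> quotient_cycles G T"
proof -
  have supp: "{X. path_cycle xs X \<noteq> 0} \<subseteq> quotient_edges G T" unfolding path_cycle_def by auto
  have E': "(xs ! Suc i, xs ! i) \<in> edges T" if "i < n" for i using E[OF that] edge_verts(4) by blast
  have "path_cycle xs (prod.swap ` X) = - path_cycle xs X" if X: "X \<in> quotient_edges G T" for X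
  proof -
    have "prod.swap ` X \<in> quotient_edges G T"
      using X swap_eorb edge_verts(4) unfolding quotient_edges_eq by fastforce
    moreover have "(a, b) \<in> prod.swap ` X \<longleftrightarrow> (b, a) \<in> X" for a b by force
    ultimately show ?thesis using X unfolding path_cycle_def by (simp add: sum_negf[symmetric])
  qed
  moreover have "(\<Sum>X | path_cycle xs X \<noteq> 0 \<and> fst ` X = Y. path_cycle xs X) = 0"
    if Y: "Y \<in> quotient_verts G T" for Y
  proof -
    let ?A = "{X \<in> quotient_edges G T. fst ` X = Y}"
    have "(\<Sum>X | path_cycle xs X \<noteq> 0 \<and> fst ` X = Y. path_cycle xs X) = (\<Sum>X\<in>?A. path_cycle xs X)"
      using fin supp by (intro sum.mono_neutral_left) auto
    also have "\<dots> = (\<Sum>X\<in>?A. \<Sum>i<n. of_bool ((xs ! i, xs ! Suc i) \<in> X) - of_bool ((xs ! Suc i, xs ! i) \<in> X))"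
      by (intro sum.cong) (auto simp: path_cycle_def len)
    also have "\<dots> = (\<Sum>i<n. \<Sum>X\<in>?A. of_bool ((xs ! i, xs ! Suc i) \<in> X) - of_bool ((xs ! Suc i, xs ! i) \<in> X))"
      by (rule sum.swap)
    also have "\<dots> = (\<Sum>i<n. of_bool (xs ! i \<in> Y) - of_bool (xs ! Suc i \<in> Y))"
    proof (rule sum.cong[OF refl])
      fix i assume "i \<in> {..<n}"
      then have i: "i < n" by simp
      have "(\<Sum>X\<in>?A. of_bool (e \<in> X)) = (of_bool (fst e \<in> Y) :: real)" if e: "e \<in> edges T" for e
        using sum_over_edge_orbit[OF fin e, where Q = "\<lambda>X. fst ` X = Y" and f = "\<lambda>_. 1"] e Y
        by (cases e) (auto simp: fst_eorb in_quotient_vert_iff edge_verts)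
      from this[OF E[OF i]] this[OF E'[OF i]]
      show "(\<Sum>X\<in>?A. of_bool ((xs ! i, xs ! Suc i) \<in> X) - of_bool ((xs ! Suc i, xs ! i) \<in> X)) =
          (of_bool (xs ! i \<in> Y) - of_bool (xs ! Suc i \<in> Y) :: real)"
        by (simp add: sum_subtractf)
    qed
    also have "\<dots> = of_bool (xs ! 0 \<in> Y) - of_bool (xs ! n \<in> Y)" by (rule sum_lessThan_telescope')
    also have "\<dots> = 0"
    proof -
      have "xs ! n \<in> verts T" using loop V orb_subset by blast
      then show ?thesis
        using in_quotient_vert_iff[OF Y] V orb_eqI[OF V loop] by auto
    qed
    finally show ?thesis .
  qed
  ultimately show ?thesis
    unfolding quotient_cycles_def using supp fin finite_subset by auto
qed

text \<open>An invariant antisymmetric weight descends to the quotient, so its integral along a path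
  depends only on the chain. The factor 2 arises because the right-hand side sums over both
  orientations.\<close>

lemma path_cycle_pairing:
  fixes w :: "'v \<times> 'v \<Rightarrow> real"
  assumes fin: "finite (quotient_edges G T)" and len: "length xs = Suc n"
    and E: "\<And>i. i < n \<Longrightarrow> (xs ! i, xs ! Suc i) \<in> edges T"
    and inv: "\<And>e e'. e \<in> edges T \<Longrightarrow> e' \<in> eorb e \<Longrightarrow> w e' = w e"
    and anti: "\<And>x y. (x, y) \<in> edges T \<Longrightarrow> w (y, x) = - w (x, y)"
  shows "2 * (\<Sum>i<n. w (xs ! i, xs ! Suc i)) =
    (\<Sum>X\<in>quotient_edges G T. path_cycle xs X * w (SOME e. e \<in> X))"
proof -
  let ?w = "\<lambda>X. w (SOME e. e \<in> X)"
  have w: "?w (eorb e) = w e" if "e \<in> edges T" for e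
    using inv[OF that] someI[of "\<lambda>e'. e' \<in> eorb e", OF eorb_refl[OF that]] by blast
  have E': "(xs ! Suc i, xs ! i) \<in> edges T" if "i < n" for i using E[OF that] edge_verts(4) by blast
  have one: "(\<Sum>X\<in>quotient_edges G T. of_bool (e \<in> X) * ?w X) = w e" if "e \<in> edges T" for e
    using sum_over_edge_orbit[OF fin that, where Q = "\<lambda>_. True" and f = ?w] w[OF that] by simp
  have "(\<Sum>X\<in>quotient_edges G T. path_cycle xs X * ?w X) =
      (\<Sum>X\<in>quotient_edges G T. \<Sum>i<n. of_bool ((xs ! i, xs ! Suc i) \<in> X) * ?w X - of_bool ((xs ! Suc i, xs ! i) \<in> X) * ?w X)"
    by (intro sum.cong refl) (simp add: path_cycle_def len sum_distrib_right left_diff_distrib)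
  also have "\<dots> = (\<Sum>i<n. \<Sum>X\<in>quotient_edges G T. of_bool ((xs ! i, xs ! Suc i) \<in> X) * ?w X - of_bool ((xs ! Suc i, xs ! i) \<in> X) * ?w X)"
    by (rule sum.swap)
  also have "\<dots> = (\<Sum>i<n. 2 * w (xs ! i, xs ! Suc i))"
  proof (rule sum.cong[OF refl])
    fix i assume "i \<in> {..<n}"
    then have i: "i < n" by simp
    show "(\<Sum>X\<in>quotient_edges G T. of_bool ((xs ! i, xs ! Suc i) \<in> X) * ?w X - of_bool ((xs ! Suc i, xs ! i) \<in> X) * ?w X) =
        2 * w (xs ! i, xs ! Suc i)"
      using one[OF E[OF i]] one[OF E'[OF i]] anti[OF E[OF i]] by (simp add: sum_subtractf)
  qed
  finally show ?thesis by (simp add: sum_distrib_left)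
qed

text \<open>The indicators of the edge orbits span a space containing all cycles, so a basis
  \<open>B\<close> is finite and \<open>dim\<close> is not at its default value. As \<open>c\<close>
  is nonzero, \<open>B\<close> consists of one vector.\<close>

lemma cycles_proportional:
  assumes fin: "finite (quotient_edges G T)" and b1: "quotient_betti1 G T \<le> 1"
    and c: "c \<in> quotient_cycles G T" "c X \<noteq> 0" and d: "d \<in> quotient_cycles G T"
  shows "\<exists>r. \<forall>Y. d Y = r * c Y"
proof -
  interpret vs: vector_space "fun_scale :: real \<Rightarrow> (('v \<times> 'v) set \<Rightarrow> real) \<Rightarrow> _"
    by (rule vector_space_fun_scale)
  let ?C = "quotient_cycles G T"
  obtain B where B: "B \<subseteq> ?C" "vs.independent B" "?C \<subseteq> vs.span B" "card B = vs.dim ?C"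
    using vs.basis_exists by blast
  define I where "I = (\<lambda>X Y. of_bool (Y = X) :: real) ` quotient_edges G T"
  have "?C \<subseteq> vs.span I"
  proof
    fix a assume "a \<in> ?C"
    then have a: "\<And>X. X \<notin> quotient_edges G T \<Longrightarrow> a X = 0" unfolding quotient_cycles_def by auto
    have "a = (\<Sum>X\<in>quotient_edges G T. fun_scale (a X) (\<lambda>Y. of_bool (Y = X)))"
    proof
      fix Y
      have "(\<Sum>X\<in>quotient_edges G T. fun_scale (a X) (\<lambda>Y. of_bool (Y = X))) Y =
          (\<Sum>X\<in>quotient_edges G T. a X * of_bool (Y = X))"
        using fin by (induction rule: finite_induct) (auto simp: fun_scale_def)
      also have "\<dots> = a Y" using a fin by (simp add: of_bool_def if_distrib cong: if_cong)
      finally show "a Y = (\<Sum>X\<in>quotient_edges G T. fun_scale (a X) (\<lambda>Y. of_bool (Y = X))) Y" by simp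
    qed
    also have "\<dots> \<in> vs.span I" unfolding I_def by (intro vs.span_sum vs.span_scale vs.span_base) auto
    finally show "a \<in> vs.span I" .
  qed
  then have "finite B" using vs.independent_span_bound[of I B] B fin unfolding I_def by auto
  moreover have "card B \<le> 1" using B(4) b1 unfolding quotient_betti1_def by simp
  moreover have "B \<noteq> {}"
  proof
    assume "B = {}"
    then have "c = 0" using B(3) c by auto
    then show False using c by simp
  qed
  ultimately obtain b where "B = {b}"
    by (metis One_nat_def card_1_singletonE card_gt_0_iff le_antisym Suc_leI)
  then have "?C \<subseteq> range (\<lambda>k. fun_scale k b)" using B(3) vs.span_singleton by simp
  then obtain k l where "c = fun_scale k b" "d = fun_scale l b" using c(1) d by blast
  then have "d Y = l / k * c Y" for Y using c(2) by (auto simp: fun_scale_def)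
  then show ?thesis by blast
qed

text \<open>\<open>St x\<close> permutes the finitely many edges at \<open>x\<close>, so the
  stabilizer of a neighbour has only finitely many cosets in it; transitivity along a path gives the
  rest.\<close>

lemma locally_finite_commensurable:
  assumes "locally_finite_gtree T" "x \<in> verts T" "y \<in> verts T"
  shows "commensurable (St x) (St y)"
proof -
  have edge: "finite (cosets_in (St x) (St y))" if xy: "(x, y) \<in> edges T" for x y
  proof -
    have V: "x \<in> verts T" "y \<in> verts T" using xy edge_verts by auto
    have "(\<lambda>a. act T a y) ` St x \<subseteq> snd ` edges_from T x"
    proof
      fix z assume "z \<in> (\<lambda>a. act T a y) ` St x"
      then obtain a where "a \<in> carrier G" "act T a x = x" "z = act T a y" by (auto simp: in_St)
      then have "(x, z) \<in> edges_from T x" using act_edge[OF _ xy] unfolding edges_from_def by force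
      then show "z \<in> snd ` edges_from T x" by force
    qed
    then have "finite ((\<lambda>a. act T a y) ` St x)"
      using assms(1) V unfolding locally_finite_gtree_def by (meson finite_imageI finite_subset)
    then show ?thesis
      unfolding cosets_in_def
    proof (rule finite_image_coarser)
      fix a b assume ab: "a \<in> St x" "b \<in> St x" "act T a y = act T b y"
      then have c: "a \<in> carrier G" "b \<in> carrier G" by (auto simp: in_St)
      then have "inv a \<otimes> b \<in> St y" using ab V act_inv(1)[of a y] by (simp add: in_St act_mult)
      then show "a <# St y = b <# St y" using l_coset_eq_iff[OF St_subgroup[OF V(2)] c] by simp
    qed
  qed
  have "finite (cosets_in (St x) (St y))" if "x \<in> verts T" "y \<in> verts T" for x y
    using connected[OF that]
  proof (induction rule: rtrancl_induct)
    case base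
    show ?case using cosets_in_self[OF St_subgroup[OF that(1)]] by simp
  next
    case (step y z)
    then show ?case
      using finite_cosets_trans(2) St_subgroup that(1) edge_verts edge by meson
  qed
  then show ?thesis using assms unfolding commensurable_def by blast
qed

text \<open>Every survivor among the edges \<open>(v, u)\<close> with \<open>stab_leaf v u\<close> gives a cycle crossing its orbit
  exactly once. When \<open>b\<^sub>1 \<le> 1\<close> all these cycles are proportional, hence the path underlying
  one of them meets all the orbits of such \<open>v\<close>, and each contributes a factor of at least 2 to the
  value of the modular function. That value is bounded by the values at the generators, because
  every period is an integer multiple of it.\<close>

lemma card_stab_leaf_orbits_le:
  assumes S: "S \<subseteq> carrier G" "generate G S = carrier G" "finite S"
    and b1: "quotient_betti1 G T \<le> 1"
    and surv: "\<And>v u. stab_leaf v u \<Longrightarrow> \<exists>R h. reduced_collapse G T R h \<and> h v \<noteq> h u"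
    and comm: "\<And>x y. x \<in> verts T \<Longrightarrow> y \<in> verts T \<Longrightarrow> commensurable (St x) (St y)"
    and K: "subgroup K G" "\<And>x. x \<in> verts T \<Longrightarrow> commensurable (St x) K"
  shows "real (card (orb ` {v. \<exists>u. stab_leaf v u})) * ln 2 \<le> (\<Sum>s\<in>S. \<bar>ln (index_ratio (conj_set s K) K)\<bar>)"
proof (cases "\<exists>v u. stab_leaf v u")
  case False
  then show ?thesis by (simp add: sum_nonneg)
next
  case True
  then obtain v u where vu: "stab_leaf v u" by blast
  let ?L = "orb ` {v. \<exists>u. stab_leaf v u}"
  note fin = finite_quotient[OF S]
  have v: "v \<in> verts T" using vu edge_verts unfolding stab_leaf_def by blast
  have loop: "\<exists>g p n. g \<in> carrier G \<and> length p = Suc n \<and> 0 < n \<and> p ! 0 = v \<and> p ! n = act T g v \<and>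
      (\<forall>i<n. (p ! i, p ! Suc i) \<in> edges T \<and> St (p ! i) \<subseteq> St (p ! Suc i)) \<and>
      (\<forall>i<n. \<forall>w. stab_leaf (p ! Suc i) w \<longrightarrow> \<not> St (p ! Suc i) \<subseteq> St (p ! i)) \<and>
      path_cycle p (eorb (v, u)) = 1"
    if vu: "stab_leaf v u" for v u
  proof -
    obtain R h where "reduced_collapse G T R h" and ne: "h v \<noteq> h u" using surv[OF vu] by blast
    interpret C: reduced_collapse G T R h by fact
    obtain g p n where p: "g \<in> carrier G" "length p = Suc n" "0 < n" "p ! 0 = v" "p ! 1 = u" "p ! n = act T g v"
      "\<And>i. i < n \<Longrightarrow> (p ! i, p ! Suc i) \<in> edges T" "\<And>i. i < n \<Longrightarrow> St (p ! i) \<subseteq> St (p ! Suc i)"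
      and col: "\<And>i. i < n \<Longrightarrow> 0 < i \<Longrightarrow> h (p ! i) = h (p ! Suc i)"
      and str: "\<And>i w. i < n \<Longrightarrow> stab_leaf (p ! Suc i) w \<Longrightarrow> \<not> St (p ! Suc i) \<subseteq> St (p ! i)"
      using C.stab_leaf_loop[OF vu ne] by metis
    have e: "(v, u) \<in> edges T" "v \<in> verts T" "u \<in> verts T"
      using vu edge_verts unfolding stab_leaf_def by auto
    \<comment> \<open>All translates of \<open>(v, u)\<close> survive in \<open>R\<close>, whereas
      \<open>h\<close> collapses every edge of \<open>p\<close> but the first; hence
      \<open>p\<close> crosses this orbit exactly once.\<close>
    have hne: "h x \<noteq> h y" if xy: "(x, y) \<in> eorb (v, u)" for x y
    proof
      assume "h x = h y"
      obtain k where k: "k \<in> carrier G" "x = act T k v" "y = act T k u" using xy by (auto simp: in_eorb)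
      then have "act R k (h v) = act R k (h u)" using \<open>h x = h y\<close> C.h_act e by simp
      then show False using C.R.act_inj[OF k(1)] C.h_verts e ne by blast
    qed
    have "(u, v) \<notin> eorb (v, u)"
      using eorb_swap_neq[OF e(1)] eorb_eqI[OF e(1)] by metis
    then have step: "of_bool ((p ! i, p ! Suc i) \<in> eorb (v, u)) - of_bool ((p ! Suc i, p ! i) \<in> eorb (v, u)) =
        (if i = 0 then 1 else 0 :: real)" if "i < n" for i
      using hne[of "p ! i" "p ! Suc i"] hne[of "p ! Suc i" "p ! i"] col[OF that] eorb_refl[OF e(1)] p(4,5)
      by (cases "i = 0") auto
    have "path_cycle p (eorb (v, u)) =
        (\<Sum>i<n. of_bool ((p ! i, p ! Suc i) \<in> eorb (v, u)) - of_bool ((p ! Suc i, p ! i) \<in> eorb (v, u)))"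
      using e p(2) by (simp add: path_cycle_def quotient_edges_eq)
    also have "\<dots> = (\<Sum>i<n. if i = 0 then 1 else 0)"
      using step by (intro sum.cong) auto
    also have "\<dots> = 1" using p(3) by simp
    finally show ?thesis using p str by blast
  qed
  obtain g p n where g: "g \<in> carrier G" and p: "length p = Suc n" "0 < n" "p ! 0 = v" "p ! n = act T g v"
    "\<And>i. i < n \<Longrightarrow> (p ! i, p ! Suc i) \<in> edges T" "\<And>i. i < n \<Longrightarrow> St (p ! i) \<subseteq> St (p ! Suc i)"
    and strict: "\<And>i w. i < n \<Longrightarrow> stab_leaf (p ! Suc i) w \<Longrightarrow> \<not> St (p ! Suc i) \<subseteq> St (p ! i)"
    and c1: "path_cycle p (eorb (v, u)) = 1"
    using loop[OF vu] by blast
  have cyc: "path_cycle p \<in> quotient_cycles G T"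
    using p g v by (intro path_cycle_in_cycles[OF fin(2) p(1)]) (auto simp: in_orb)
  \<comment> \<open>A potential: the logarithmic size of the stabilizer relative to
    \<open>St v\<close>. It is not invariant, but its increments along edges are, and they form the
    weight \<open>w\<close>.\<close>
  define m where "m x = ln (index_ratio (St x) (St v))" for x
  have m_diff: "m y - m x = ln (index_ratio (St y) (St x))" if xy: "x \<in> verts T" "y \<in> verts T" for x y
  proof -
    note s = St_subgroup[OF xy(1)] St_subgroup[OF xy(2)] St_subgroup[OF v]
    have "index_ratio (St y) (St x) * index_ratio (St x) (St v) = index_ratio (St y) (St v)"
      using index_ratio_mult[OF s(2,1,3)] comm xy v by blast
    then have "ln (index_ratio (St y) (St x)) + m x = m y"
      unfolding m_def using ln_mult_pos index_ratio_pos s comm xy v by metis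
    then show ?thesis by simp
  qed
  have conj: "St (act T k x) = conj_set k (St x)" if "k \<in> carrier G" "x \<in> verts T" for k x
    using St_act[OF that] unfolding conj_set_def .
  have m_act: "m (act T k y) - m (act T k x) = m y - m x" if "k \<in> carrier G" "x \<in> verts T" "y \<in> verts T" for k x y
    using m_diff that act_closed index_ratio_conj_set St_subgroup by (simp add: conj)
  define w where "w e = m (snd e) - m (fst e)" for e
  have w_inv: "w e' = w e" if "e \<in> edges T" "e' \<in> eorb e" for e e'
    using that edge_verts m_act unfolding w_def by (cases e; cases e') (auto simp: in_eorb)
  have w_anti: "w (y, x) = - w (x, y)" for x y unfolding w_def by simp
  define Q where "Q = m (act T g v) - m v"
  have Q_sum: "(\<Sum>i<n. w (p ! i, p ! Suc i)) = Q"
    unfolding w_def Q_def using sum_lessThan_telescope[of "\<lambda>i. m (p ! i)" n] p by simp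
  have Q_pair: "(\<Sum>X\<in>quotient_edges G T. path_cycle p X * w (SOME e. e \<in> X)) = 2 * Q"
    using path_cycle_pairing[where w = w, OF fin(2) p(1,5) w_inv w_anti] Q_sum by simp
  have w_p: "0 \<le> w (p ! i, p ! Suc i)" "stab_leaf (p ! Suc i) z \<Longrightarrow> ln 2 \<le> w (p ! i, p ! Suc i)"
    if i: "i < n" for i z
  proof -
    have V: "p ! i \<in> verts T" "p ! Suc i \<in> verts T" using p(5)[OF i] edge_verts by auto
    note r = index_ratio_subset[OF St_subgroup[OF V(1)] St_subgroup[OF V(2)] p(6)[OF i] comm[OF V(2,1)]]
    have eq: "w (p ! i, p ! Suc i) = ln (index_ratio (St (p ! Suc i)) (St (p ! i)))"
      using m_diff[OF V] unfolding w_def by simp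
    show "0 \<le> w (p ! i, p ! Suc i)" unfolding eq using r(1) by simp
    show "ln 2 \<le> w (p ! i, p ! Suc i)" if "stab_leaf (p ! Suc i) z"
      unfolding eq using r(2) strict[OF i that] by simp
  qed
  have visit: "\<exists>i<n. p ! Suc i \<in> Y" if Y: "Y \<in> ?L" for Y
  proof -
    obtain v' u' where v': "stab_leaf v' u'" "Y = orb v'" using Y by blast
    have e': "(v', u') \<in> edges T" "v' \<in> verts T" using v' edge_verts unfolding stab_leaf_def by auto
    obtain g' p' n' where p': "g' \<in> carrier G" "length p' = Suc n'" "p' ! 0 = v'" "p' ! n' = act T g' v'"
      "\<And>i. i < n' \<Longrightarrow> (p' ! i, p' ! Suc i) \<in> edges T" "path_cycle p' (eorb (v', u')) = 1"
      using loop[OF v'(1)] by blast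
    have "path_cycle p' \<in> quotient_cycles G T"
      using p' e' by (intro path_cycle_in_cycles[OF fin(2) p'(2)]) (auto simp: in_orb)
    then obtain r where "\<And>X. path_cycle p' X = r * path_cycle p X"
      using cycles_proportional[OF fin(2) b1 cyc, of "eorb (v, u)"] c1 by force
    \<comment> \<open>The cycle through the leaf \<open>v'\<close> has coefficient 1 at this edge
      and is a multiple of the cycle of \<open>p\<close>, so \<open>p\<close> must cross the edge as
      well.\<close>
    then have "path_cycle p (eorb (v', u')) \<noteq> 0" using p'(6) by (metis mult_zero_right zero_neq_one)
    then have "\<exists>i<n. (p ! i, p ! Suc i) \<in> eorb (v', u') \<or> (p ! Suc i, p ! i) \<in> eorb (v', u')"
      unfolding path_cycle_def p(1) by (auto split: if_splits intro!: sum.neutral)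
    then obtain i where i: "i < n" "p ! i \<in> Y \<or> p ! Suc i \<in> Y"
      unfolding v'(2) by (auto simp: in_eorb in_orb)
    show ?thesis
    proof (cases "p ! Suc i \<in> Y")
      case False
      then have pi: "p ! i \<in> Y" using i by blast
      show ?thesis
      proof (cases i)
        case 0
        \<comment> \<open>Growth is credited to the terminal vertex of an edge, so the start
          \<open>v\<close> of \<open>p\<close> is exchanged for its end \<open>act T g v\<close>,
          which lies in the same orbit.\<close>
        then have "orb v = Y" using pi p(3) orb_eqI[OF e'(2)] v'(2) by simp
        then have "p ! n \<in> Y" using p(4) g by (auto simp: in_orb)
        then show ?thesis using p(2) by (intro exI[of _ "n - 1"]) simp
      next
        case (Suc j)
        then show ?thesis using pi i by (intro exI[of _ j]) simp
      qed
    qed (use i in blast)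
  qed
  then obtain \<iota> where \<iota>: "\<And>Y. Y \<in> ?L \<Longrightarrow> \<iota> Y < n \<and> p ! Suc (\<iota> Y) \<in> Y" by metis
  have LQ: "?L \<subseteq> quotient_verts G T" unfolding quotient_verts_eq stab_leaf_def using edge_verts by auto
  have inj: "inj_on \<iota> ?L"
  proof (rule inj_onI)
    fix Y Z assume YZ: "Y \<in> ?L" "Z \<in> ?L" "\<iota> Y = \<iota> Z"
    have V: "p ! Suc (\<iota> Y) \<in> verts T" using \<iota>[OF YZ(1)] p(5)[of "\<iota> Y"] edge_verts(2) by blast
    have "Y = orb (p ! Suc (\<iota> Y))"
      using in_quotient_vert_iff[OF subsetD[OF LQ YZ(1)] V] \<iota>[OF YZ(1)] by blast
    moreover have "Z = orb (p ! Suc (\<iota> Y))"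
      using in_quotient_vert_iff[OF subsetD[OF LQ YZ(2)] V] \<iota>[OF YZ(2)] YZ(3) by simp
    ultimately show "Y = Z" by simp
  qed
  have leaf: "ln 2 \<le> w (p ! \<iota> Y, p ! Suc (\<iota> Y))" if Y: "Y \<in> ?L" for Y
  proof -
    obtain v' u' where v': "stab_leaf v' u'" "Y = orb v'" using Y by blast
    then obtain k where "k \<in> carrier G" "p ! Suc (\<iota> Y) = act T k v'" using \<iota>[OF Y] by (auto simp: in_orb)
    then have "stab_leaf (p ! Suc (\<iota> Y)) (act T k u')" using stab_leaf_act v' by simp
    then show ?thesis using w_p(2) \<iota>[OF Y] by blast
  qed
  have "real (card ?L) * ln 2 = (\<Sum>Y\<in>?L. ln 2)" by simp
  also have "\<dots> \<le> (\<Sum>Y\<in>?L. w (p ! \<iota> Y, p ! Suc (\<iota> Y)))" by (intro sum_mono leaf)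
  also have "\<dots> = (\<Sum>i\<in>\<iota> ` ?L. w (p ! i, p ! Suc i))" by (simp add: sum.reindex[OF inj])
  also have "\<dots> \<le> (\<Sum>i<n. w (p ! i, p ! Suc i))" using \<iota> w_p(1) by (intro sum_mono2) auto
  finally have card_le: "real (card ?L) * ln 2 \<le> Q" using Q_sum by simp
  have "?L \<noteq> {}" "finite ?L" using vu LQ fin(1) finite_subset by auto
  then have "0 < real (card ?L) * ln 2" by (simp add: card_gt_0_iff)
  then have Qpos: "0 < Q" using card_le by linarith
  have period: "\<exists>k::int. m (act T s v) - m v = k * Q" if s: "s \<in> carrier G" for s
  proof -
    define q where "q = path_between (edges T) v (act T s v)"
    have q: "simple_path (edges T) v q (act T s v)" unfolding q_def using path_between v act_closed s by blast
    define l where "l = length q - 1"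
    have l: "length q = Suc l" "q ! 0 = v" "q ! l = act T s v" "\<And>i. i < l \<Longrightarrow> (q ! i, q ! Suc i) \<in> edges T"
      using q unfolding simple_path_def l_def
      by (auto simp: hd_conv_nth last_conv_nth successively_conv_nth)
    have "path_cycle q \<in> quotient_cycles G T"
      using l s v by (intro path_cycle_in_cycles[OF fin(2) l(1)]) (auto simp: in_orb)
    then obtain r where r: "\<And>X. path_cycle q X = r * path_cycle p X"
      using cycles_proportional[OF fin(2) b1 cyc, of "eorb (v, u)"] c1 by force
    \<comment> \<open>The cycle of \<open>p\<close> has coefficient 1 at this edge, so
      \<open>r\<close> equals a coefficient of the cycle of \<open>q\<close>, and these are
      integers.\<close>
    have "path_cycle q (eorb (v, u)) \<in> \<int>" unfolding path_cycle_def by (auto intro!: Ints_sum)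
    then have "r \<in> \<int>" using r c1 by simp
    then obtain k where k: "r = of_int k" by (auto elim: Ints_cases)
    have "2 * (m (act T s v) - m v) = 2 * (\<Sum>i<l. w (q ! i, q ! Suc i))"
      unfolding w_def using sum_lessThan_telescope[of "\<lambda>i. m (q ! i)" l] l by simp
    also have "\<dots> = (\<Sum>X\<in>quotient_edges G T. path_cycle q X * w (SOME e. e \<in> X))"
      by (rule path_cycle_pairing[where w = w, OF fin(2) l(1,4) w_inv w_anti])
    also have "\<dots> = r * (2 * Q)" unfolding r Q_pair[symmetric] by (simp add: sum_distrib_left mult.assoc)
    finally show ?thesis using k by (intro exI[of _ k]) simp
  qed
  \<comment> \<open>If all generators had period 0, \<open>m\<close> would be invariant under the
    whole group, but \<open>Q\<close> is the period of \<open>g\<close>.\<close>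
  have "\<exists>s\<in>S. m (act T s v) - m v \<noteq> 0"
  proof (rule ccontr)
    assume "\<not> ?thesis"
    then have zero: "m (act T s v) = m v" if "s \<in> S" for s using that by simp
    have "\<forall>x\<in>verts T. m (act T k x) = m x" if "k \<in> carrier G" for k
    proof (rule generate_induct_act[OF S(1,2) that])
      show "\<forall>x\<in>verts T. m (act T s x) = m x" if "s \<in> S" for s
        using m_act[of s v] zero[OF that] S(1) that v by fastforce
      show "\<forall>x\<in>verts T. m (act T (inv s) x) = m x" if "s \<in> carrier G" "\<forall>x\<in>verts T. m (act T s x) = m x" for s
        using that act_inv(2)[OF that(1)] act_closed[OF inv_closed[OF that(1)]] by metis
    qed (auto simp: act_one act_mult act_closed)
    then show False using Qpos g v unfolding Q_def by simp
  qed
  then obtain s where s: "s \<in> S" "m (act T s v) - m v \<noteq> 0" by blast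
  then have sG: "s \<in> carrier G" using S by blast
  obtain k :: int where k: "m (act T s v) - m v = k * Q" using period[OF sG] by blast
  then have "1 \<le> \<bar>k\<bar>" using s by auto
  then have "1 * Q \<le> \<bar>real_of_int k\<bar> * Q" using Qpos by (intro mult_right_mono) linarith+
  then have "Q \<le> \<bar>m (act T s v) - m v\<bar>" using k Qpos by (simp add: abs_mult)
  \<comment> \<open>By \<open>index_ratio_modular\<close> the period can be read off from
    \<open>K\<close> instead of \<open>St v\<close>, which makes the bound independent of the
    tree.\<close>
  also have "m (act T s v) - m v = ln (index_ratio (conj_set s K) K)"
    using m_diff[OF v act_closed[OF sG v]] conj[OF sG v]
      index_ratio_modular[OF sG St_subgroup[OF v] K(1) K(2)[OF v]] comm[OF act_closed[OF sG v] v] by simp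
  also have "\<bar>\<dots>\<bar> \<le> (\<Sum>s\<in>S. \<bar>ln (index_ratio (conj_set s K) K)\<bar>)"
    using s(1) S(3) by (intro member_le_sum) auto
  finally show ?thesis using card_le by linarith
qed

end

section \<open>The collapse poset\<close>

lemma G_treeI: "is_gtree G T \<Longrightarrow> G_tree G T"
  unfolding G_tree_def G_tree_axioms_def is_gtree_def acts_by_automorphisms_def
    group_action_def group_hom_def by blast

lemma collapseI: "is_gtree G T \<Longrightarrow> is_gtree G T' \<Longrightarrow> collapses_to G T T' f \<Longrightarrow> collapse G T T' f"
  unfolding collapse_def collapse_axioms_def using G_treeI by blast

context collapse
begin

lemma quotient_verts_image: "quotient_verts G R = (`) h ` quotient_verts G T"
proof -
  have "h ` T.orb x = R.orb (h x)" if "x \<in> verts T" for x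
    using that h_act by (force simp: orbit_def)
  moreover have "verts R = h ` verts T" using h_verts h_surj by blast
  ultimately show ?thesis
    unfolding T.quotient_verts_eq R.quotient_verts_eq by (auto simp: image_image)
qed

lemma elliptic_collapse: "H \<subseteq> carrier G \<Longrightarrow> elliptic T H \<Longrightarrow> elliptic R H"
  using T.elliptic_iff[of H] R.elliptic_iff[of H] h_verts St_subset by (meson order_trans)

text \<open>\<open>h\<close> induces a surjection between the finite sets of orbits, and it
  identifies the distinct orbits of \<open>x\<close> and \<open>y\<close>.\<close>

lemma card_quotient_verts_less:
  assumes "finite (quotient_verts G T)" "x \<in> verts T" "y \<in> verts T"
    "h x = h y" "\<not> same_orbit G T x y"
  shows "card (quotient_verts G R) < card (quotient_verts G T)"
proof (rule ccontr)
  assume "\<not> ?thesis"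
  then have "card ((`) h ` quotient_verts G T) = card (quotient_verts G T)"
    using card_image_le[OF assms(1), of "(`) h"] unfolding quotient_verts_image by simp
  then have inj: "inj_on ((`) h) (quotient_verts G T)" using assms(1) eq_card_imp_inj_on by blast
  have "h ` T.orb x = h ` T.orb y"
    using assms h_act by (auto simp: orbit_def image_iff) metis+
  then have "T.orb x = T.orb y" using inj_onD[OF inj] assms unfolding T.quotient_verts_eq by blast
  then show False using assms T.orb_eq_iff[of y x] unfolding same_orbit_def by metis
qed

end

section \<open>Isomorphism classes and chains of collapses\<close>

lemma gtree_isomorphism_sym:
  assumes iso: "gtree_isomorphism G T T' f" and T: "is_gtree G T"
  shows "gtree_isomorphism G T' T (inv_into (verts T) f)"
proof -
  interpret T: G_tree G T using G_treeI[OF T] .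
  let ?g = "inv_into (verts T) f"
  have f: "bij_betw f (verts T) (verts T')" and eq: "equivariant G T T' f"
    and E: "\<And>u v. u \<in> verts T \<Longrightarrow> v \<in> verts T \<Longrightarrow> (f u, f v) \<in> edges T' \<longleftrightarrow> (u, v) \<in> edges T"
    using iso unfolding gtree_isomorphism_def by auto
  have g: "bij_betw ?g (verts T') (verts T)" using f by (rule bij_betw_inv_into)
  have gV: "?g v \<in> verts T" "f (?g v) = v" if "v \<in> verts T'" for v
    using that f bij_betw_inv_into_right[OF f that] bij_betwE[OF g] by auto
  have "?g (act T' k v) = act T k (?g v)" if k: "k \<in> carrier G" "v \<in> verts T'" for k v
  proof -
    have "act T' k v = f (act T k (?g v))" using eq gV[OF k(2)] k unfolding equivariant_def by simp
    then show ?thesis using T.act_closed[OF k(1) gV(1)[OF k(2)]] bij_betw_inv_into_left[OF f] by simp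
  qed
  then show ?thesis using g gV E unfolding gtree_isomorphism_def equivariant_def by metis
qed

lemma gtree_isomorphism_trans:
  assumes f: "gtree_isomorphism G T T' f" and g: "gtree_isomorphism G T' T'' g"
  shows "gtree_isomorphism G T T'' (g \<circ> f)"
proof -
  have "f v \<in> verts T'" if "v \<in> verts T" for v
    using f that unfolding gtree_isomorphism_def by (auto dest: bij_betwE)
  then show ?thesis
    using f g bij_betw_trans unfolding gtree_isomorphism_def equivariant_def by auto
qed

lemma iso_class_eq:
  assumes "gtree_isomorphism G T T' f" "is_gtree G T" "is_gtree G T'"
  shows "iso_class G T = iso_class G T'"
  unfolding iso_class_def
  using gtree_isomorphism_sym[OF assms(1,2)] assms gtree_isomorphism_trans by blast

lemma iso_classD:
  assumes "T' \<in> iso_class G T" "is_gtree G T"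
  shows "is_gtree G T'" "iso_class G T' = iso_class G T"
  using assms iso_class_eq unfolding iso_class_def by blast+

lemma collapse_move_collapses_to:
  assumes "collapse_move G T T' f" "is_gtree G T"
  shows "is_gtree G T'" "collapses_to G T T' f"
    "\<exists>x\<in>verts T. \<exists>y\<in>verts T. f x = f y \<and> \<not> same_orbit G T x y"
proof -
  interpret T: G_tree G T using G_treeI[OF assms(2)] .
  obtain e where e: "collapsible G T e"
    "contraction G (T.eorb e \<union> T.eorb (prod.swap e)) T T' f"
    using assms(1) unfolding collapse_move_def by blast
  have eE: "e \<in> edges T" "prod.swap e \<in> edges T"
    using e(1) T.edge_verts(4) unfolding collapsible_def by (cases e; simp)+
  have sub: "T.eorb e \<union> T.eorb (prod.swap e) \<subseteq> edges T" using T.eorb_subset eE by blast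
  show "is_gtree G T'" using e(2) unfolding contraction_def by blast
  show "collapses_to G T T' f" by (rule contraction_collapses_to(1)[OF e(2) sub assms(2)])
  have "f (fst e) = f (snd e)"
    using contraction_collapses_to(2)[OF e(2) sub assms(2) eE(1)] T.eorb_refl[OF eE(1)] by blast
  moreover have "fst e \<in> verts T" "snd e \<in> verts T" using eE T.edge_verts by (cases e; simp)+
  ultimately show "\<exists>x\<in>verts T. \<exists>y\<in>verts T. f x = f y \<and> \<not> same_orbit G T x y"
    using e(1) unfolding collapsible_def by blast
qed

lemma collapse_map_collapses_to:
  assumes "collapse_map G T T' f"
  shows "is_gtree G T" "is_gtree G T'" "collapses_to G T T' f"
proof -
  have "is_gtree G T \<and> is_gtree G T' \<and> collapses_to G T T' f"
    using assms
  proof (induction rule: collapse_map.induct)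
    case (iso T' f)
    then show ?case using gtree_isomorphism_collapses_to by blast
  next
    case (step T' f T'' h)
    then show ?case using collapse_move_collapses_to collapses_to_comp by metis
  qed
  then show "is_gtree G T" "is_gtree G T'" "collapses_to G T T' f" by blast+
qed

lemma card_quotient_verts_le_if_collapses_to:
  assumes "collapses_to G T T' f" "is_gtree G T" "is_gtree G T'" "finite (quotient_verts G T)"
  shows "card (quotient_verts G T') \<le> card (quotient_verts G T)"
  using collapse.quotient_verts_image[OF collapseI[OF assms(2,3,1)]] card_image_le[OF assms(4)] by simp

lemma collapse_map_iso_or_less:
  assumes S: "S \<subseteq> carrier G" "generate G S = carrier G" "finite S" and "collapse_map G T T' f"
  shows "(\<exists>f. gtree_isomorphism G T T' f) \<or> card (quotient_verts G T') < card (quotient_verts G T)"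
  using assms(4)
proof (induction rule: collapse_map.induct)
  case (step T' f T'' h)
  note T = collapse_map_collapses_to[OF step(1)]
  note m = collapse_move_collapses_to[OF step(2) T(2)]
  have fin: "finite (quotient_verts G T)" "finite (quotient_verts G T')"
    using G_tree.finite_quotient(1)[OF G_treeI S] T by blast+
  have "card (quotient_verts G T'') < card (quotient_verts G T')"
    using collapse.card_quotient_verts_less[OF collapseI[OF T(2) m(1,2)] fin(2)] m(3) by blast
  then show ?case using card_quotient_verts_le_if_collapses_to[OF T(3,1,2) fin(1)] by linarith
qed blast

text \<open>The number of vertices of the quotient depends only on the isomorphism class and drops
  along every strict relation, so it is injective on a chain and has values in
  \<open>{..N}\<close>.\<close>

lemma order_complex_bounded:
  fixes G :: "('g, 'b) monoid_scheme" and P :: "('g, 'v) gtree set set"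
  assumes S: "S \<subseteq> carrier G" "generate G S = carrier G" "finite S"
    and P: "\<And>X. X \<in> P \<Longrightarrow> \<exists>T. X = iso_class G T \<and> is_gtree G T \<and> card (quotient_verts G T) \<le> N"
    and \<sigma>: "\<sigma> \<in> order_complex (Col_le G) P"
  shows "card \<sigma> \<le> Suc N"
proof -
  have sub: "\<sigma> \<subseteq> P" and ch: "\<And>X Y. X \<in> \<sigma> \<Longrightarrow> Y \<in> \<sigma> \<Longrightarrow> Col_le G X Y \<or> Col_le G Y X"
    using \<sigma> unfolding order_complex_def Complete_Partial_Order.chain_def by blast+
  define rep where "rep X = (SOME T. X = iso_class G T \<and> is_gtree G T \<and> card (quotient_verts G T) \<le> N)"
    for X :: "('g, 'v) gtree set"
  define \<nu> where "\<nu> X = card (quotient_verts G (rep X))" for X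
  have rep: "X = iso_class G (rep X) \<and> is_gtree G (rep X) \<and> \<nu> X \<le> N" if "X \<in> \<sigma>" for X
    unfolding \<nu>_def rep_def using someI_ex[OF P] sub that by blast
  have member: "is_gtree G T \<and> iso_class G T = X \<and> card (quotient_verts G T) = \<nu> X" if X: "X \<in> \<sigma>" and T: "T \<in> X" for X T
  proof -
    note r = rep[OF X]
    then have T': "T \<in> iso_class G (rep X)" and g: "is_gtree G (rep X)" using T by blast+
    note m = iso_classD[OF T' g]
    obtain f where f: "gtree_isomorphism G (rep X) T f" using T' unfolding iso_class_def by blast
    note fin = G_tree.finite_quotient(1)[OF G_treeI S]
    have "card (quotient_verts G T) \<le> \<nu> X"
      unfolding \<nu>_def using card_quotient_verts_le_if_collapses_to gtree_isomorphism_collapses_to[OF f g m(1)]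
        g m(1) fin[OF g] by blast
    moreover have "\<nu> X \<le> card (quotient_verts G T)"
      unfolding \<nu>_def using card_quotient_verts_le_if_collapses_to
        gtree_isomorphism_collapses_to[OF gtree_isomorphism_sym[OF f g] m(1) g] g m(1) fin[OF m(1)] by blast
    ultimately show ?thesis using m r by simp
  qed
  have le: "X = Y \<or> \<nu> X < \<nu> Y" if XY: "X \<in> \<sigma>" "Y \<in> \<sigma>" "Col_le G X Y" for X Y
  proof -
    obtain T T' f where T: "T \<in> X" "T' \<in> Y" "collapse_map G T' T f"
      using XY(3) unfolding Col_le_def dominates_def by blast
    show ?thesis
      using collapse_map_iso_or_less[OF S T(3)] member[OF XY(1) T(1)] member[OF XY(2) T(2)]
        iso_class_eq[of G T' T] by auto
  qed
  have "inj_on \<nu> \<sigma>"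
  proof (rule inj_onI)
    fix X Y assume "X \<in> \<sigma>" "Y \<in> \<sigma>" "\<nu> X = \<nu> Y"
    then show "X = Y" using le ch by (metis less_irrefl)
  qed
  moreover have "\<nu> ` \<sigma> \<subseteq> {..N}" using rep by auto
  ultimately have "card \<sigma> \<le> card {..N}" by (intro card_inj_on_le) auto
  then show ?thesis by simp
qed

lemma deformation_spaceD:
  assumes "(T, l) \<in> deformation_space G T0"
  shows "is_gtree G T" "subgroup H G \<Longrightarrow> elliptic T H \<longleftrightarrow> elliptic T0 H"
  using assms unfolding deformation_space_def metric_gtree_def by auto

lemma deformation_spaceI:
  assumes "is_gtree G T" "\<And>H. subgroup H G \<Longrightarrow> elliptic T H \<longleftrightarrow> elliptic T0 H"
  shows "(T, \<lambda>_. 1) \<in> deformation_space G T0"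
  using assms unfolding deformation_space_def metric_gtree_def by simp

section \<open>The tree left after collapsing the non-surviving edges\<close>

locale TW_collapse =
  fixes G :: "('g, 'b) monoid_scheme" and T0 T T' :: "('g, 'v) gtree" and D :: "('g, 'v) defspace" and p
  assumes D: "D = deformation_space G T0" and T: "T \<in> Col_trees G D"
    and p: "contraction G {e \<in> edges T. \<not> surviving G D T e} T T' p"
begin

lemma gtrees: "is_gtree G T" "is_gtree G T'"
proof -
  obtain l where "(T, l) \<in> deformation_space G T0" using T unfolding D Col_trees_def by blast
  then show "is_gtree G T" by (rule deformation_spaceD(1))
  show "is_gtree G T'" using p unfolding contraction_def by (rule conjunct1)
qed

sublocale p: collapse G T T' p
  using contraction_collapses_to(1)[OF p _ gtrees(1)] by (intro collapseI gtrees) auto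

text \<open>What \<open>p\<close> identifies is joined by non-surviving edges, and by the definition
  of survival \<open>f\<close> collapses each of them.\<close>

lemma red_collapse:
  assumes R: "R \<in> red_trees G D T" and f: "collapse_map G T R f"
  obtains h where "collapse G T' R h" "\<And>u. u \<in> verts T \<Longrightarrow> h (p u) = f u"
proof -
  note f' = collapse_map_collapses_to[OF f]
  have "f u = f v" if uv: "u \<in> verts T" "v \<in> verts T" "p u = p v" for u v
  proof -
    have "(u, v) \<in> {e \<in> edges T. \<not> surviving G D T e}\<^sup>*"
      using p uv unfolding contraction_def by blast
    then show ?thesis
    proof (induction rule: rtrancl_induct)
      case (step y z)
      then show ?case using R f unfolding surviving_def by auto
    qed simp
  qed
  then obtain h where "collapses_to G T' R h" "\<And>u. u \<in> verts T \<Longrightarrow> h (p u) = f u"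
    using collapses_to_factor[OF f'(1,3) p.collapses] by metis
  then show thesis using that collapseI[OF gtrees(2) f'(2)] by blast
qed

lemma red_in_D: "R \<in> red_trees G D T \<Longrightarrow> \<exists>l. (R, l) \<in> D"
  unfolding red_trees_def Col_trees_def by blast

text \<open>Without a reduced tree below \<open>T\<close> no edge survives, so \<open>T'\<close> is
  a single vertex. This case stands apart since the comparison with a reduced tree, on which
  \<open>in_D\<close> and \<open>survivor\<close> rest, is then missing.\<close>

lemma point:
  assumes "red_trees G D T = {}"
  shows "card (quotient_verts G T') \<le> 1"
proof -
  have "p u = p v" if "u \<in> verts T" "v \<in> verts T" for u v
  proof -
    have "{e \<in> edges T. \<not> surviving G D T e} = edges T" using assms unfolding surviving_def by auto
    then show ?thesis using p that p.T.connected[OF that] unfolding contraction_def by simp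
  qed
  moreover obtain v where "v \<in> verts T" using p.T.nonempty by blast
  ultimately have "verts T' \<subseteq> {p v}" using p.h_surj by blast
  then have "quotient_verts G T' \<subseteq> {p.R.orb (p v)}" unfolding p.R.quotient_verts_eq by blast
  then show ?thesis using card_mono[of "{p.R.orb (p v)}" "quotient_verts G T'"] by simp
qed

text \<open>\<open>T'\<close> lies between \<open>T\<close> and \<open>R\<close>, which have the
  same elliptic subgroups, and a collapse preserves ellipticity.\<close>

lemma elliptic_iff_T0:
  assumes R: "R \<in> red_trees G D T" and H: "subgroup H G"
  shows "elliptic T' H \<longleftrightarrow> elliptic T0 H"
proof -
  have Hc: "H \<subseteq> carrier G" using subgroup.subset[OF H] .
  obtain f where f: "collapse_map G T R f" using R unfolding red_trees_def dominates_def by blast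
  obtain h where h: "collapse G T' R h" using red_collapse[OF R f] by metis
  have "elliptic T H \<longleftrightarrow> elliptic T0 H" "elliptic R H \<longleftrightarrow> elliptic T0 H"
    using T red_in_D[OF R] deformation_spaceD(2)[OF _ H] unfolding D Col_trees_def by blast+
  then show ?thesis using p.elliptic_collapse[OF Hc] collapse.elliptic_collapse[OF h Hc] by blast
qed

lemma in_D:
  assumes "R \<in> red_trees G D T"
  shows "(T', \<lambda>_. 1) \<in> D"
  unfolding D by (rule deformation_spaceI[OF gtrees(2) elliptic_iff_T0[OF assms]])

text \<open>A lift of the edge to \<open>T\<close> is not contracted by \<open>p\<close>, so it
  survives in some reduced \<open>R\<close>, and the map to \<open>R\<close> factors through
  \<open>T'\<close>. Since \<open>R\<close> and \<open>T'\<close> have the same elliptic subgroups,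
  the conditions of \<open>reduced_collapse\<close> hold.\<close>

lemma survivor:
  assumes "(v, u) \<in> edges T'"
  obtains R h where "R \<in> red_trees G D T" "reduced_collapse G T' R h" "h v \<noteq> h u"
proof -
  obtain x y where xy: "(x, y) \<in> edges T" "p x = v" "p y = u" using p.edge_lift[OF assms] by blast
  have "p x \<noteq> p y" using xy p.R.edge_verts(3)[OF assms] by simp
  then have "surviving G D T (x, y)"
    using contraction_collapses_to(2)[OF p _ gtrees(1) xy(1)] xy(1) by auto
  then obtain R f where R: "R \<in> red_trees G D T" and f: "collapse_map G T R f" "f x \<noteq> f y"
    unfolding surviving_def by auto
  obtain h where h: "collapse G T' R h" and hp: "\<And>u. u \<in> verts T \<Longrightarrow> h (p u) = f u"
    using red_collapse[OF R f(1)] by metis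
  interpret h: collapse G T' R h by fact
  have "elliptic T' (h.R.St r)" if r: "r \<in> verts R" for r
  proof -
    have s: "subgroup (h.R.St r) G" using h.R.St_subgroup[OF r] .
    have "elliptic R (h.R.St r)" using r h.R.elliptic_iff[OF h.R.St_carrier] by blast
    then have "elliptic T0 (h.R.St r)"
      using red_in_D[OF R] deformation_spaceD(2)[OF _ s] unfolding D by blast
    then show ?thesis using elliptic_iff_T0[OF R s] by blast
  qed
  then have "reduced_collapse G T' R h"
    using R h unfolding reduced_collapse_def reduced_collapse_axioms_def red_trees_def by blast
  then show thesis using that R hp xy f(2) p.T.edge_verts[OF xy(1)] by metis
qed

text \<open>The bound involves only the generators and the base tree \<open>T0\<close> with a vertex
  stabilizer \<open>K\<close>, so it is uniform over all \<open>T\<close>.\<close>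

lemma card_quotient_verts_TW:
  assumes S: "S \<subseteq> carrier G" "generate G S = carrier G" "finite S"
    and T0: "is_gtree G T0" and x0: "x0 \<in> verts T0" and red: "red_trees G D T \<noteq> {}"
    and hyp: "non_ascending_space G D \<or>
      (locally_finite_space D \<and> (\<forall>(T, l)\<in>D. quotient_betti1 G T \<le> 1))"
  defines "K \<equiv> vertex_stab G T0 x0"
  shows "card (quotient_verts G T') \<le> 2 * card S + 3 * (card (quotient_verts G T0) +
    nat \<lfloor>(\<Sum>s\<in>S. \<bar>ln (group.index_ratio G (group.conj_set G s K) K)\<bar>) / ln 2\<rfloor>)"
proof -
  interpret T0: G_tree G T0 using G_treeI[OF T0] .
  let ?B = "\<Sum>s\<in>S. \<bar>ln (group.index_ratio G (group.conj_set G s K) K)\<bar>"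
  let ?L = "p.R.orb ` {v. \<exists>u. p.R.stab_leaf v u}"
  obtain R0 where R0: "R0 \<in> red_trees G D T" using red by blast
  have leaves: "card ?L \<le> nat \<lfloor>?B / ln 2\<rfloor>"
    using hyp
  proof
    assume na: "non_ascending_space G D"
    have "\<not> p.R.stab_leaf v u" for v u
    proof
      assume vu: "p.R.stab_leaf v u"
      then obtain R h where R: "R \<in> red_trees G D T" "reduced_collapse G T' R h" "h v \<noteq> h u"
        using survivor unfolding p.R.stab_leaf_def by metis
      then have "has_ascending_loop G R"
        using reduced_collapse.stab_leaf_loop[OF R(2) vu R(3)] by metis
      then show False using na red_in_D[OF R(1)] unfolding non_ascending_space_def by blast
    qed
    then show ?thesis by simp
  next
    assume lf: "locally_finite_space D \<and> (\<forall>(T, l)\<in>D. quotient_betti1 G T \<le> 1)"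
    have T'D: "(T', \<lambda>_. 1) \<in> D" using in_D[OF R0] .
    have "(T0, \<lambda>_. 1) \<in> D" unfolding D using deformation_spaceI[OF T0] by blast
    then have lf0: "locally_finite_gtree T0" and lf': "locally_finite_gtree T'"
      and b1: "quotient_betti1 G T' \<le> 1"
      using lf T'D unfolding locally_finite_space_def by auto
    note comm0 = T0.locally_finite_commensurable[OF lf0] and comm = p.R.locally_finite_commensurable[OF lf']
    have K: "subgroup K G" unfolding K_def using T0.St_subgroup[OF x0] .
    have KT': "elliptic T' K"
      unfolding elliptic_iff_T0[OF R0 K] using x0 T0.elliptic_iff[OF T0.St_carrier] unfolding K_def by blast
    \<comment> \<open>The two finite indices come from different trees: \<open>p.R.St x\<close> lies
      in a stabilizer of \<open>T0\<close>, commensurable with \<open>K\<close>, while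
      \<open>K\<close> lies in a stabilizer of \<open>T'\<close>, commensurable with
      \<open>p.R.St x\<close>.\<close>
    have "p.T.commensurable (p.R.St x) K" if x: "x \<in> verts T'" for x
    proof -
      have "elliptic T' (p.R.St x)" using x p.R.elliptic_iff[OF p.R.St_carrier] by blast
      then have "elliptic T0 (p.R.St x)" using elliptic_iff_T0[OF R0 p.R.St_subgroup[OF x]] by blast
      then obtain y where y: "y \<in> verts T0" "p.R.St x \<subseteq> T0.St y" using T0.elliptic_iff[OF p.R.St_carrier] by blast
      obtain z where z: "z \<in> verts T'" "K \<subseteq> p.R.St z"
        using KT' p.R.elliptic_iff[OF subgroup.subset[OF K]] by blast
      show ?thesis
        using comm0[OF y(1) x0] comm[OF z(1) x] p.T.finite_cosets_subset y(2) z(2)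
        unfolding p.T.commensurable_def K_def by blast
    qed
    moreover have "\<exists>R h. reduced_collapse G T' R h \<and> h v \<noteq> h u" if "p.R.stab_leaf v u" for v u
      using survivor that unfolding p.R.stab_leaf_def by metis
    ultimately have "real (card ?L) * ln 2 \<le> ?B"
      by (intro p.R.card_stab_leaf_orbits_le[OF S b1 _ comm K])
    then have "real (card ?L) \<le> ?B / ln 2" by (simp add: pos_le_divide_eq)
    then show ?thesis by (rule le_nat_floor)
  qed
  have "no_subdivision_vertices G T'"
    using p.no_subdivision_collapse T unfolding Col_trees_def by blast
  note p.R.card_quotient_verts_le[OF S this]
  moreover have "card (p.R.orb ` {v. p.R.rigid v}) \<le> card (quotient_verts G T0)"
    using p.R.card_rigid_orbits(2)[OF G_treeI[OF T0] T0.finite_quotient(1)[OF S]] elliptic_iff_T0[OF R0] by blast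
  moreover have "a \<le> 2 * s + 3 * (r' + l')"
    if "a \<le> 2 * s + 3 * (r + l)" "r \<le> r'" "l \<le> l'" for a s r r' l l' :: nat
    by (rule order_trans[OF that(1)]) (intro add_left_mono mult_left_mono add_mono that zero_le)
  ultimately show ?thesis using leaves by blast
qed

end

theorem theorem1p18:
  fixes G :: "('g, 'b) monoid_scheme"
    and T0 :: "('g, 'v) gtree"
    and D :: "('g, 'v) defspace"
  assumes "infinite (UNIV :: 'v set)"
    and "finitely_generated_group G"
    and "is_gtree G T0"
    and "D = deformation_space G T0"
    and "irreducible_space G D"
    and "non_ascending_space G D \<or>
         (locally_finite_space D \<and> (\<forall>(T, l)\<in>D. quotient_betti1 G T \<le> 1))"
  shows "finite_dimensional_complex (W_complex G D)"
proof -
  obtain S where S: "S \<subseteq> carrier G" "generate G S = carrier G" "finite S"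
    using assms(2) unfolding finitely_generated_group_def by blast
  obtain x0 where x0: "x0 \<in> verts T0"
    using assms(3) unfolding is_gtree_def is_tree_def by blast
  define K where "K = vertex_stab G T0 x0"
  \<comment> \<open>The final summand 1 covers the one-vertex tree of \<open>point\<close>.\<close>
  define N where "N = 2 * card S + 3 * (card (quotient_verts G T0) +
    nat \<lfloor>(\<Sum>s\<in>S. \<bar>ln (group.index_ratio G (group.conj_set G s K) K)\<bar>) / ln 2\<rfloor>) + 1"
  have "\<exists>T. X = iso_class G T \<and> is_gtree G T \<and> card (quotient_verts G T) \<le> N"
    if X: "X \<in> W_poset G D" for X
  proof -
    obtain T T' p where W: "X = iso_class G T'" "T \<in> Col_trees G D"
      "contraction G {e \<in> edges T. \<not> surviving G D T e} T T' p"
      using X unfolding W_poset_def is_TW_def by blast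
    interpret TW_collapse G T0 T T' D p using assms(4) W by unfold_locales
    have "card (quotient_verts G T') \<le> N"
      using card_quotient_verts_TW[OF S assms(3) x0 _ assms(6)] point unfolding N_def K_def
      by (cases "red_trees G D T = {}") auto
    then show ?thesis using W(1) gtrees by blast
  qed
  then show ?thesis
    using order_complex_bounded[OF S, of "W_poset G D" N]
    unfolding finite_dimensional_complex_def W_complex_def by blast
qed

end
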